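(* Let $\alpha_1,\alpha_2>-1$ with $\alpha_1-\alpha_2\notin\mathbb Z$, and let $\beta=0$. Let $\theta\in(0,1)$ be fixed, and let $\vec n=(n_1,n_2)$ run through multi-indices tending to infinity with $n_1+n_2=2n$ and $\frac{n_2}{n_1+n_2}=\frac{\theta}{2}$ (so $n_2=\theta n\in\mathbb Z$ and $n_1=(2-\theta)n$). Let $P_{\vec n}$ be the monic polynomial of degree $n_1+n_2$ satisfying $\int_0^1P_{\vec n}(x)x^kx^{\alpha_j}\,dx=0$ for $k=0,\dots,n_j-1$, $j=1,2$. Then, uniformly for $z$ in compact subsets of $\mathbb C\setminus[0,1]$, as $n\to\infty$, $$P_{\vec n}(z)=\frac{4^{\alpha_1}(\varphi_0(z)-\theta_1)}{[(2+\theta)(4-\theta)]^{\alpha_1}}\;\frac{(\varphi_0(z)-\theta_2)^{\alpha_2-\alpha_1+1}\,\varphi_0(z)^{2\alpha_1-\alpha_2}}{z^{\alpha_1}\sqrt{\mathcal D(\varphi_0(z))}}\;e^{n\tilde H_0(z)}\Big(1+O\Big(\frac1n\Big)\Big).$$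
   Context: Notation, for $\theta\in(0,1)$: $\theta_1=\frac{2-\theta}{4-\theta}$, $\theta_2=\frac{\theta}{2+\theta}$, $c_0=\frac{4}{(2+\theta)(4-\theta)}$, and $$R(s)=\frac{c_0s^3}{(s-\theta_1)(s-\theta_2)}.$$ $\varphi_0$ is the holomorphic function on $\mathbb C\setminus[0,1]$ with $R(\varphi_0(z))=z$ and $\varphi_0(z)=z/c_0+O(1)$ as $z\to\infty$. It maps the upper (lower) half-plane into the upper (lower) half-plane. $\mathcal D(s)=s^2(s-1)(s-3\theta_1\theta_2)$, and $\sqrt{\mathcal D(\varphi_0(z))}$ is the branch holomorphic in $\mathbb C\setminus[0,1]$ that is positive for large positive $z$ (so it behaves like $\varphi_0(z)^2$ at infinity). The powers $(\varphi_0(z)-\theta_2)^{\alpha_2-\alpha_1+1}$, $\varphi_0(z)^{2\alpha_1-\alpha_2}$, $z^{\alpha_1}$ are principal branches; their combination in the formula is continuous across $(-\infty,0)$ and is understood there by continuity. $H_0(z)=(2-\theta)\ln(\varphi_0(z)-\theta_1)+\theta\ln(\varphi_0(z)-\theta_2)+C$ (principal logarithms, $z\in\mathbb C\setminus(-\infty,1]$) with $C=(2-\theta)\ln\frac1{\theta_1}+\theta\ln\frac1{\theta_2}$; $C_0=C+2\ln\frac1{c_0}$; and $\tilde H_0=H_0-C_0$. For $n\in\mathbb N$ with $\theta n\in\mathbb Z$, $e^{n\tilde H_0(z)}=c_0^{2n}(\varphi_0(z)-\theta_1)^{(2-\theta)n}(\varphi_0(z)-\theta_2)^{\theta n}$ extends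 holomorphically to $\mathbb C\setminus[0,1]$. *)

theory Defs
  imports
    "HOL-Complex_Analysis.Complex_Analysis"
    "HOL-Library.Landau_Symbols"
begin

definition \<theta>1 :: "real \<Rightarrow> real" where
  "\<theta>1 \<theta> = (2 - \<theta>) / (4 - \<theta>)"

definition \<theta>2 :: "real \<Rightarrow> real" where
  "\<theta>2 \<theta> = \<theta> / (2 + \<theta>)"

definition c0 :: "real \<Rightarrow> real" where
  "c0 \<theta> = 4 / ((2 + \<theta>) * (4 - \<theta>))"

definition R_map :: "real \<Rightarrow> complex \<Rightarrow> complex" where
  "R_map \<theta> s = of_real (c0 \<theta>) * s ^ 3 / ((s - of_real (\<theta>1 \<theta>)) * (s - of_real (\<theta>2 \<theta>)))"

definition slit_plane :: "complex set" where
  "slit_plane = - (complex_of_real ` {0..1})"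

text \<open>The inverse branch of the rational function at infinity; at most one function on the
  slit plane has this property. At its poles \<open>R_map\<close> is totalised to 0, which is not in the slit
  plane, so the equation forces the values to avoid both poles.\<close>

definition is_phi0 :: "real \<Rightarrow> (complex \<Rightarrow> complex) \<Rightarrow> bool" where
  "is_phi0 \<theta> \<phi> \<longleftrightarrow>
     \<phi> holomorphic_on slit_plane \<and>
     (\<forall>z\<in>slit_plane. R_map \<theta> (\<phi> z) = z) \<and>
     (\<lambda>z. \<phi> z - z / of_real (c0 \<theta>)) \<in> O[at_infinity](\<lambda>_. 1)"

definition D_poly :: "real \<Rightarrow> complex \<Rightarrow> complex" where
  "D_poly \<theta> s = s\<^sup>2 * (s - 1) * (s - of_real (3 * \<theta>1 \<theta> * \<theta>2 \<theta>))"

definition is_sqrt_D :: "real \<Rightarrow> (complex \<Rightarrow> complex) \<Rightarrow> (complex \<Rightarrow> complex) \<Rightarrow> bool" where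
  "is_sqrt_D \<theta> \<phi> S \<longleftrightarrow>
     S holomorphic_on slit_plane \<and>
     (\<forall>z\<in>slit_plane. (S z)\<^sup>2 = D_poly \<theta> (\<phi> z)) \<and>
     (\<forall>\<^sub>F x::real in at_top. S (of_real x) \<in> \<real> \<and> 0 < Re (S (of_real x)))"

definition C_const :: "real \<Rightarrow> real" where
  "C_const \<theta> = (2 - \<theta>) * ln (1 / \<theta>1 \<theta>) + \<theta> * ln (1 / \<theta>2 \<theta>)"

definition C0_const :: "real \<Rightarrow> real" where
  "C0_const \<theta> = C_const \<theta> + 2 * ln (1 / c0 \<theta>)"

definition H0 :: "real \<Rightarrow> (complex \<Rightarrow> complex) \<Rightarrow> complex \<Rightarrow> complex" where
  "H0 \<theta> \<phi> z = of_real (2 - \<theta>) * Ln (\<phi> z - of_real (\<theta>1 \<theta>))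
     + of_real \<theta> * Ln (\<phi> z - of_real (\<theta>2 \<theta>)) + of_real (C_const \<theta>)"

text \<open>When \<open>\<theta> * n\<close> is an integer, \<open>exp (n * H0_tilde \<theta> \<phi> z)\<close> equals
  \<open>c0^(2n) * (\<phi> z - \<theta>1)^((2-\<theta>)n) * (\<phi> z - \<theta>2)^(\<theta>n)\<close> with integer exponents whatever logarithms
  are chosen, so on the negative axis it is the value of the holomorphic extension.\<close>

definition H0_tilde :: "real \<Rightarrow> (complex \<Rightarrow> complex) \<Rightarrow> complex \<Rightarrow> complex" where
  "H0_tilde \<theta> \<phi> z = H0 \<theta> \<phi> z - of_real (C0_const \<theta>)"

text \<open>The complex \<open>powr\<close> is the principal one, with argument \<open>pi\<close> on the negative axis, i.e.
  continuous there from above. For \<open>z < 0\<close> both \<open>\<phi> z\<close> and \<open>\<phi> z - \<theta>2\<close> are negative, and they are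
  approached from the upper half-plane together with \<open>z\<close>; so the expression below is the limit
  from above. The limit from below is the same, because the exponents of the three powers
  (the last one with a minus sign) add up to 1. Hence the value on the negative axis is the one
  given by continuity.\<close>

definition prefactor ::
  "real \<Rightarrow> real \<Rightarrow> real \<Rightarrow> (complex \<Rightarrow> complex) \<Rightarrow> (complex \<Rightarrow> complex) \<Rightarrow> complex \<Rightarrow> complex" where
  "prefactor \<alpha>1 \<alpha>2 \<theta> \<phi> S z =
     of_real (4 powr \<alpha>1) * (\<phi> z - of_real (\<theta>1 \<theta>)) / of_real (((2 + \<theta>) * (4 - \<theta>)) powr \<alpha>1)
     * ((\<phi> z - of_real (\<theta>2 \<theta>)) powr of_real (\<alpha>2 - \<alpha>1 + 1) * \<phi> z powr of_real (2 * \<alpha>1 - \<alpha>2)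
        / (z powr of_real \<alpha>1 * S z))"

definition is_monic_MOP :: "real \<Rightarrow> real \<Rightarrow> nat \<Rightarrow> nat \<Rightarrow> complex poly \<Rightarrow> bool" where
  "is_monic_MOP \<alpha>1 \<alpha>2 n1 n2 P \<longleftrightarrow>
     lead_coeff P = 1 \<and> degree P = n1 + n2 \<and>
     (\<forall>k<n1. ((\<lambda>x::real. poly P (of_real x) * of_real (x ^ k * x powr \<alpha>1)) has_integral 0) {0..1}) \<and>
     (\<forall>k<n2. ((\<lambda>x::real. poly P (of_real x) * of_real (x ^ k * x powr \<alpha>2)) has_integral 0) {0..1})"

end

theory Submission
  imports Defs "HOL-Computational_Algebra.Fundamental_Theorem_Algebra"
begin

text \<open>
Since \<open>\<alpha>1 - \<alpha>2\<close> is not an integer, the orthogonality conditions prescribe all zeros of the numerator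
of \<open>\<Sum>k. p k / (s + k + 1)\<close>, where the \<open>p k\<close> are the coefficients of \<open>P\<close>. Hence the coefficients are
explicit, \<open>P\<close> arises from \<open>(1 - x) ^ (n1 + n2)\<close> by operators \<open>x * d/dx + c\<close> with \<open>c > 0\<close>, which keep
all zeros in \<open>[0, 1]\<close>, and \<open>P\<close> solves a hypergeometric differential equation of third order.

In the variable \<open>w = 1 / z\<close> the slit plane together with \<open>\<infinity>\<close> becomes the plane cut along \<open>[1, \<infinity>)\<close>, which
is star-shaped about \<open>0\<close>. Let \<open>T w = w ^ (2 * n) * P (1 / w)\<close>. Because the zeros lie in \<open>[0, 1]\<close>,
\<open>U = w * T' / (n * T)\<close> is bounded on compact sets uniformly in \<open>n\<close>, and by Cauchy's estimates so are its
derivatives. The differential equation therefore says that \<open>U\<close> satisfies a cubic equation up to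
\<open>O(1/n)\<close>. One of the roots of the cubic is \<open>U0 = - 2 * \<psi> / (1 - \<psi>)\<close> with \<open>\<psi> w = 1 / \<phi>0 (1 / w)\<close>; it is
simple everywhere, and \<open>U = U0\<close> at \<open>w = 0\<close>, so \<open>U = U0 + O(1/n)\<close> by connectedness. Inserting this
once more gives \<open>U = U0 + U1 / n + O(1/n\<^sup>2)\<close>, where \<open>n * U0 + U1\<close> is the logarithmic derivative of
the claimed main term. Integrating from \<open>w = 0\<close> yields the relative error \<open>O(1/n)\<close>.
\<close>

section \<open>Coefficients and zeros of the orthogonal polynomials\<close>

text \<open>The cubic has a rational parametrization: \<open>U = - 2 * s / (1 - s)\<close> turns it
  into \<open>4 * w = s * ((4 - \<theta>) - (2 - \<theta>) * s) * ((2 + \<theta>) - \<theta> *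
  s)\<close>, which is \<open>R_map \<theta> (1 / s) = 1 / w\<close>; this is how \<phi>0 enters. At
  this root the derivative of the cubic is \<open>(4 - \<theta>) * (2 + \<theta>) * (1 - 3 *
  \<theta>1 * \<theta>2 * s)\<close>, so simplicity of the root means that \<phi>0 omits the last
  zero of \<open>D_poly\<close>. A formal expansion in powers of 1/n solves the differential
  equation but says nothing about the polynomial itself. The bound on \<open>U\<close> closes this
  gap: terms with derivatives of \<open>U\<close> carry fewer powers of n than the cubic and stay
  bounded by Cauchy's estimates, so they only perturb an algebraic equation. Two orders of
  \<open>U\<close> are needed because the logarithm of \<open>T\<close> is n times the integral of
  \<open>U / w\<close>: an error of order \<open>1 / n^2\<close> in \<open>U\<close> becomes one of
  order \<open>1 / n\<close>.\<close>

definition shifted_euler :: "'a \<Rightarrow> 'a poly \<Rightarrow> 'a::{comm_ring_1,ring_no_zero_divisors} poly" where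
  "shifted_euler c p = pCons 0 (pderiv p) + smult c p"

lemma coeff_shifted_euler: "coeff (shifted_euler c p) k = (of_nat k + c) * coeff p k"
  by (cases k) (simp_all add: shifted_euler_def coeff_pderiv algebra_simps)

lemma poly_shifted_euler: "poly (shifted_euler c p) x = x * poly (pderiv p) x + c * poly p x"
  by (simp add: shifted_euler_def)

lemma poly_pderiv_prod_linear:
  fixes x :: "'a::field"
  assumes "poly (\<Prod>r\<leftarrow>rs. [:-r, 1:]) x \<noteq> 0"
  shows "poly (pderiv (\<Prod>r\<leftarrow>rs. [:-r, 1:])) x =
    poly (\<Prod>r\<leftarrow>rs. [:-r, 1:]) x * (\<Sum>r\<leftarrow>rs. 1 / (x - r))"
  using assms
  by (induction rs) (auto simp: pderiv_mult pderiv_pCons field_simps simp del: mult_pCons_left)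

lemma complex_poly_eq_prod_list:
  fixes p :: "complex poly"
  obtains rs where "p = smult (lead_coeff p) (\<Prod>r\<leftarrow>rs. [:-r, 1:])"
proof -
  obtain rs where rs: "mset rs = proots p" using ex_mset by blast
  have "p = smult (lead_coeff p) (\<Prod>x\<in>#proots p. [:-x, 1:])"
    by (rule complex_poly_decompose_multiset [symmetric])
  also have "(\<Prod>x\<in>#proots p. [:-x, 1:]) = (\<Prod>x\<leftarrow>rs. [:-x, 1:])"
    by (subst prod_mset_prod_list [symmetric]) (simp add: rs)
  finally show ?thesis by (rule that)
qed

lemma sum_list_Re: "Re (sum_list xs) = sum_list (map Re xs)"
  by (induction xs) auto

lemma sum_list_Im: "Im (sum_list xs) = sum_list (map Im xs)"
  by (induction xs) auto

text \<open>For real \<open>x\<close> outside the interval each summand is nonnegative, since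
  \<open>x\<close> and \<open>x - r\<close> have the same sign. For nonreal \<open>x\<close> the
  real part of a summand may be negative, but the imaginary parts all have the sign of
  \<open>- Im x\<close> or vanish; as their sum is 0, every \<open>r\<close> is 0 and every summand
  is 1.\<close>

lemma sum_over_unit_interval_ne_negative:
  fixes rs :: "real list" and c :: real and x :: complex
  assumes rs: "set rs \<subseteq> {0..1}" and c: "c > 0" and x: "x \<notin> of_real ` {0..1}"
  shows "(\<Sum>r\<leftarrow>rs. x / (x - of_real r)) \<noteq> - of_real c"
proof
  assume eq: "(\<Sum>r\<leftarrow>rs. x / (x - of_real r)) = - of_real c"
  have Re_eq: "(\<Sum>r\<leftarrow>rs. Re (x / (x - of_real r))) = - c"
    using arg_cong[OF eq, of Re] by (simp add: sum_list_Re o_def)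
  have Im_eq: "(\<Sum>r\<leftarrow>rs. Im (x / (x - of_real r))) = 0"
    using arg_cong[OF eq, of Im] by (simp add: sum_list_Im o_def)
  have nonneg: "Re (x / (x - of_real r)) \<ge> 0" if r: "r \<in> set rs" for r
  proof (cases "Im x = 0")
    case True
    then have xr: "x = of_real (Re x)" by (simp add: complex_eq_iff)
    have "Re x < 0 \<or> Re x > 1" using x xr by (metis atLeastAtMost_iff image_eqI not_le)
    moreover have "0 \<le> r" "r \<le> 1" using rs r by auto
    moreover have "Re (x / (x - of_real r)) = Re x / (Re x - r)"
      by (subst (1 2) xr) (metis Re_complex_of_real of_real_diff of_real_divide)
    ultimately show ?thesis by (auto intro: divide_nonneg_nonneg divide_nonpos_nonpos)
  next
    case False
    define d where "d r = (Re x - r)\<^sup>2 + (Im x)\<^sup>2" for r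
    have d: "d r > 0" for r using False unfolding d_def by (simp add: add_nonneg_pos)
    have Im_term: "Im (x / (x - of_real r)) = - Im x * (r / d r)" for r
      by (simp add: Im_divide d_def) (simp add: field_simps)
    have "(\<Sum>r\<leftarrow>rs. - Im x * (r / d r)) = 0" using Im_eq by (simp only: Im_term)
    then have "- Im x * (\<Sum>r\<leftarrow>rs. r / d r) = 0" by (simp only: sum_list_const_mult)
    then have "(\<Sum>r\<leftarrow>rs. r / d r) = 0" using False by simp
    then have "r / d r = 0"
      using rs d r by (subst (asm) sum_list_nonneg_eq_0_iff) (force intro!: divide_nonneg_pos)+
    then have "r = 0" using d[of r] by simp
    then show ?thesis by (cases "x = 0") auto
  qed
  have "(\<Sum>r\<leftarrow>rs. Re (x / (x - of_real r))) \<ge> 0"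
    by (intro sum_list_nonneg) (use nonneg in auto)
  then show False using Re_eq c by simp
qed

definition roots_in_unit_interval :: "complex poly \<Rightarrow> bool" where
  "roots_in_unit_interval p \<longleftrightarrow> p \<noteq> 0 \<and> (\<forall>x. poly p x = 0 \<longrightarrow> x \<in> of_real ` {0..1})"

lemma roots_in_unit_interval_factorization:
  assumes "roots_in_unit_interval p"
  obtains rs :: "real list" where "set rs \<subseteq> {0..1}"
    "p = smult (lead_coeff p) (\<Prod>r\<leftarrow>rs. [:- of_real r, 1:])"
proof -
  obtain zs where zs: "p = smult (lead_coeff p) (\<Prod>r\<leftarrow>zs. [:-r, 1:])"
    by (rule complex_poly_eq_prod_list)
  have "poly p z = 0" if "z \<in> set zs" for z
  proof -
    have "poly (\<Prod>r\<leftarrow>zs. [:-r, 1:]) z = 0"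
      using that by (induction zs) auto
    then show ?thesis by (subst zs) simp
  qed
  then have zreal: "z \<in> of_real ` {0..1}" if "z \<in> set zs" for z
    using assms that by (auto simp: roots_in_unit_interval_def)
  then have "map (of_real \<circ> Re) zs = zs"
    by (intro map_idI) (force simp del: of_real_eq_id)
  then have "(\<Prod>r\<leftarrow>zs. [:-r, 1:]) = (\<Prod>r\<leftarrow>map Re zs. [:- of_real r, 1:])"
    by (metis (no_types, lifting) comp_apply map_eq_conv map_map)
  moreover have "set (map Re zs) \<subseteq> {0..1}" using zreal by force
  ultimately show ?thesis using zs that by metis
qed

text \<open>Outside the interval \<open>p\<close> does not vanish, and dividing
  \<open>x * p' + c * p = 0\<close> by \<open>p\<close> gives a sum of terms
  \<open>x / (x - r)\<close> equal to \<open>- c\<close>, which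
  \<open>sum_over_unit_interval_ne_negative\<close> excludes.\<close>

lemma roots_in_unit_interval_shifted_euler:
  assumes p: "roots_in_unit_interval p" and c: "c > 0"
  shows "roots_in_unit_interval (shifted_euler (of_real c) p)"
  unfolding roots_in_unit_interval_def
proof (intro conjI allI impI)
  have "of_nat k + complex_of_real c \<noteq> 0" for k :: nat
    using c by (metis add_cancel_right_left add_pos_nonneg of_nat_0_le_iff of_real_add of_real_eq_0_iff of_real_of_nat_eq order_less_irrefl add.commute)
  then show "shifted_euler (of_real c) p \<noteq> 0"
    using p by (auto simp: roots_in_unit_interval_def poly_eq_iff coeff_shifted_euler)
next
  fix x assume x: "poly (shifted_euler (of_real c) p) x = 0"
  show "x \<in> of_real ` {0..1}"
  proof (rule ccontr)
    assume nx: "x \<notin> of_real ` {0..1}"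
    then have px: "poly p x \<noteq> 0" using p by (auto simp: roots_in_unit_interval_def)
    obtain rs :: "real list" where rs: "set rs \<subseteq> {0..1}"
      and prs: "p = smult (lead_coeff p) (\<Prod>r\<leftarrow>rs. [:- of_real r, 1:])"
      using roots_in_unit_interval_factorization[OF p] .
    define q where "q = (\<Prod>r\<leftarrow>map of_real rs. [:- r, 1::complex:])"
    have pq: "p = smult (lead_coeff p) q" using prs by (simp add: q_def o_def)
    have qx: "poly q x \<noteq> 0" using px by (subst (asm) pq) auto
    have "poly (pderiv p) x = lead_coeff p * poly (pderiv q) x"
      by (subst pq) (simp add: pderiv_smult)
    also have "poly (pderiv q) x = poly q x * (\<Sum>r\<leftarrow>map of_real rs. 1 / (x - r))"
      using qx unfolding q_def by (rule poly_pderiv_prod_linear)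
    finally have "poly (pderiv p) x = poly p x * (\<Sum>r\<leftarrow>rs. 1 / (x - of_real r))"
      using arg_cong[OF pq, of "\<lambda>p. poly p x"] by (simp add: o_def)
    then have "poly p x * (x * (\<Sum>r\<leftarrow>rs. 1 / (x - of_real r)) + of_real c) = 0"
      using x by (simp add: poly_shifted_euler algebra_simps)
    then have "x * (\<Sum>r\<leftarrow>rs. 1 / (x - of_real r)) + of_real c = 0" using px by simp
    then have "(\<Sum>r\<leftarrow>rs. x / (x - of_real r)) = - of_real c"
      by (simp add: sum_list_const_mult[symmetric] eq_neg_iff_add_eq_0)
    then show False using sum_over_unit_interval_ne_negative[OF rs c nx] by simp
  qed
qed

text \<open>\<open>pochhammer (a + k) m\<close> is the product of the factors
  \<open>k + (a + j)\<close> for \<open>j < m\<close>, and each factor is the effect of one operator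
  \<open>shifted_euler (a + j)\<close> on coefficient \<open>k\<close>.\<close>

lemma roots_in_unit_interval_pochhammer:
  assumes p: "roots_in_unit_interval p" and a: "a > (0::real)"
  shows "\<exists>q. roots_in_unit_interval q \<and>
    (\<forall>k. coeff q k = coeff p k * pochhammer (of_real a + of_nat k) m)"
proof (induction m)
  case 0
  then show ?case using p by auto
next
  case (Suc m)
  then obtain q where q: "roots_in_unit_interval q"
    "\<And>k. coeff q k = coeff p k * pochhammer (of_real a + of_nat k) m" by blast
  have "roots_in_unit_interval (shifted_euler (of_real (a + m)) q)"
    using q(1) a by (intro roots_in_unit_interval_shifted_euler) auto
  then show ?case
    by (rule_tac exI[of _ "shifted_euler (of_real (a + m)) q"])
       (auto simp: coeff_shifted_euler q(2) pochhammer_Suc mult_ac add_ac)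
qed

text \<open>The \<open>p k\<close> are the residues of the sum of simple fractions, whose numerator has degree at most
  \<open>N\<close> and hence is fixed up to a factor by the zeros in \<open>Z\<close>.\<close>

lemma partial_fraction_coeffs:
  fixes p :: "nat \<Rightarrow> 'a::field_char_0" and Z :: "'a set"
  assumes Z: "finite Z" "card Z = N"
    and poles: "\<And>\<zeta> k. \<zeta> \<in> Z \<Longrightarrow> \<zeta> + of_nat k + 1 \<noteq> 0"
    and zeros: "\<And>\<zeta>. \<zeta> \<in> Z \<Longrightarrow> (\<Sum>k\<le>N. p k / (\<zeta> + of_nat k + 1)) = 0"
  shows "\<exists>c. \<forall>k\<le>N. p k = c * ((-1) ^ k * of_nat (N choose k) * (\<Prod>\<zeta>\<in>Z. \<zeta> + of_nat k + 1))"
proof -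
  define num where "num = (\<Sum>k\<le>N. smult (p k) (\<Prod>l\<in>{..N}-{k}. [:of_nat l + 1, 1:]))"
  define W where "W = (\<Prod>\<zeta>\<in>Z. [:-\<zeta>, 1:])"
  \<comment> \<open>Polynomials of degree at most \<open>N\<close> are compared at
    \<open>N + 1\<close> points: those of \<open>Z\<close> and \<open>-1\<close>, which is a pole
    and therefore not in \<open>Z\<close>.\<close>
  define c where "c = poly num (-1) / poly W (-1)"
  have W1: "poly W (-1) \<noteq> 0"
    using poles[of "-1" 0] Z(1) by (auto simp: W_def poly_prod prod_zero_iff minus_equation_iff[of _ 1])
  have "degree (\<Prod>l\<in>{..N}-{k}. [:of_nat l + 1, 1:] :: 'a poly) \<le> N" if "k \<le> N" for k
  proof -
    have "degree (\<Prod>l\<in>{..N}-{k}. [:of_nat l + 1, 1:] :: 'a poly) \<le> (\<Sum>l\<in>{..N}-{k}. 1)"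
      using degree_prod_sum_le[of "{..N}-{k}" "\<lambda>l. [:of_nat l + 1, 1:] :: 'a poly"] by (simp add: o_def)
    then show ?thesis using that by simp
  qed
  then have deg_num: "degree num \<le> N"
    unfolding num_def by (intro degree_sum_le) (auto intro: order.trans[OF degree_smult_le])
  have deg_W: "degree W \<le> N"
    using degree_prod_sum_le[of Z "\<lambda>\<zeta>. [:-\<zeta>, 1:]"] Z by (simp add: W_def o_def)
  have num_zero: "poly num \<zeta> = 0" if "\<zeta> \<in> Z" for \<zeta>
  proof -
    have "poly num \<zeta> = (\<Sum>k\<le>N. p k * (\<Prod>l\<in>{..N}-{k}. \<zeta> + of_nat l + 1))"
      by (simp add: num_def poly_sum poly_prod add_ac)
    also have "\<dots> = (\<Sum>k\<le>N. p k / (\<zeta> + of_nat k + 1) * (\<Prod>l\<le>N. \<zeta> + of_nat l + 1))"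
      using poles[OF that] by (intro sum.cong refl) (simp add: prod.remove[of "{..N}"])
    also have "\<dots> = 0" using zeros[OF that] unfolding sum_distrib_right[symmetric] by simp
    finally show ?thesis .
  qed
  have num_eq: "num = smult c W"
  proof (rule poly_eqI_degree[of "insert (-1) Z"])
    have "-1 \<notin> Z" using poles[of "-1" 0] by auto
    then have "card (insert (-1) Z) = N + 1" using Z by simp
    then show "card (insert (-1) Z) > degree num" "card (insert (-1) Z) > degree (smult c W)"
      using deg_num deg_W order.trans[OF degree_smult_le deg_W, of c] by simp_all
    show "poly num x = poly (smult c W) x" if "x \<in> insert (-1) Z" for x
    proof (cases "x \<in> Z")
      case True
      moreover from this have "poly W x = 0" using Z(1) by (auto simp: W_def poly_prod prod_zero_iff)
      ultimately show ?thesis using num_zero by simp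
    next
      case False
      then show ?thesis using that W1 by (simp add: c_def)
    qed
  qed
  have fact_prod: "(\<Prod>l\<in>{..N}-{k}. of_nat l - of_nat k) * of_nat (N choose k)
      = (-1) ^ k * (fact N :: 'a)" if k: "k \<le> N" for k
  proof -
    have "{..N}-{k} = {..<k} \<union> {k<..N}" using k by auto
    then have "(\<Prod>l\<in>{..N}-{k}. of_nat l - of_nat k :: 'a)
       = (\<Prod>l<k. of_nat l - of_nat k) * (\<Prod>l\<in>{k<..N}. of_nat l - of_nat k)"
      by (simp add: prod.union_disjoint[symmetric] disjoint_iff)
    also have "(\<Prod>l<k. of_nat l - of_nat k :: 'a) = (\<Prod>l<k. - of_nat (k - l))"
      by (intro prod.cong) (auto simp: of_nat_diff)
    also have "\<dots> = (-1) ^ k * (\<Prod>l<k. of_nat (k - l))"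
      by (subst prod_uminus) simp
    also have "(\<Prod>l<k. of_nat (k - l)) = (fact k :: 'a)"
      by (subst fact_prod_rev) (simp add: atLeast0LessThan)
    also have "(\<Prod>l\<in>{k<..N}. of_nat l - of_nat k) = (\<Prod>l\<in>{1..N-k}. of_nat l :: 'a)"
      by (rule prod.reindex_bij_witness[of _ "\<lambda>l. l + k" "\<lambda>l. l - k"]) (use k in \<open>auto simp: of_nat_diff\<close>)
    also have "\<dots> = fact (N - k)" by (simp add: fact_prod)
    finally show ?thesis using binomial_fact_lemma[OF k, THEN arg_cong[of _ _ "of_nat :: nat \<Rightarrow> 'a"]]
      by (simp add: mult_ac)
  qed
  have "p k = c * (-1) ^ N / fact N * ((-1) ^ k * of_nat (N choose k) * (\<Prod>\<zeta>\<in>Z. \<zeta> + of_nat k + 1))"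
    if k: "k \<le> N" for k
  proof -
    \<comment> \<open>At \<open>- k - 1\<close> all summands of \<open>num\<close> but the one for
      \<open>k\<close> vanish.\<close>
    have "poly num (- of_nat k - 1) = (\<Sum>j\<le>N. p j * (\<Prod>l\<in>{..N}-{j}. of_nat l - of_nat k))"
      by (simp add: num_def poly_sum poly_prod algebra_simps)
    also have "\<dots> = (\<Sum>j\<in>{k}. p j * (\<Prod>l\<in>{..N}-{j}. of_nat l - of_nat k))"
      by (rule sum.mono_neutral_right) (use k in \<open>auto intro!: bexI[of _ k]\<close>)
    finally have "p k * (\<Prod>l\<in>{..N}-{k}. of_nat l - of_nat k) = poly num (- of_nat k - 1)" by simp
    also have "\<dots> = c * (\<Prod>\<zeta>\<in>Z. - (\<zeta> + of_nat k + 1))"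
      by (simp add: num_eq W_def poly_prod algebra_simps)
    also have "\<dots> = c * ((-1) ^ N * (\<Prod>\<zeta>\<in>Z. \<zeta> + of_nat k + 1))"
      by (subst prod_uminus) (simp add: Z)
    finally have "p k * ((-1) ^ k * fact N) = c * ((-1) ^ N * (\<Prod>\<zeta>\<in>Z. \<zeta> + of_nat k + 1)) * of_nat (N choose k)"
      using fact_prod[OF k] by (metis mult.assoc)
    then have "p k * ((-1) ^ k * fact N) * (-1) ^ k = c * ((-1) ^ N * (\<Prod>\<zeta>\<in>Z. \<zeta> + of_nat k + 1)) * of_nat (N choose k) * (-1) ^ k"
      by simp
    moreover have "(-1) ^ k * (-1) ^ k = (1::'a)" by (simp add: power_add[symmetric])
    ultimately show ?thesis by (simp add: field_simps mult.left_commute)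
  qed
  then show ?thesis by blast
qed

text \<open>Integrating \<open>x powr (i + k + \<alpha>)\<close> gives
  \<open>1 / (i + k + \<alpha> + 1)\<close>, so the moment is the sum of simple fractions at the
  point \<open>\<alpha> + k\<close>.\<close>

lemma moment_condition:
  assumes \<alpha>: "\<alpha> > -1"
    and int: "((\<lambda>x::real. poly P (of_real x) * of_real (x ^ k * x powr \<alpha>)) has_integral 0) {0..1}"
  shows "(\<Sum>i\<le>degree P. coeff P i / (of_real (\<alpha> + real k) + of_nat i + 1)) = (0::complex)"
proof -
  have eq: "poly P (of_real x) * of_real (x ^ k * x powr \<alpha>)
      = (\<Sum>i\<le>degree P. coeff P i * of_real (x powr (real (i + k) + \<alpha>)))" if "x \<in> {0..1}" for x :: real
  \<comment> \<open>At the endpoint both sides are 0, because \<open>0 powr y = 0\<close> for every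
    \<open>y\<close>.\<close>
  proof (cases "x = 0")
    case False
    then show ?thesis using that
      by (simp add: poly_altdef sum_distrib_right powr_add powr_realpow power_add mult_ac sum_distrib_left)
  qed simp
  have "((\<lambda>x::real. \<Sum>i\<le>degree P. coeff P i * of_real (x powr (real (i + k) + \<alpha>)))
      has_integral (\<Sum>i\<le>degree P. coeff P i * of_real (1 / (real (i + k) + \<alpha> + 1)))) {0..1}"
  proof (intro has_integral_sum has_integral_mult_right has_integral_of_real finite_atMost)
    fix i
    show "((\<lambda>x. x powr (real (i + k) + \<alpha>)) has_integral 1 / (real (i + k) + \<alpha> + 1)) {0..1}"
      using has_integral_powr_from_0[of "real (i + k) + \<alpha>" 1] \<alpha> by simp
  qed
  moreover have "((\<lambda>x::real. \<Sum>i\<le>degree P. coeff P i * of_real (x powr (real (i + k) + \<alpha>)))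
      has_integral 0) {0..1}"
    by (rule has_integral_eq[OF eq int])
  ultimately have "(\<Sum>i\<le>degree P. coeff P i * of_real (1 / (real (i + k) + \<alpha> + 1))) = 0"
    by (rule has_integral_unique)
  then show ?thesis by (simp add: add_ac divide_inverse)
qed

section \<open>Explicit coefficients, zeros and recurrence of the orthogonal polynomials\<close>

context
  fixes \<alpha>1 \<alpha>2 :: real and n1 n2 :: nat and P :: "complex poly"
  assumes \<alpha>: "\<alpha>1 > -1" "\<alpha>2 > -1" "\<alpha>1 - \<alpha>2 \<notin> \<int>"
    and P: "is_monic_MOP \<alpha>1 \<alpha>2 n1 n2 P"
begin

text \<open>The sum of simple fractions vanishes at \<open>\<alpha>1 + j\<close> for
  \<open>j < n1\<close> and at \<open>\<alpha>2 + j\<close> for \<open>j < n2\<close>. A coincidence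
  between the two groups would make \<open>\<alpha>1 - \<alpha>2\<close> an integer, so there are
  \<open>n1 + n2\<close> such points, and the product over each group is a Pochhammer
  symbol.\<close>

lemma MOP_coeffs:
  "\<exists>c. c \<noteq> 0 \<and> (\<forall>k\<le>n1+n2. coeff P k = c * ((-1) ^ k * of_nat ((n1 + n2) choose k) *
     (pochhammer (of_real (\<alpha>1 + 1) + of_nat k) n1 * pochhammer (of_real (\<alpha>2 + 1) + of_nat k) n2)))"
proof -
  define Z1 where "Z1 = (\<lambda>j. complex_of_real (\<alpha>1 + real j)) ` {0..<n1}"
  define Z2 where "Z2 = (\<lambda>j. complex_of_real (\<alpha>2 + real j)) ` {0..<n2}"
  have deg: "degree P = n1 + n2" using P by (simp add: is_monic_MOP_def)
  have inj: "inj_on (\<lambda>j. complex_of_real (\<alpha>1 + real j)) A" "inj_on (\<lambda>j. complex_of_real (\<alpha>2 + real j)) A" for A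
    by (auto simp: inj_on_def simp flip: of_real_add)
  have "\<alpha>1 + real i \<noteq> \<alpha>2 + real j" for i j
  proof
    assume "\<alpha>1 + real i = \<alpha>2 + real j"
    then have "\<alpha>1 - \<alpha>2 = of_int (int j - int i)" by simp
    then show False using \<alpha>(3) by (metis Ints_of_int)
  qed
  then have disj: "Z1 \<inter> Z2 = {}" by (auto simp: Z1_def Z2_def disjoint_iff simp del: of_real_add)
  have "\<exists>c. \<forall>k\<le>n1+n2. coeff P k = c * ((-1) ^ k * of_nat ((n1 + n2) choose k) * (\<Prod>\<zeta>\<in>Z1 \<union> Z2. \<zeta> + of_nat k + 1))"
  proof (rule partial_fraction_coeffs)
    show "finite (Z1 \<union> Z2)" by (simp add: Z1_def Z2_def)
    show "card (Z1 \<union> Z2) = n1 + n2"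
      using disj by (subst card_Un_disjoint) (auto simp: Z1_def Z2_def card_image inj simp del: of_real_add)
  next
    fix \<zeta> k assume "\<zeta> \<in> Z1 \<union> Z2"
    then obtain t :: real where t: "\<zeta> = of_real t" "t > -1"
      unfolding Z1_def Z2_def using \<alpha>(1,2) by fastforce
    have "\<zeta> + of_nat k + 1 = of_real (t + real k + 1)" using t by simp
    moreover have "t + real k + 1 \<noteq> 0" using t by linarith
    ultimately show "\<zeta> + of_nat k + 1 \<noteq> 0" by (metis of_real_eq_0_iff)
  next
    fix \<zeta> assume "\<zeta> \<in> Z1 \<union> Z2"
    then show "(\<Sum>k\<le>n1+n2. coeff P k / (\<zeta> + of_nat k + 1)) = 0"
      using P moment_condition[OF \<alpha>(1), of P] moment_condition[OF \<alpha>(2), of P]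
      unfolding Z1_def Z2_def is_monic_MOP_def by auto
  qed
  moreover have "(\<Prod>\<zeta>\<in>Z1 \<union> Z2. \<zeta> + of_nat k + 1) =
      pochhammer (of_real (\<alpha>1 + 1) + of_nat k) n1 * pochhammer (of_real (\<alpha>2 + 1) + of_nat k) n2" for k
  proof -
    have "(\<Prod>\<zeta>\<in>Z1 \<union> Z2. \<zeta> + of_nat k + 1) = (\<Prod>\<zeta>\<in>Z1. \<zeta> + of_nat k + 1) * (\<Prod>\<zeta>\<in>Z2. \<zeta> + of_nat k + 1)"
      using disj by (intro prod.union_disjoint) (auto simp: Z1_def Z2_def)
    then show ?thesis
      unfolding Z1_def Z2_def
      by (simp add: prod.reindex inj pochhammer_prod add_ac del: of_real_add) (simp add: add_ac)
  qed
  ultimately obtain c where c: "\<forall>k\<le>n1+n2. coeff P k = c * ((-1) ^ k * of_nat ((n1 + n2) choose k) *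
     (pochhammer (of_real (\<alpha>1 + 1) + of_nat k) n1 * pochhammer (of_real (\<alpha>2 + 1) + of_nat k) n2))"
    by auto
  moreover have "c \<noteq> 0"
    using c P by (auto simp: is_monic_MOP_def)
  ultimately show ?thesis by blast
qed

text \<open>The factor \<open>(-1) ^ k * (n1 + n2 choose k)\<close> is the coefficient of
  \<open>(1 - x) ^ (n1 + n2)\<close>, which vanishes at most at 1; the two Pochhammer factors come
  from operators with shifts at least \<open>\<alpha>1 + 1\<close> and \<open>\<alpha>2 + 1\<close>,
  both positive.\<close>

lemma MOP_factorization:
  "\<exists>rs :: real list. set rs \<subseteq> {0..1} \<and> length rs = n1 + n2 \<and> P = (\<Prod>r\<leftarrow>rs. [:- of_real r, 1:])"
proof -
  obtain c where c: "c \<noteq> 0" "\<And>k. k \<le> n1+n2 \<Longrightarrow> coeff P k = c * ((-1) ^ k * of_nat ((n1 + n2) choose k) *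
     (pochhammer (of_real (\<alpha>1 + 1) + of_nat k) n1 * pochhammer (of_real (\<alpha>2 + 1) + of_nat k) n2))"
    using MOP_coeffs by blast
  define B :: "complex poly" where "B = [:1, -1:] ^ (n1 + n2)"
  have "roots_in_unit_interval B"
    by (auto simp: roots_in_unit_interval_def B_def intro!: image_eqI[of _ _ 1])
  then obtain q1 where q1: "roots_in_unit_interval q1"
      "\<And>k. coeff q1 k = coeff B k * pochhammer (of_real (\<alpha>1 + 1) + of_nat k) n1"
    using roots_in_unit_interval_pochhammer[of B "\<alpha>1 + 1" n1] \<alpha>(1) by auto
  obtain q2 where q2: "roots_in_unit_interval q2"
      "\<And>k. coeff q2 k = coeff q1 k * pochhammer (of_real (\<alpha>2 + 1) + of_nat k) n2"
    using roots_in_unit_interval_pochhammer[OF q1(1), of "\<alpha>2 + 1" n2] \<alpha>(2) by auto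
  have "P = smult c q2"
  proof (rule poly_eqI)
    fix k
    show "coeff P k = coeff (smult c q2) k"
    proof (cases "k \<le> n1 + n2")
      case True
      then show ?thesis by (simp add: c(2) q2(2) q1(2) B_def coeff_linear_poly_power mult_ac del: of_real_add)
    next
      case False
      have "degree B \<le> n1 + n2" by (simp add: B_def degree_linear_power degree_power_eq)
      then have "coeff B k = 0" using False by (simp add: coeff_eq_0)
      moreover have "coeff P k = 0" using False P by (auto simp: is_monic_MOP_def intro: coeff_eq_0)
      ultimately show ?thesis by (simp add: q2(2) q1(2))
    qed
  qed
  then have "roots_in_unit_interval P" using q2(1) c(1) by (simp add: roots_in_unit_interval_def)
  then obtain rs :: "real list" where rs: "set rs \<subseteq> {0..1}"
    "P = smult (lead_coeff P) (\<Prod>r\<leftarrow>rs. [:- of_real r, 1:])"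
    by (rule roots_in_unit_interval_factorization)
  moreover have "lead_coeff P = 1" "degree P = n1 + n2" using P by (auto simp: is_monic_MOP_def)
  moreover have "degree (\<Prod>r\<leftarrow>rs. [:- complex_of_real r, 1:]) = length rs"
  proof (induction rs)
    case (Cons a rs)
    have "(\<Prod>r\<leftarrow>rs. [:- complex_of_real r, 1:]) \<noteq> 0" by (auto simp: prod_list_zero_iff)
    then show ?case by (simp add: degree_mult_eq Cons del: mult_pCons_left)
  qed simp
  ultimately show ?thesis by (metis smult_1_left)
qed

text \<open>Consecutive coefficients have a rational ratio, as for a hypergeometric polynomial of
  type \<open>3F2\<close>. The form without division can be compared coefficientwise with a
  differential equation.\<close>

lemma MOP_recurrence:
  assumes k: "k < n1 + n2"
  shows "coeff P (Suc k) * of_nat (Suc k) * (of_nat (Suc k) + of_real \<alpha>1) * (of_nat (Suc k) + of_real \<alpha>2)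
    = - coeff P k * of_nat (n1 + n2 - k) * (of_nat (k + n1) + of_real \<alpha>1 + 1) * (of_nat (k + n2) + of_real \<alpha>2 + 1)"
proof -
  obtain c where c: "\<And>k. k \<le> n1+n2 \<Longrightarrow> coeff P k = c * ((-1) ^ k * of_nat ((n1 + n2) choose k) *
     (pochhammer (of_real (\<alpha>1 + 1) + of_nat k) n1 * pochhammer (of_real (\<alpha>2 + 1) + of_nat k) n2))"
    using MOP_coeffs by blast
  have poch: "pochhammer (x + 1) n * x = pochhammer x n * (x + of_nat n)" for x :: complex and n
    by (metis mult.commute pochhammer_Suc pochhammer_rec)
  have bin: "of_nat ((n1+n2) choose Suc k) * of_nat (Suc k) = (of_nat ((n1+n2) choose k) * of_nat (n1 + n2 - k) :: complex)"
    by (metis binomial_absorb_comp binomial_absorption mult.commute of_nat_mult)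
  define x y where "x = of_real (\<alpha>1 + 1) + (of_nat k :: complex)" and "y = of_real (\<alpha>2 + 1) + (of_nat k :: complex)"
  have "coeff P (Suc k) * of_nat (Suc k) * x * y
     = - (c * (-1) ^ k * (of_nat ((n1+n2) choose Suc k) * of_nat (Suc k)) * (pochhammer (x + 1) n1 * x) * (pochhammer (y + 1) n2 * y))"
    using k by (simp add: c x_def y_def add_ac mult_ac)
  also have "\<dots> = - (coeff P k * of_nat (n1 + n2 - k) * (x + of_nat n1) * (y + of_nat n2))"
    unfolding bin poch using k by (simp add: c x_def y_def mult_ac)
  finally show ?thesis by (simp add: x_def y_def add_ac)
qed

end

section \<open>Locally bounded families of holomorphic functions\<close>

lemma norm_exp_minus_1_le:
  fixes z :: complex
  shows "cmod (exp z - 1) \<le> exp (cmod z) * cmod z"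
proof -
  have "norm (exp z - exp 0) \<le> exp (cmod z) * norm (z - 0)"
  proof (rule field_differentiable_bound[of "cball 0 (cmod z)"])
    fix x :: complex assume "x \<in> cball 0 (cmod z)"
    then have "Re x \<le> cmod z" using complex_Re_le_cmod[of x] by (simp add: dist_norm)
    then show "norm (exp x) \<le> exp (cmod z)" by (simp add: norm_exp_eq_Re)
  qed (auto intro: derivative_eq_intros)
  then show ?thesis by simp
qed

text \<open>The index will stand for a polynomial together with its degrees. A bound of order
  \<open>1 / n\<close> is expressed as local boundedness after multiplication by \<open>n\<close>,
  so that no sequences or limits occur.\<close>

definition locally_bounded_family ::
  "'i set \<Rightarrow> complex set \<Rightarrow> ('i \<Rightarrow> complex \<Rightarrow> complex) \<Rightarrow> bool" where
  "locally_bounded_family I \<Omega> F \<longleftrightarrow>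
     (\<forall>K. compact K \<and> K \<subseteq> \<Omega> \<longrightarrow> (\<exists>C. \<forall>i\<in>I. \<forall>w\<in>K. cmod (F i w) \<le> C))"

lemma locally_bounded_familyI:
  assumes "\<And>K. compact K \<Longrightarrow> K \<subseteq> \<Omega> \<Longrightarrow> \<exists>C. \<forall>i\<in>I. \<forall>w\<in>K. cmod (F i w) \<le> C"
  shows "locally_bounded_family I \<Omega> F"
  using assms by (auto simp: locally_bounded_family_def)

lemma locally_bounded_familyE:
  assumes "locally_bounded_family I \<Omega> F" "compact K" "K \<subseteq> \<Omega>"
  obtains C where "C > 0" "\<And>i w. i \<in> I \<Longrightarrow> w \<in> K \<Longrightarrow> cmod (F i w) \<le> C"
proof -
  obtain C where C: "\<forall>i\<in>I. \<forall>w\<in>K. cmod (F i w) \<le> C"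
    using assms by (auto simp: locally_bounded_family_def)
  show ?thesis by (rule that[of "max C 1"]) (use C in \<open>auto intro: le_max_iff_disj[THEN iffD2]\<close>)
qed

lemma locally_bounded_family_cong:
  assumes "locally_bounded_family I \<Omega> F" "\<And>i w. i \<in> I \<Longrightarrow> w \<in> \<Omega> \<Longrightarrow> F i w = G i w"
  shows "locally_bounded_family I \<Omega> G"
proof (rule locally_bounded_familyI)
  fix K assume K: "compact K" "K \<subseteq> \<Omega>"
  obtain C where "\<And>i w. i \<in> I \<Longrightarrow> w \<in> K \<Longrightarrow> cmod (F i w) \<le> C"
    using locally_bounded_familyE[OF assms(1) K] by metis
  then show "\<exists>C. \<forall>i\<in>I. \<forall>w\<in>K. cmod (G i w) \<le> C" using assms(2) K(2) by (metis subsetD)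
qed

lemma locally_bounded_family_continuous:
  assumes "continuous_on \<Omega> g"
  shows "locally_bounded_family I \<Omega> (\<lambda>i. g)"
proof (rule locally_bounded_familyI)
  fix K assume K: "compact K" "K \<subseteq> \<Omega>"
  have "bounded (g ` K)"
    using assms K by (intro compact_imp_bounded compact_continuous_image) (rule continuous_on_subset)
  then show "\<exists>C. \<forall>i\<in>I. \<forall>w\<in>K. cmod (g w) \<le> C" by (auto simp: bounded_iff)
qed

lemma locally_bounded_family_const: "locally_bounded_family I \<Omega> (\<lambda>i w. c)"
  by (rule locally_bounded_family_continuous) simp

lemma locally_bounded_family_inverse_nat:
  "locally_bounded_family I \<Omega> (\<lambda>i w. 1 / of_nat (n i))"
proof (rule locally_bounded_familyI, intro exI ballI)
  fix i show "cmod (1 / of_nat (n i)) \<le> 1" by (cases "n i") (simp_all add: norm_divide del: of_nat_Suc)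
qed

lemma locally_bounded_family_add:
  assumes "locally_bounded_family I \<Omega> F" "locally_bounded_family I \<Omega> G"
  shows "locally_bounded_family I \<Omega> (\<lambda>i w. F i w + G i w)"
proof (rule locally_bounded_familyI)
  fix K assume K: "compact K" "K \<subseteq> \<Omega>"
  obtain C D where "\<And>i w. i \<in> I \<Longrightarrow> w \<in> K \<Longrightarrow> cmod (F i w) \<le> C"
    "\<And>i w. i \<in> I \<Longrightarrow> w \<in> K \<Longrightarrow> cmod (G i w) \<le> D"
    using assms K by (metis locally_bounded_familyE)
  then show "\<exists>C. \<forall>i\<in>I. \<forall>w\<in>K. cmod (F i w + G i w) \<le> C"
    by (intro exI[of _ "C + D"] ballI norm_triangle_mono) auto
qed

lemma locally_bounded_family_mult:
  assumes "locally_bounded_family I \<Omega> F" "locally_bounded_family I \<Omega> G"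
  shows "locally_bounded_family I \<Omega> (\<lambda>i w. F i w * G i w)"
proof (rule locally_bounded_familyI)
  fix K assume K: "compact K" "K \<subseteq> \<Omega>"
  obtain C D where C: "C > 0" "\<And>i w. i \<in> I \<Longrightarrow> w \<in> K \<Longrightarrow> cmod (F i w) \<le> C"
    and D: "\<And>i w. i \<in> I \<Longrightarrow> w \<in> K \<Longrightarrow> cmod (G i w) \<le> D"
    using assms K by (metis locally_bounded_familyE)
  have "cmod (F i w * G i w) \<le> C * D" if "i \<in> I" "w \<in> K" for i w
    unfolding norm_mult using C(1) by (intro mult_mono C(2) D that) auto
  then show "\<exists>C. \<forall>i\<in>I. \<forall>w\<in>K. cmod (F i w * G i w) \<le> C" by blast
qed

lemma locally_bounded_family_uminus:
  "locally_bounded_family I \<Omega> F \<Longrightarrow> locally_bounded_family I \<Omega> (\<lambda>i w. - F i w)"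
  by (simp add: locally_bounded_family_def)

lemma locally_bounded_family_diff:
  assumes "locally_bounded_family I \<Omega> F" "locally_bounded_family I \<Omega> G"
  shows "locally_bounded_family I \<Omega> (\<lambda>i w. F i w - G i w)"
  using locally_bounded_family_add[OF assms(1) locally_bounded_family_uminus[OF assms(2)]] by simp

lemmas locally_bounded_family_arith = locally_bounded_family_const locally_bounded_family_add
  locally_bounded_family_diff locally_bounded_family_mult locally_bounded_family_uminus

lemma compact_fatten:
  fixes K \<Omega> :: "complex set"
  assumes "compact K" "K \<subseteq> \<Omega>" "open \<Omega>"
  obtains r where "r > 0" "compact (\<Union>x\<in>K. cball x r)" "(\<Union>x\<in>K. cball x r) \<subseteq> \<Omega>"
proof -
  obtain d where d: "d > 0" "(\<Union>x\<in>K. ball x d) \<subseteq> \<Omega>"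
    using compact_subset_open_imp_ball_epsilon_subset[OF assms(1,3,2)] by metis
  have "cball x (d/2) = (\<Union>y\<in>cball 0 (d/2). {x + y})" for x :: complex
    using image_add_cball[of x 0 "d/2"] by (simp add: UNION_singleton_eq_range)
  then have "(\<Union>x\<in>K. cball x (d/2)) = (\<Union>x\<in>K. \<Union>y\<in>cball 0 (d/2). {x + y})"
    by (intro SUP_cong refl)
  then have "compact (\<Union>x\<in>K. cball x (d/2))"
    using compact_sums'[OF assms(1) compact_cball, of 0 "d/2"] by (simp only:)
  moreover have "(\<Union>x\<in>K. cball x (d/2)) \<subseteq> \<Omega>"
    using d by (intro order.trans[OF _ d(2)] UN_mono) auto
  ultimately show ?thesis using d(1) by (intro that[of "d/2"]) auto
qed

lemma locally_bounded_family_deriv: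
  assumes "open \<Omega>" "\<And>i. i \<in> I \<Longrightarrow> F i holomorphic_on \<Omega>" "locally_bounded_family I \<Omega> F"
  shows "locally_bounded_family I \<Omega> (\<lambda>i. deriv (F i))"
proof (rule locally_bounded_familyI)
  fix K assume K: "compact K" "K \<subseteq> \<Omega>"
  obtain r where r: "r > 0" "compact (\<Union>x\<in>K. cball x r)" "(\<Union>x\<in>K. cball x r) \<subseteq> \<Omega>"
    by (rule compact_fatten[OF K assms(1)])
  obtain C where C: "C > 0" "\<And>i w. i \<in> I \<Longrightarrow> w \<in> (\<Union>x\<in>K. cball x r) \<Longrightarrow> cmod (F i w) \<le> C"
    by (rule locally_bounded_familyE[OF assms(3) r(2,3)]) blast
  have "cmod (deriv (F i) w) \<le> C / r" if iw: "i \<in> I" "w \<in> K" for i w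
  proof -
    have sub: "cball w r \<subseteq> \<Omega>" using r(3) iw by auto
    have "F i holomorphic_on ball w r" "continuous_on (cball w r) (F i)"
      using assms(2)[OF iw(1)] sub ball_subset_cball[of w r]
      by (meson holomorphic_on_subset order.trans, meson holomorphic_on_imp_continuous_on continuous_on_subset)
    then have "cmod ((deriv ^^ 1) (F i) w) \<le> fact 1 * C / r ^ 1"
      using r(1) by (rule Cauchy_inequality) (use C iw in \<open>auto simp: dist_norm\<close>)
    then show ?thesis by simp
  qed
  then show "\<exists>C. \<forall>i\<in>I. \<forall>w\<in>K. cmod (deriv (F i) w) \<le> C" by blast
qed

text \<open>Only points near 0 are critical; there the maximum modulus principle carries the bound
  on the circle of radius \<open>r\<close> inwards. It serves to remove the factor \<open>w\<close>
  of the Euler derivative \<open>w * d/dw\<close>.\<close>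

lemma locally_bounded_family_cancel_id:
  assumes "open \<Omega>" "0 \<in> \<Omega>" "\<And>i. i \<in> I \<Longrightarrow> F i holomorphic_on \<Omega>"
    and "locally_bounded_family I \<Omega> (\<lambda>i w. w * F i w)"
  shows "locally_bounded_family I \<Omega> F"
proof (rule locally_bounded_familyI)
  fix K assume K: "compact K" "K \<subseteq> \<Omega>"
  obtain r where r: "r > 0" "cball 0 r \<subseteq> \<Omega>"
    using assms(1,2) open_contains_cball by blast
  obtain C where C: "C > 0" "\<And>i w. i \<in> I \<Longrightarrow> w \<in> K \<union> cball 0 r \<Longrightarrow> cmod (w * F i w) \<le> C"
    by (rule locally_bounded_familyE[OF assms(4), of "K \<union> cball 0 r"])
       (use K r in \<open>auto intro: compact_Un\<close>)
  have far: "cmod (F i w) \<le> C / r" if "i \<in> I" "w \<in> K \<union> cball 0 r" "cmod w \<ge> r" for i w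
  proof -
    have "r * cmod (F i w) \<le> cmod w * cmod (F i w)" using that by (intro mult_right_mono) auto
    also have "\<dots> \<le> C" using C(2)[OF that(1,2)] by (simp add: norm_mult)
    finally show ?thesis using r(1) by (simp add: field_simps)
  qed
  have "cmod (F i w) \<le> C / r" if iw: "i \<in> I" "w \<in> K" for i w
  proof (cases "cmod w \<ge> r")
    case True
    then show ?thesis using far iw by blast
  next
    case False
    have hol: "F i holomorphic_on cball 0 r" using assms(3) iw r by (meson holomorphic_on_subset)
    show ?thesis
    proof (rule maximum_modulus_frontier[of "F i" "cball 0 r"])
      show "F i holomorphic_on interior (cball 0 r)"
        using hol by (rule holomorphic_on_subset) (rule interior_subset)
      show "continuous_on (closure (cball 0 r)) (F i)"
        using hol by (simp add: holomorphic_on_imp_continuous_on)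
      show "cmod (F i z) \<le> C / r" if "z \<in> frontier (cball 0 r)" for z
        using that r(1) far[OF iw(1), of z] by (auto simp: dist_norm)
    qed (use False in auto)
  qed
  then show "\<exists>C. \<forall>i\<in>I. \<forall>w\<in>K. cmod (F i w) \<le> C" by blast
qed

section \<open>Estimates on domains star-shaped about 0\<close>

text \<open>Connectedness to 0 and segments from 0 are needed inside a compact set, since only there
  are the bounds uniform.\<close>

lemma compact_star_hull:
  fixes K \<Omega> :: "complex set"
  assumes K: "compact K" "K \<subseteq> \<Omega>"
    and star: "0 \<in> \<Omega>" "\<And>w. w \<in> \<Omega> \<Longrightarrow> closed_segment 0 w \<subseteq> \<Omega>"
  obtains L where "compact L" "connected L" "K \<subseteq> L" "L \<subseteq> \<Omega>" "0 \<in> L"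
    "\<And>w. w \<in> L \<Longrightarrow> closed_segment 0 w \<subseteq> L"
proof -
  define L where "L = insert 0 ((\<lambda>(t, w). complex_of_real t * w) ` ({0..1} \<times> K))"
  have seg: "closed_segment 0 w = (\<lambda>t. complex_of_real t * w) ` {0..1}" for w :: complex
    by (auto simp: closed_segment_image_interval scaleR_conv_of_real)
  have "compact L"
    unfolding L_def
    by (intro compact_insert compact_continuous_image compact_Times K compact_Icc)
       (auto simp: case_prod_unfold intro!: continuous_intros)
  have seg_L: "closed_segment 0 w \<subseteq> L" if wL: "w \<in> L" for w
  proof
    fix z assume "z \<in> closed_segment 0 w"
    then obtain s where s: "s \<in> {0..1}" "z = of_real s * w" by (auto simp: seg)
    consider "w = 0" | t v where "t \<in> {0..1}" "v \<in> K" "w = of_real t * v"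
      using wL unfolding L_def by auto
    then show "z \<in> L"
    proof cases
      case 2
      have "z = of_real (s * t) * v" "s * t \<in> {0..1}"
        using s 2 by (auto intro: mult_le_one)
      then show ?thesis using 2 unfolding L_def by (intro insertI2 image_eqI[of _ _ "(s * t, v)"]) auto
    qed (use s in \<open>simp add: L_def\<close>)
  qed
  have "starlike L" unfolding starlike_def using seg_L by (intro bexI[of _ 0]) (auto simp: L_def)
  then have "connected L" by (rule starlike_imp_connected)
  have "K \<subseteq> L"
  proof
    fix w assume "w \<in> K"
    then show "w \<in> L" unfolding L_def by (intro insertI2 image_eqI[of _ _ "(1, w)"]) auto
  qed
  have "L \<subseteq> \<Omega>"
  proof
    fix z assume "z \<in> L"
    then consider "z = 0" | t w where "t \<in> {0..1}" "w \<in> K" "z = of_real t * w"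
      unfolding L_def by auto
    then show "z \<in> \<Omega>"
    proof cases
      case 2
      then have "z \<in> closed_segment 0 w" by (auto simp: seg)
      then show ?thesis using star(2)[of w] K(2) 2 by blast
    qed (use star in simp)
  qed
  show ?thesis
    by (rule that[OF \<open>compact L\<close> \<open>connected L\<close> \<open>K \<subseteq> L\<close> \<open>L \<subseteq> \<Omega>\<close> _ seg_L]) (simp_all add: L_def)
qed

text \<open>On a connected compact set containing \<open>0\<close>, a small value of \<open>g * (q + H * g)\<close> forces
  \<open>g\<close> to be either small or bounded away from zero; since \<open>g 0 = 0\<close>, it is small.\<close>

lemma locally_bounded_family_bootstrap:
  fixes g H :: "'i \<Rightarrow> complex \<Rightarrow> complex" and n :: "'i \<Rightarrow> nat"
  assumes star: "0 \<in> \<Omega>" "\<And>w. w \<in> \<Omega> \<Longrightarrow> closed_segment 0 w \<subseteq> \<Omega>"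
    and q: "continuous_on \<Omega> q" "\<And>w. w \<in> \<Omega> \<Longrightarrow> q w \<noteq> 0"
    and g: "\<And>i. i \<in> I \<Longrightarrow> continuous_on \<Omega> (g i)" "\<And>i. i \<in> I \<Longrightarrow> g i 0 = 0"
      "locally_bounded_family I \<Omega> g"
    and H: "locally_bounded_family I \<Omega> H"
    and n: "\<And>i. i \<in> I \<Longrightarrow> n i > 0"
    and bdd: "locally_bounded_family I \<Omega> (\<lambda>i w. of_nat (n i) * (g i w * (q w + H i w * g i w)))"
  shows "locally_bounded_family I \<Omega> (\<lambda>i w. of_nat (n i) * g i w)"
proof (rule locally_bounded_familyI)
  fix K assume K: "compact K" "K \<subseteq> \<Omega>"
  obtain L where L: "compact L" "connected L" "K \<subseteq> L" "L \<subseteq> \<Omega>" "0 \<in> L"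
    using compact_star_hull[OF K star] by metis
  obtain G where G: "G > 0" "\<And>i w. i \<in> I \<Longrightarrow> w \<in> L \<Longrightarrow> cmod (g i w) \<le> G"
    by (rule locally_bounded_familyE[OF g(3) L(1,4)]) blast
  obtain h where h: "h > 0" "\<And>i w. i \<in> I \<Longrightarrow> w \<in> L \<Longrightarrow> cmod (H i w) \<le> h"
    by (rule locally_bounded_familyE[OF H L(1,4)]) blast
  obtain C where C: "C > 0" "\<And>i w. i \<in> I \<Longrightarrow> w \<in> L \<Longrightarrow> cmod (of_nat (n i) * (g i w * (q w + H i w * g i w))) \<le> C"
    by (rule locally_bounded_familyE[OF bdd L(1,4)]) blast
  have "continuous_on L (\<lambda>w. cmod (q w))"
    using q(1) L(4) by (intro continuous_intros) (rule continuous_on_subset)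
  then obtain w0 where w0: "w0 \<in> L" "\<And>w. w \<in> L \<Longrightarrow> cmod (q w0) \<le> cmod (q w)"
    using continuous_attains_inf[OF L(1)] L(5) by blast
  define m where "m = cmod (q w0) / 2"
  have m: "m > 0" "\<And>w. w \<in> L \<Longrightarrow> 2 * m \<le> cmod (q w)"
    using w0 q(2) L(4) by (auto simp: m_def)
  \<comment> \<open>For \<open>cmod (g i v) < \<delta>\<close> the term \<open>H i v * g i v\<close>
    has modulus at most \<open>m\<close>, which is at most half of
    \<open>cmod (q v)\<close>.\<close>
  define \<delta> where "\<delta> = m / h"
  have \<delta>: "\<delta> > 0" using m h by (simp add: \<delta>_def)
  have "cmod (of_nat (n i) * g i w) \<le> max (C / m) (2 * C / (m * \<delta>) * G)" if i: "i \<in> I" and w: "w \<in> K" for i w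
  \<comment> \<open>Below the threshold \<open>n\<close> is bounded and the bound on
    \<open>g\<close> suffices; above it \<open>C / (m * n)\<close> is at most
    \<open>\<delta> / 2\<close>, which creates the gap.\<close>
  proof (cases "real (n i) \<ge> 2 * C / (m * \<delta>)")
    case False
    then have "cmod (of_nat (n i) * g i w) \<le> 2 * C / (m * \<delta>) * G"
      unfolding norm_mult using G i w L(3) by (intro mult_mono) auto
    then show ?thesis by simp
  next
    case True
    have small: "real (n i) * cmod (g i v) \<le> C / m" if v: "v \<in> L" "cmod (g i v) < \<delta>" for v
    proof -
      have "cmod (H i v * g i v) \<le> h * \<delta>"
        unfolding norm_mult using v h i by (intro mult_mono) auto
      also have "\<dots> = m" using h(1) by (simp add: \<delta>_def)
      finally have "m \<le> cmod (q v + H i v * g i v)"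
        using m(2)[OF v(1)] norm_diff_ineq[of "q v" "H i v * g i v"] by linarith
      then have "real (n i) * cmod (g i v) * m \<le> real (n i) * cmod (g i v) * cmod (q v + H i v * g i v)"
        by (intro mult_left_mono) auto
      also have "\<dots> \<le> C" using C(2)[OF i v(1)] by (simp add: norm_mult mult.assoc)
      finally show ?thesis using m(1) by (simp add: field_simps)
    qed
    have gap: "cmod (g i v) \<le> \<delta> / 2" if v: "v \<in> L" "cmod (g i v) < \<delta>" for v
    proof -
      have "2 * C / (m * \<delta>) * cmod (g i v) \<le> real (n i) * cmod (g i v)"
        using True by (intro mult_right_mono) auto
      also have "\<dots> \<le> C / m" using small v by blast
      finally show ?thesis using m(1) \<delta> C(1) by (simp add: field_simps)
    qed
    have "cmod (g i w) < \<delta>"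
    proof (rule ccontr)
      assume large: "\<not> cmod (g i w) < \<delta>"
      have "connected ((\<lambda>v. cmod (g i v)) ` L)"
        using g(1)[OF i] L(2,4) by (intro connected_continuous_image continuous_intros) (rule continuous_on_subset)
      moreover have "0 \<in> (\<lambda>v. cmod (g i v)) ` L" using L(5) g(2)[OF i] by (auto intro!: image_eqI[of _ _ 0])
      moreover have "cmod (g i w) \<in> (\<lambda>v. cmod (g i v)) ` L" using w L(3) by auto
      \<comment> \<open>The range of \<open>cmod (g i v)\<close> is connected, so it cannot pass
        from 0 to \<open>\<delta>\<close> without meeting the gap; \<open>3 / 4 * \<delta>\<close>
        is an arbitrary point of the gap.\<close>
      ultimately have "3 / 4 * \<delta> \<in> (\<lambda>v. cmod (g i v)) ` L"
        by (rule connectedD_interval) (use large \<delta> in auto)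
      then obtain v where "v \<in> L" "cmod (g i v) = 3 / 4 * \<delta>" by auto
      then show False using gap[of v] \<delta> by simp
    qed
    then show ?thesis using small[of w] w L(3) by (auto simp: norm_mult)
  qed
  then show "\<exists>C. \<forall>i\<in>I. \<forall>w\<in>K. cmod (of_nat (n i) * g i w) \<le> C" by blast
qed

text \<open>On the simply connected domain \<open>f i = exp l\<close>. Integrating the derivative of
  \<open>l\<close>, which is of order \<open>1 / n\<close>, along the segment from 0 gives
  \<open>l w - l 0\<close> of order \<open>1 / n\<close>, and \<open>exp\<close> turns this into the
  bound for \<open>f i w - 1\<close>.\<close>

lemma locally_bounded_family_logderiv:
  fixes f :: "'i \<Rightarrow> complex \<Rightarrow> complex" and n :: "'i \<Rightarrow> nat"
  assumes "open \<Omega>" and star: "0 \<in> \<Omega>" "\<And>w. w \<in> \<Omega> \<Longrightarrow> closed_segment 0 w \<subseteq> \<Omega>"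
    and f: "\<And>i. i \<in> I \<Longrightarrow> f i holomorphic_on \<Omega>" "\<And>i. i \<in> I \<Longrightarrow> f i 0 = 1"
      "\<And>i w. i \<in> I \<Longrightarrow> w \<in> \<Omega> \<Longrightarrow> f i w \<noteq> 0"
    and n: "\<And>i. i \<in> I \<Longrightarrow> n i > 0"
    and bdd: "locally_bounded_family I \<Omega> (\<lambda>i w. of_nat (n i) * (deriv (f i) w / f i w))"
  shows "locally_bounded_family I \<Omega> (\<lambda>i w. of_nat (n i) * (f i w - 1))"
proof (rule locally_bounded_familyI)
  fix K assume K: "compact K" "K \<subseteq> \<Omega>"
  obtain L where L: "compact L" "K \<subseteq> L" "L \<subseteq> \<Omega>" "\<And>w. w \<in> L \<Longrightarrow> closed_segment 0 w \<subseteq> L"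
    using compact_star_hull[OF K star] by metis
  obtain C where C: "C > 0"
    "\<And>i w. i \<in> I \<Longrightarrow> w \<in> L \<Longrightarrow> cmod (of_nat (n i) * (deriv (f i) w / f i w)) \<le> C"
    by (rule locally_bounded_familyE[OF bdd L(1,3)]) blast
  obtain B where B: "B > 0" "\<And>w. w \<in> K \<Longrightarrow> cmod w \<le> B"
    using compact_imp_bounded[OF K(1)] by (auto simp: bounded_pos)
  have "simply_connected \<Omega>"
    using star by (intro starlike_imp_simply_connected) (auto simp: starlike_def)
  have "cmod (of_nat (n i) * (f i w - 1)) \<le> exp (C * B) * (C * B)" if i: "i \<in> I" and w: "w \<in> K" for i w
  proof -
    obtain l where l: "l holomorphic_on \<Omega>" "\<And>z. z \<in> \<Omega> \<Longrightarrow> f i z = exp (l z)"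
      using \<open>simply_connected \<Omega>\<close> f(1,3)[OF i] simply_connected_eq_holomorphic_log[OF \<open>open \<Omega>\<close>]
      by metis
    have deriv_l: "(l has_field_derivative deriv (f i) z / f i z) (at z)" if z: "z \<in> \<Omega>" for z
    proof -
      have dl: "(l has_field_derivative deriv l z) (at z)"
        using l(1) \<open>open \<Omega>\<close> z by (rule holomorphic_derivI)
      then have "((\<lambda>z. exp (l z)) has_field_derivative exp (l z) * deriv l z) (at z)"
        by (auto intro!: derivative_eq_intros)
      then have "(f i has_field_derivative exp (l z) * deriv l z) (at z)"
        by (rule has_field_derivative_transform_within_open[OF _ \<open>open \<Omega>\<close> z]) (simp add: l(2))
      then have "deriv (f i) z = f i z * deriv l z"
        using z by (simp add: DERIV_imp_deriv l(2))
      then show ?thesis using dl f(3)[OF i z] by simp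
    qed
    have w\<Omega>: "w \<in> L" "w \<in> \<Omega>" using w L by auto
    have seg: "closed_segment 0 w \<subseteq> L" using w\<Omega>(1) by (rule L(4))
    have "cmod (l w - l 0) \<le> C / n i * cmod (w - 0)"
    proof (rule field_differentiable_bound[of "closed_segment 0 w" l "\<lambda>z. deriv (f i) z / f i z"])
      fix z assume z: "z \<in> closed_segment 0 w"
      then have "z \<in> L" using seg by blast
      then show "(l has_field_derivative deriv (f i) z / f i z) (at z within closed_segment 0 w)"
        using deriv_l L(3) has_field_derivative_at_within by blast
      show "cmod (deriv (f i) z / f i z) \<le> C / n i"
        using C(2)[OF i \<open>z \<in> L\<close>] n[OF i]
        by (simp only: norm_mult norm_of_nat) (simp add: pos_le_divide_eq mult.commute)
    qed auto
    also have "\<dots> \<le> C / n i * B" using B w C by (intro mult_left_mono) auto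
    finally have le: "cmod (l w - l 0) \<le> C * B / n i" by simp
    also have "\<dots> \<le> C * B / 1"
      using C B n[OF i] by (intro divide_left_mono) auto
    finally have le1: "cmod (l w - l 0) \<le> C * B" by simp
    have "f i w = exp (l w - l 0)"
      using l(2)[OF w\<Omega>(2)] l(2)[OF star(1)] f(2)[OF i] by (simp add: exp_diff)
    then have "cmod (f i w - 1) \<le> exp (cmod (l w - l 0)) * cmod (l w - l 0)"
      by (simp add: norm_exp_minus_1_le)
    also have "\<dots> \<le> exp (C * B) * (C * B / n i)"
      using le le1 by (intro mult_mono) auto
    finally show ?thesis using n[OF i] by (simp only: norm_mult norm_of_nat) (simp add: field_simps)
  qed
  then show "\<exists>C. \<forall>i\<in>I. \<forall>w\<in>K. cmod (of_nat (n i) * (f i w - 1)) \<le> C" by blast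
qed

section \<open>The Riccati equation\<close>

definition cut_plane :: "complex set" where
  "cut_plane = - (complex_of_real ` {1..})"

lemma open_cut_plane: "open cut_plane"
  unfolding cut_plane_def by (intro open_Compl closed_slot_right)

lemma zero_in_cut_plane: "0 \<in> cut_plane"
  by (auto simp: cut_plane_def)

lemma closed_segment_cut_plane: "w \<in> cut_plane \<Longrightarrow> closed_segment 0 w \<subseteq> cut_plane"
  using starlike_slotted_complex_plane_right_aux[of w 1 0] by (simp add: cut_plane_def)

lemma connected_cut_plane: "connected cut_plane"
  unfolding cut_plane_def
  by (intro simply_connected_imp_connected simply_connected_slotted_complex_plane_right)

lemma one_minus_mult_ne_zero:
  assumes "w \<in> cut_plane" "r \<in> {0..1}"
  shows "1 - of_real r * w \<noteq> 0"
proof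
  assume "1 - of_real r * w = 0"
  then have "of_real r * w = 1" by simp
  moreover from this have "r \<noteq> 0" by auto
  ultimately have "w = of_real (1 / r)" by (simp add: field_simps)
  moreover have "1 / r \<in> {1..}" using assms(2) \<open>r \<noteq> 0\<close> by auto
  ultimately show False using assms(1) unfolding cut_plane_def by blast
qed

lemma poly_prod_one_minus:
  "poly (\<Prod>r\<leftarrow>rs. [:1, - of_real r:]) w = (\<Prod>r\<leftarrow>rs. 1 - of_real r * w :: complex)"
  by (induction rs) (auto simp: algebra_simps)

lemma poly_prod_one_minus_ne_zero:
  assumes "set rs \<subseteq> {0..1}" "w \<in> cut_plane"
  shows "poly (\<Prod>r\<leftarrow>rs. [:1, - of_real r:]) w \<noteq> 0"
  using assms one_minus_mult_ne_zero[of w]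
  by (auto simp: poly_prod_one_minus prod_list_zero_iff)

lemma poly_pderiv_prod_one_minus:
  assumes "set rs \<subseteq> {0..1}" "w \<in> cut_plane"
  shows "poly (pderiv (\<Prod>r\<leftarrow>rs. [:1, - of_real r:])) w =
    poly (\<Prod>r\<leftarrow>rs. [:1, - of_real r:]) w * (\<Sum>r\<leftarrow>rs. - of_real r / (1 - of_real r * w))"
  using assms
proof (induction rs)
  case (Cons r rs)
  have alg: "x * (p * s) + p * (- c) = x * p * (- c / x + s)" if "x \<noteq> 0" for x p s c :: complex
    using that by (simp add: field_simps)
  let ?p = "\<Prod>r\<leftarrow>rs. [:1, - of_real r:] :: complex poly"
  let ?S = "\<Sum>r\<leftarrow>rs. - of_real r / (1 - of_real r * w)"
  have ne: "1 - of_real r * w \<noteq> 0" using Cons.prems by (intro one_minus_mult_ne_zero) auto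
  have "poly (pderiv ([:1, - of_real r:] * ?p)) w
      = (1 - of_real r * w) * poly (pderiv ?p) w + poly ?p w * (- of_real r)"
    unfolding pderiv_mult poly_add poly_mult by (simp add: pderiv_pCons)
  also have "poly (pderiv ?p) w = poly ?p w * ?S" using Cons by simp
  also note alg[OF ne]
  finally show ?case by (simp only: list.map prod_list.Cons sum_list.Cons poly_mult) simp
qed simp

text \<open>A zero \<open>r\<close> contributes \<open>w * (- r / (1 - r * w))\<close>, a continuous
  function on the compact set \<open>{0..1} \<times> K\<close>. This gives one constant per factor,
  whatever the zeros are.\<close>

lemma logderiv_prod_one_minus_bound:
  assumes K: "compact K" "K \<subseteq> cut_plane"
  shows "\<exists>C::real. \<forall>rs w. set rs \<subseteq> {0..1} \<longrightarrow> w \<in> K \<longrightarrow>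
    cmod (w * poly (pderiv (\<Prod>r\<leftarrow>rs. [:1, - of_real r:])) w / poly (\<Prod>r\<leftarrow>rs. [:1, - of_real r:]) w)
      \<le> C * length rs"
proof -
  define F where "F = (\<lambda>(r, w). w * (- complex_of_real r / (1 - of_real r * w)))"
  have "continuous_on ({0..1} \<times> K) F"
    unfolding F_def case_prod_unfold using K(2) one_minus_mult_ne_zero
    by (intro continuous_intros) (auto simp: mem_Times_iff)
  then have "bounded (F ` ({0..1} \<times> K))"
    by (intro compact_imp_bounded compact_continuous_image compact_Times K compact_Icc)
  then obtain C where C: "\<And>r w. r \<in> {0..1} \<Longrightarrow> w \<in> K \<Longrightarrow> cmod (F (r, w)) \<le> C"
    by (force simp: bounded_iff)
  have "cmod (w * poly (pderiv (\<Prod>r\<leftarrow>rs. [:1, - of_real r:])) w / poly (\<Prod>r\<leftarrow>rs. [:1, - of_real r:]) w)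
      \<le> C * length rs" if rs: "set rs \<subseteq> {0..1}" and w: "w \<in> K" for rs w
  proof -
    have "w \<in> cut_plane" using w K by auto
    then have "w * poly (pderiv (\<Prod>r\<leftarrow>rs. [:1, - of_real r:])) w / poly (\<Prod>r\<leftarrow>rs. [:1, - of_real r:]) w
       = w * (\<Sum>r\<leftarrow>rs. - of_real r / (1 - of_real r * w))"
      using poly_prod_one_minus_ne_zero[OF rs] by (subst poly_pderiv_prod_one_minus[OF rs]) auto
    also have "\<dots> = (\<Sum>r\<leftarrow>rs. F (r, w))"
      unfolding F_def by (induction rs) (simp_all add: algebra_simps)
    also have "cmod \<dots> \<le> C * length rs"
      using rs
    proof (induction rs)
      case (Cons r rs)
      have "cmod (F (r, w) + (\<Sum>r\<leftarrow>rs. F (r, w))) \<le> C + C * length rs"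
        using Cons w by (intro norm_triangle_mono C) auto
      then show ?case by (simp add: algebra_simps)
    qed simp
    finally show ?thesis .
  qed
  then show ?thesis by (intro exI[of _ C] allI impI)
qed

section \<open>From the linear differential equation to an equation for the logarithmic
  derivative\<close>

text \<open>By the product rule \<open>shifted_euler c\<close> maps a multiple \<open>f * T\<close>
  to another multiple of \<open>T\<close>, so that repeated application only changes the
  cofactor.\<close>

lemma poly_shifted_euler_transfer:
  assumes "open \<Omega>" "w \<in> \<Omega>"
    and f: "f holomorphic_on \<Omega>" "\<And>z. z \<in> \<Omega> \<Longrightarrow> poly p z = f z * poly T z"
    and T: "w * poly (pderiv T) w = u * poly T w"
  shows "poly (shifted_euler c p) w = (w * deriv f w + (u + c) * f w) * poly T w"
proof -
  have "((\<lambda>z. f z * poly T z) has_field_derivative (deriv f w * poly T w + poly (pderiv T) w * f w)) (at w)"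
    using holomorphic_derivI[OF f(1) assms(1,2)] poly_DERIV by (rule DERIV_mult)
  then have "(poly p has_field_derivative (deriv f w * poly T w + poly (pderiv T) w * f w)) (at w)"
    by (rule has_field_derivative_transform_within_open[OF _ assms(1,2)]) (simp add: f(2))
  then have "poly (pderiv p) w = deriv f w * poly T w + poly (pderiv T) w * f w"
    using poly_DERIV DERIV_unique by blast
  then have "poly (shifted_euler c p) w
      = w * deriv f w * poly T w + w * poly (pderiv T) w * f w + c * (f w * poly T w)"
    using f(2)[OF assms(2)] by (simp add: poly_shifted_euler algebra_simps)
  then show ?thesis by (simp add: T algebra_simps)
qed

text \<open>Starting from the cofactor \<open>m * U + c1\<close>, two transfers yield the
  third-order operator; the common factor \<open>T\<close> splits off, and a nonlinear expression of
  second order in \<open>U\<close> remains.\<close>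

lemma poly_shifted_euler_3:
  fixes T :: "complex poly"
  assumes \<Omega>: "open \<Omega>" "w \<in> \<Omega>"
    and U: "U holomorphic_on \<Omega>" "\<And>z. z \<in> \<Omega> \<Longrightarrow> z * poly (pderiv T) z = m * U z * poly T z"
  defines "D1 \<equiv> \<lambda>w. w * deriv U w"
  shows "poly (shifted_euler c3 (shifted_euler c2 (shifted_euler c1 T))) w =
    (m * (w * deriv D1 w) + m * D1 w * (2 * m * U w + c1 + c2) +
     (m * U w + c3) * (m * D1 w + (m * U w + c1) * (m * U w + c2))) * poly T w"
proof -
  have dU: "(U has_field_derivative deriv U z) (at z)" if "z \<in> \<Omega>" for z
    using U(1) \<Omega>(1) that by (rule holomorphic_derivI)
  have D1: "D1 holomorphic_on \<Omega>" unfolding D1_def using U(1) \<Omega>(1) by (intro holomorphic_intros)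
  have dD1: "(D1 has_field_derivative deriv D1 z) (at z)" if "z \<in> \<Omega>" for z
    using D1 \<Omega>(1) that by (rule holomorphic_derivI)
  define f1 where "f1 = (\<lambda>z. m * U z + c1)"
  define f2 where "f2 = (\<lambda>z. m * D1 z + (m * U z + c1) * (m * U z + c2))"
  have hol: "f1 holomorphic_on \<Omega>" "f2 holomorphic_on \<Omega>"
    unfolding f1_def f2_def using U D1 by (auto intro!: holomorphic_intros)
  have p1: "poly (shifted_euler c1 T) z = f1 z * poly T z" if "z \<in> \<Omega>" for z
    using U(2)[OF that] by (simp add: poly_shifted_euler f1_def algebra_simps)
  have d1: "deriv f1 z = m * deriv U z" if "z \<in> \<Omega>" for z
    unfolding f1_def using dU[OF that] by (intro DERIV_imp_deriv) (auto intro!: derivative_eq_intros)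
  have p2: "poly (shifted_euler c2 (shifted_euler c1 T)) z = f2 z * poly T z" if z: "z \<in> \<Omega>" for z
    by (subst poly_shifted_euler_transfer[OF \<Omega>(1) z hol(1) p1 U(2)[OF z]])
       (simp, unfold d1[OF z], simp add: f1_def f2_def D1_def algebra_simps)
  have d2: "deriv f2 z = m * deriv D1 z + m * deriv U z * (2 * m * U z + c1 + c2)" if "z \<in> \<Omega>" for z
    unfolding f2_def using dU[OF that] dD1[OF that]
    by (intro DERIV_imp_deriv) (auto intro!: derivative_eq_intros simp: algebra_simps)
  show ?thesis
    by (subst poly_shifted_euler_transfer[OF \<Omega> hol(2) p2 U(2)[OF \<Omega>(2)]])
       (simp, unfold d2[OF \<Omega>(2)], simp add: f2_def D1_def algebra_simps)
qed

section \<open>Algebraic identities on the cubic curve\<close>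

text \<open>In the parameter \<open>s\<close>, with \<open>e = 1 - s\<close>, the factors of the
  cubic are \<open>- 2 * s / e\<close>, \<open>- A / e\<close>, \<open>- B / e\<close> and
  \<open>- 2 / e\<close>, while \<open>w = s * A * B / 4\<close>. The second identity computes the
  derivative of the cubic with respect to \<open>U\<close> at this root.\<close>

lemma leading_order_identities:
  fixes s th w :: complex
  assumes s: "s \<noteq> 1" and w: "4 * w = s * ((4 - th) - (2 - th) * s) * ((2 + th) - th * s)"
  defines "U \<equiv> - 2 * s / (1 - s)"
  shows "U * (U - (4 - th)) * (U - (2 + th)) = w * (U - 2) ^ 3"
    and "(U - (4 - th)) * (U - (2 + th)) + U * (U - (2 + th)) + U * (U - (4 - th)) - 3 * w * (U - 2)\<^sup>2
       = (4 - th) * (2 + th) - 3 * th * (2 - th) * s"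
proof -
  define A B where "A = (4 - th) - (2 - th) * s" and "B = (2 + th) - th * s"
  obtain e where e: "1 - s = e" "e \<noteq> 0" using s by simp
  have U: "U = - 2 * s / e" "U - (4 - th) = - A / e" "U - (2 + th) = - B / e" "U - 2 = - 2 / e"
    using e(2) unfolding e(1)[symmetric] by (simp_all add: U_def A_def B_def field_simps)
  have w': "w = s * A * B / 4" using w unfolding A_def B_def by (metis nonzero_mult_div_cancel_left zero_neq_numeral)
  show "U * (U - (4 - th)) * (U - (2 + th)) = w * (U - 2) ^ 3"
    unfolding U(2-4) w' using e(2) by (simp add: U(1) field_simps power3_eq_cube)
  have "A * B + 2 * s * (A + B) - 3 * s * A * B = ((4 - th) * (2 + th) - 3 * th * (2 - th) * s) * (1 - s)\<^sup>2"
    unfolding A_def B_def by algebra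
  then have "(A * B + 2 * s * (A + B) - 3 * s * A * B) / e\<^sup>2 = (4 - th) * (2 + th) - 3 * th * (2 - th) * s"
    using e by simp
  moreover have "(U - (4 - th)) * (U - (2 + th)) + U * (U - (2 + th)) + U * (U - (4 - th)) - 3 * w * (U - 2)\<^sup>2
      = (A * B + 2 * s * (A + B) - 3 * s * A * B) / e\<^sup>2"
    unfolding U(2-4) w' using e(2) by (simp add: U(1) field_simps power2_eq_square)
  ultimately show "(U - (4 - th)) * (U - (2 + th)) + U * (U - (2 + th)) + U * (U - (4 - th)) - 3 * w * (U - 2)\<^sup>2
       = (4 - th) * (2 + th) - 3 * th * (2 - th) * s"
    by simp
qed

text \<open>With \<open>s\<close> for the value of \<open>\<psi>\<close> and \<open>d\<close> for
  \<open>w * deriv \<psi> w\<close>, this is the equation at the second power of n when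
  \<open>U = U0 + U1 / n\<close> is inserted into the Riccati equation; it determines
  \<open>U1\<close>. All terms are brought over the denominator \<open>2 * e\<^sup>2 * Q\<close>,
  which leaves a polynomial identity.\<close>

lemma first_order_identity:
  fixes s th w a b d :: complex
  defines "A \<equiv> (4 - th) - (2 - th) * s" and "B \<equiv> (2 + th) - th * s"
    and "Q \<equiv> (4 - th) * (2 + th) - 3 * th * (2 - th) * s" and "U \<equiv> - 2 * s / (1 - s)"
  assumes s: "s \<noteq> 1" and w: "4 * w = s * A * B" and d: "d = s * A * B / ((1 - s) * Q)"
    and nz: "A \<noteq> 0" "B \<noteq> 0" "Q \<noteq> 0"
  shows "Q * (d * (- (2 - th) * (a + 1) / A - th * (b + 1) / B
        + (1 / (1 - s) + 3 * th * (2 - th) / Q) / 2))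
    + (3 * (1 - w) * (U - 2) * (- 2 * d / (1 - s)\<^sup>2)
       - U * ((a + 1) * (U - (2 + th)) + (b + 1) * (U - (4 - th))) + w * (a + b) * (U - 2)\<^sup>2) = 0"
proof -
  obtain e where e: "1 - s = e" "e \<noteq> 0" using s by simp
  have U: "U = - 2 * s / e" "U - (4 - th) = - A / e" "U - (2 + th) = - B / e" "U - 2 = - 2 / e"
    using e(2) unfolding e(1)[symmetric] by (simp_all add: U_def A_def B_def field_simps)
  have w': "w = s * A * B / 4" using w by (metis nonzero_mult_div_cancel_left zero_neq_numeral)
  define p q r where "p = 2 - th" and "q = 3 * th * (2 - th)" and "r = 4 - th * (2 - th) * s"
  \<comment> \<open>At \<open>s = 1\<close> the function \<open>s * A * B\<close> of
    \<open>s\<close> has a critical point with value 4; hence \<open>(1 - s)\<^sup>2\<close> splits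
    off.\<close>
  have "4 * (1 - w) = 4 - s * A * B" using w by (simp add: algebra_simps)
  also have "\<dots> = (1 - s)\<^sup>2 * r"
    unfolding A_def B_def r_def by algebra
  finally have one_w: "1 - w = e\<^sup>2 * r / 4"
    unfolding e(1) by (metis nonzero_mult_div_cancel_left zero_neq_numeral)
  have f1: "d * (- p * (a + 1) / A) = s / (e * Q) * (- p * (a + 1) * B)"
    and f2: "d * (th * (b + 1) / B) = s / (e * Q) * (th * (b + 1) * A)"
    unfolding d e(1) using nz by simp_all
  have f3: "d * ((1 / e + q / Q) / 2) = s * A * B * (Q + q * e) / (2 * e\<^sup>2 * Q\<^sup>2)"
    unfolding d e(1) using nz e(2) by (simp add: field_simps power2_eq_square)
  have lin: "x * (y1 - y2 + y3) = x * y1 - x * y2 + x * y3" for x y1 y2 y3 :: complex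
    by (simp add: algebra_simps)
  have 0: "d * (- p * (a + 1) / A - th * (b + 1) / B + (1 / e + q / Q) / 2)
      = s / (e * Q) * (- p * (a + 1) * B) - s / (e * Q) * (th * (b + 1) * A)
        + s * A * B * (Q + q * e) / (2 * e\<^sup>2 * Q\<^sup>2)"
    by (simp only: lin f1 f2 f3)
  have "Q * (s / (e * Q) * X - s / (e * Q) * Y + s * A * B * Z / (2 * e\<^sup>2 * Q\<^sup>2))
      = s * (2 * Q * e * (X - Y) + A * B * Z) / (2 * e\<^sup>2 * Q)" for X Y Z
    using nz e(2) by (simp add: field_simps power2_eq_square)
  then have 1: "Q * (d * (- p * (a + 1) / A - th * (b + 1) / B + (1 / e + q / Q) / 2))
      = s * (2 * Q * e * (- p * (a + 1) * B - th * (b + 1) * A) + A * B * (Q + q * e)) / (2 * e\<^sup>2 * Q)"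
    by (simp only: 0)
  have 2: "3 * (1 - w) * (U - 2) * (- 2 * d / e\<^sup>2) = s * (6 * r * A * B) / (2 * e\<^sup>2 * Q)"
    unfolding U(4) one_w d e(1) using nz e(2) by (simp add: field_simps power2_eq_square)
  have 3: "w * (a + b) * (U - 2)\<^sup>2 - U * ((a + 1) * (U - (2 + th)) + (b + 1) * (U - (4 - th)))
      = s * (2 * Q * (- 2 * ((a + 1) * B + (b + 1) * A) + A * B * (a + b))) / (2 * e\<^sup>2 * Q)"
    unfolding U(2-4) w' unfolding U(1) using nz e(2) by (simp add: field_simps power2_eq_square)
  have "Q * (d * (- p * (a + 1) / A - th * (b + 1) / B + (1 / e + q / Q) / 2))
      + (3 * (1 - w) * (U - 2) * (- 2 * d / e\<^sup>2)
         - U * ((a + 1) * (U - (2 + th)) + (b + 1) * (U - (4 - th))) + w * (a + b) * (U - 2)\<^sup>2)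
      = s * (2 * Q * e * (- p * (a + 1) * B - th * (b + 1) * A)
        + A * B * (Q + q * e) + 6 * r * A * B
        + 2 * Q * (- 2 * ((a + 1) * B + (b + 1) * A) + A * B * (a + b))) / (2 * e\<^sup>2 * Q)"
  proof -
    have "x1 + (x2 - x3 + x4) = x1 + x2 + (x4 - x3)" for x1 x2 x3 x4 :: complex by simp
    moreover have "s * (p1 + p2 + p3) / D = s * p1 / D + s * p2 / D + s * p3 / D" for p1 p2 p3 D :: complex
      by (simp add: distrib_left add_divide_distrib)
    ultimately show ?thesis by (simp only: 1 2 3)
  qed
  also have "2 * Q * e * (- p * (a + 1) * B - th * (b + 1) * A)
        + A * B * (Q + q * e) + 6 * r * A * B
        + 2 * Q * (- 2 * ((a + 1) * B + (b + 1) * A) + A * B * (a + b)) = 0"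
    unfolding A_def B_def Q_def p_def q_def r_def e(1)[symmetric] by algebra
  finally show ?thesis by (simp add: p_def q_def e(1))
qed

text \<open>\<open>\<psi>\<close> stands for \<open>1 / \<phi>0 (1 / w)\<close>. The excluded values
  are those where the root or its first correction would become singular: \<open>1 - \<psi>\<close>,
  \<open>A\<close>, \<open>B\<close> and \<open>Q\<close> occur as denominators in \<open>U0\<close>
  and \<open>U1\<close>.\<close>

locale inverse_branch =
  fixes th :: complex and \<psi> :: "complex \<Rightarrow> complex"
  assumes \<psi>_holomorphic: "\<psi> holomorphic_on cut_plane" and \<psi>_0: "\<psi> 0 = 0"
    and \<psi>_eq: "\<And>w. w \<in> cut_plane \<Longrightarrow>
      4 * w = \<psi> w * ((4 - th) - (2 - th) * \<psi> w) * ((2 + th) - th * \<psi> w)"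
    and \<psi>_ne: "\<And>w. w \<in> cut_plane \<Longrightarrow> \<psi> w \<noteq> 1"
      "\<And>w. w \<in> cut_plane \<Longrightarrow> (4 - th) - (2 - th) * \<psi> w \<noteq> 0"
      "\<And>w. w \<in> cut_plane \<Longrightarrow> (2 + th) - th * \<psi> w \<noteq> 0"
      "\<And>w. w \<in> cut_plane \<Longrightarrow> (4 - th) * (2 + th) - 3 * th * (2 - th) * \<psi> w \<noteq> 0"
begin

definition "A w = (4 - th) - (2 - th) * \<psi> w"
definition "B w = (2 + th) - th * \<psi> w"
definition "Q w = (4 - th) * (2 + th) - 3 * th * (2 - th) * \<psi> w"
definition "U0 w = - 2 * \<psi> w / (1 - \<psi> w)"
definition "d\<psi> w = w * deriv \<psi> w"
text \<open>This is \<open>w * d/dw\<close> of the logarithm of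
  \<open>A^(a + 1) * B^(b + 1) / sqrt ((1 - \<psi>) * Q)\<close>, up to a constant factor the part
  of the main term that does not depend on \<open>n\<close>.\<close>

definition "U1 a b w = d\<psi> w * (- (2 - th) * (a + 1) / A w - th * (b + 1) / B w
        + (1 / (1 - \<psi> w) + 3 * th * (2 - th) / Q w) / 2)"

lemma ne: assumes "w \<in> cut_plane" shows "1 - \<psi> w \<noteq> 0" "A w \<noteq> 0" "B w \<noteq> 0" "Q w \<noteq> 0"
  using \<psi>_ne[OF assms] by (auto simp: A_def B_def Q_def)

lemma ABQ_holomorphic [holomorphic_intros]:
  "A holomorphic_on cut_plane" "B holomorphic_on cut_plane" "Q holomorphic_on cut_plane"
  "U0 holomorphic_on cut_plane" "d\<psi> holomorphic_on cut_plane" "U1 a b holomorphic_on cut_plane"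
proof -
  show h: "A holomorphic_on cut_plane" "B holomorphic_on cut_plane" "Q holomorphic_on cut_plane"
    "d\<psi> holomorphic_on cut_plane"
    unfolding A_def B_def Q_def d\<psi>_def
    by (intro holomorphic_intros \<psi>_holomorphic open_cut_plane)+
  show "U0 holomorphic_on cut_plane" "U1 a b holomorphic_on cut_plane"
    unfolding U0_def U1_def using ne by (intro holomorphic_intros h \<psi>_holomorphic; auto)+
qed

lemma \<psi>_eq': "w \<in> cut_plane \<Longrightarrow> 4 * w = \<psi> w * A w * B w"
  using \<psi>_eq by (simp add: A_def B_def)

lemma \<psi>_DERIV: "w \<in> cut_plane \<Longrightarrow> (\<psi> has_field_derivative deriv \<psi> w) (at w)"
  using \<psi>_holomorphic open_cut_plane by (rule holomorphic_derivI)

text \<open>The derivative of \<open>s * A * B\<close> with respect to \<open>s\<close> factors as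
  \<open>(1 - s) * Q\<close>, so differentiating \<open>4 * w = \<psi> * A * B\<close> gives
  \<open>deriv \<psi> w = 4 / ((1 - \<psi> w) * Q w)\<close>; multiplying by \<open>w\<close> brings
  back the cubic.\<close>

lemma d\<psi>_eq:
  assumes w: "w \<in> cut_plane"
  shows "d\<psi> w = \<psi> w * A w * B w / ((1 - \<psi> w) * Q w)"
proof -
  note dp = \<psi>_DERIV[OF w]
  have "((\<lambda>w. \<psi> w * A w * B w) has_field_derivative deriv \<psi> w * ((1 - \<psi> w) * Q w)) (at w)"
    unfolding A_def B_def Q_def by (rule derivative_eq_intros dp refl)+ algebra
  then have "((\<lambda>w. 4 * w) has_field_derivative deriv \<psi> w * ((1 - \<psi> w) * Q w)) (at w)"
    by (rule has_field_derivative_transform_within_open[OF _ open_cut_plane w]) (simp add: \<psi>_eq')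
  moreover have "((\<lambda>w. 4 * w) has_field_derivative 4) (at w)" by (auto intro!: derivative_eq_intros)
  ultimately have "deriv \<psi> w * ((1 - \<psi> w) * Q w) = 4" by (rule DERIV_unique)
  then have "w * deriv \<psi> w * ((1 - \<psi> w) * Q w) = \<psi> w * A w * B w"
    using \<psi>_eq'[OF w] by (metis mult.assoc mult.commute)
  then show ?thesis using ne[OF w] by (simp add: d\<psi>_def field_simps)
qed

lemma U0_deriv:
  assumes w: "w \<in> cut_plane"
  shows "w * deriv U0 w = - 2 * d\<psi> w / (1 - \<psi> w)\<^sup>2"
proof -
  note dp = \<psi>_DERIV[OF w]
  have "(U0 has_field_derivative - 2 * deriv \<psi> w / (1 - \<psi> w)\<^sup>2) (at w)"
    unfolding U0_def using ne[OF w]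
    by (auto intro!: derivative_eq_intros dp simp: field_simps power2_eq_square)
  then show ?thesis by (simp add: DERIV_imp_deriv d\<psi>_def)
qed

end

text \<open>\<open>U\<close> is meant as \<open>w * T' / (n * T)\<close> for the reversed polynomial
  \<open>T\<close>; the equation is the differential equation for \<open>T\<close> divided by
  \<open>T\<close>. With \<open>N = 2 * n\<close> one has \<open>N + n1 = (4 - \<theta>) * n\<close>
  and \<open>N + n2 = (2 + \<theta>) * n\<close>, the origin of the coefficients.\<close>

locale riccati_family = inverse_branch +
  fixes I :: "'i set" and n :: "'i \<Rightarrow> nat" and U :: "'i \<Rightarrow> complex \<Rightarrow> complex" and a b :: complex
  assumes n_pos: "\<And>i. i \<in> I \<Longrightarrow> n i > 0"
    and U_holomorphic: "\<And>i. i \<in> I \<Longrightarrow> U i holomorphic_on cut_plane"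
    and U_0: "\<And>i. i \<in> I \<Longrightarrow> U i 0 = 0"
    and U_bounded: "locally_bounded_family I cut_plane U"
    and riccati: "\<And>i w m D1 D2. i \<in> I \<Longrightarrow> w \<in> cut_plane \<Longrightarrow> m = of_nat (n i) \<Longrightarrow>
       D1 = w * deriv (U i) w \<Longrightarrow> D2 = w * deriv (\<lambda>z. z * deriv (U i) z) w \<Longrightarrow>
       m * D2 + m * D1 * (2 * m * U i w - ((2 + th) * m + b + 1) - ((4 - th) * m + a + 1))
         + m * U i w * (m * D1 + (m * U i w - ((2 + th) * m + b + 1)) * (m * U i w - ((4 - th) * m + a + 1)))
       = w * (m * D2 + m * D1 * (2 * m * U i w - (2 * m + b) - (2 * m + a))
         + (m * U i w - 2 * m) * (m * D1 + (m * U i w - (2 * m + b)) * (m * U i w - (2 * m + a))))"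
begin

definition "D1 i w = w * deriv (U i) w"
definition "D2 i w = w * deriv (D1 i) w"
text \<open>Sorted by powers of \<open>m\<close>, the Riccati equation is
  \<open>m^3 * F0 + m^2 * F1 + m * F2 = 0\<close>, where \<open>F0\<close> is the cubic.
  \<open>F1\<close> is kept as a function of \<open>u\<close> and \<open>d\<close> because it is
  evaluated at \<open>U\<close> and at \<open>U0\<close>.\<close>

definition "F1 u d w = 3 * (1 - w) * (u - 2) * d
       - u * ((a + 1) * (u - (2 + th)) + (b + 1) * (u - (4 - th))) + w * (a + b) * (u - 2)\<^sup>2"
definition "F2 i w = D2 i w - (a + b + 2) * D1 i w + U i w * (a + 1) * (b + 1)
   - w * (D2 i w - (a + b) * D1 i w + (U i w - 2) * a * b)"
definition "g i w = U i w - U0 w"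
text \<open>Taylor expansion of the cubic at its root \<open>U0\<close>: its value at
  \<open>U0 + g\<close> is \<open>g * (Q + H * g)\<close>. The common factor \<open>1 - w\<close>
  appears because \<open>(4 - th) + (2 + th) = 3 * 2\<close>.\<close>

definition "H i w = 3 * (U0 w - 2) * (1 - w) + g i w * (1 - w)"
definition "V i w = of_nat (n i) * g i w"
definition "DV i w = w * deriv (V i) w"

lemma holomorphic_family:
  assumes "i \<in> I"
  shows "D1 i holomorphic_on cut_plane" "g i holomorphic_on cut_plane" "V i holomorphic_on cut_plane"
  unfolding D1_def V_def g_def using U_holomorphic[OF assms]
  by (auto intro!: holomorphic_intros open_cut_plane)

lemma bounded_U0: "locally_bounded_family I cut_plane (\<lambda>_. U0)"
  by (intro locally_bounded_family_continuous holomorphic_on_imp_continuous_on holomorphic_intros)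

lemma bounded_id: "locally_bounded_family I cut_plane (\<lambda>_ w. w)"
  by (intro locally_bounded_family_continuous continuous_intros)

lemma bounded_family:
  "locally_bounded_family I cut_plane D1" "locally_bounded_family I cut_plane F2"
  "locally_bounded_family I cut_plane g" "locally_bounded_family I cut_plane H"
proof -
  show D1: "locally_bounded_family I cut_plane D1"
    unfolding D1_def
    by (intro locally_bounded_family_mult bounded_id locally_bounded_family_deriv open_cut_plane U_holomorphic U_bounded)
  have D2: "locally_bounded_family I cut_plane D2"
    unfolding D2_def
    by (intro locally_bounded_family_mult bounded_id locally_bounded_family_deriv open_cut_plane holomorphic_family D1)
  show "locally_bounded_family I cut_plane F2"
    unfolding F2_def by (intro locally_bounded_family_arith D1 D2 U_bounded bounded_id)
  show g: "locally_bounded_family I cut_plane g"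
    unfolding g_def by (intro locally_bounded_family_diff U_bounded bounded_U0)
  show "locally_bounded_family I cut_plane H"
    unfolding H_def by (intro locally_bounded_family_arith g bounded_U0 bounded_id)
qed

text \<open>Division of the Riccati equation by \<open>m\<^sup>2\<close> leaves all derivatives of
  \<open>U\<close> on the right, where they are bounded.\<close>

lemma expanded_riccati:
  assumes i: "i \<in> I" and w: "w \<in> cut_plane"
  shows "of_nat (n i) * (g i w * (Q w + H i w * g i w)) = - F1 (U i w) (D1 i w) w - 1 / of_nat (n i) * F2 i w"
proof -
  define m where "m = complex_of_nat (n i)"
  define F0 where "F0 u = u * (u - (4 - th)) * (u - (2 + th)) - w * (u - 2) ^ 3" for u
  have m: "m \<noteq> 0" using n_pos[OF i] by (simp add: m_def)
  have "m ^ 3 * F0 (U i w) + m\<^sup>2 * F1 (U i w) (D1 i w) w + m * F2 i w = 0"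
    using riccati[OF i w m_def D1_def[of i w], of "D2 i w"]
    unfolding F0_def F1_def F2_def D2_def D1_def[abs_def] by algebra
  then have "m * (m\<^sup>2 * F0 (U i w) + m * F1 (U i w) (D1 i w) w + F2 i w) = 0" by algebra
  then have "m\<^sup>2 * F0 (U i w) + m * F1 (U i w) (D1 i w) w + F2 i w = 0" using m by simp
  then have eq: "m * F0 (U i w) = - F1 (U i w) (D1 i w) w - 1 / m * F2 i w"
    using m by (simp add: field_simps power2_eq_square) algebra
  note lead = leading_order_identities[OF \<psi>_ne(1)[OF w] \<psi>_eq[OF w], folded U0_def Q_def]
  have U: "U i w = U0 w + g i w" by (simp add: g_def)
  have "F0 (U i w) = F0 (U0 w) + g i w * (((U0 w - (4 - th)) * (U0 w - (2 + th)) + U0 w * (U0 w - (2 + th))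
      + U0 w * (U0 w - (4 - th)) - 3 * w * (U0 w - 2)\<^sup>2) + H i w * g i w)"
    unfolding F0_def H_def U by algebra
  also have "F0 (U0 w) = 0" using lead(1) by (simp add: F0_def)
  finally show ?thesis using eq unfolding lead(2) m_def by simp
qed

text \<open>First pass: the right side of \<open>expanded_riccati\<close> is bounded, and the
  bootstrap selects the root \<open>U0\<close> because \<open>g\<close> vanishes at 0.\<close>

lemma V_bounded: "locally_bounded_family I cut_plane V"
  unfolding V_def
proof (rule locally_bounded_family_bootstrap[where q = Q and H = H])
  show "g i 0 = 0" if "i \<in> I" for i using U_0[OF that] by (simp add: g_def U0_def \<psi>_0)
  have "locally_bounded_family I cut_plane (\<lambda>i w. F1 (U i w) (D1 i w) w)"
  proof -
    have c: "locally_bounded_family I cut_plane (\<lambda>i w. U i w - c)" for c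
      by (intro locally_bounded_family_diff U_bounded locally_bounded_family_const)
    show ?thesis
      unfolding F1_def power2_eq_square
      by (intro locally_bounded_family_arith U_bounded c bounded_id bounded_family)
  qed
  then have "locally_bounded_family I cut_plane (\<lambda>i w. - F1 (U i w) (D1 i w) w - 1 / of_nat (n i) * F2 i w)"
    by (intro locally_bounded_family_diff locally_bounded_family_uminus
        locally_bounded_family_mult[OF locally_bounded_family_inverse_nat] bounded_family)
  then show "locally_bounded_family I cut_plane (\<lambda>i w. of_nat (n i) * (g i w * (Q w + H i w * g i w)))"
    by (rule locally_bounded_family_cong) (simp only: expanded_riccati)
qed (use ne bounded_family holomorphic_family n_pos in
      \<open>auto intro!: zero_in_cut_plane closed_segment_cut_plane
         intro: holomorphic_on_imp_continuous_on ABQ_holomorphic\<close>)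

text \<open>Second pass: \<open>Q * U1 = - F1 (U0 w) D10 w\<close> is subtracted. The difference of
  the two values of \<open>F1\<close> becomes, after multiplication by \<open>n\<close>, a
  combination of \<open>V\<close> and \<open>DV\<close> with bounded coefficients, so everything on
  the right is bounded.\<close>

lemma V_minus_U1:
  assumes i: "i \<in> I" and w: "w \<in> cut_plane"
  shows "of_nat (n i) * (V i w - U1 a b w) = 1 / Q w * (- V i w * V i w * H i w - F2 i w -
     (V i w * (- (a + b + 2) * (U i w + U0 w) + (a + 1) * (2 + th) + (b + 1) * (4 - th)
        + w * (a + b) * (U i w + U0 w - 4)) + 3 * (1 - w) * (V i w * D1 i w + (U0 w - 2) * DV i w)))"
proof -
  define m where "m = complex_of_nat (n i)"
  have m: "m \<noteq> 0" using n_pos[OF i] by (simp add: m_def)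
  have V: "V i w = m * g i w" by (simp add: V_def m_def)
  define D10 where "D10 = - 2 * d\<psi> w / (1 - \<psi> w)\<^sup>2"
  have dV: "deriv (V i) w = m * (deriv (U i) w - deriv U0 w)"
  proof (rule DERIV_imp_deriv)
    have "(U i has_field_derivative deriv (U i) w) (at w)" "(U0 has_field_derivative deriv U0 w) (at w)"
      using U_holomorphic[OF i] ABQ_holomorphic(4) open_cut_plane w by (auto intro: holomorphic_derivI)
    then show "(V i has_field_derivative m * (deriv (U i) w - deriv U0 w)) (at w)"
      unfolding V_def[abs_def] g_def m_def by (auto intro!: derivative_eq_intros)
  qed
  have DV: "DV i w = m * (D1 i w - D10)"
    unfolding DV_def dV D1_def D10_def U0_deriv[OF w, symmetric] by (simp add: algebra_simps)
  have first: "Q w * U1 a b w + F1 (U0 w) D10 w = 0"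
    using first_order_identity[OF \<psi>_ne(1)[OF w], of w th "d\<psi> w" a b] \<psi>_eq'[OF w] d\<psi>_eq[OF w] ne[OF w]
    unfolding A_def B_def Q_def U0_def U1_def F1_def D10_def by simp
  have "m * (m * (g i w * (Q w + H i w * g i w))) = m * (- F1 (U i w) (D1 i w) w - 1 / m * F2 i w)"
    using expanded_riccati[OF i w] by (simp add: m_def)
  then have eq: "m * (m * (g i w * (Q w + H i w * g i w))) = - m * F1 (U i w) (D1 i w) w - F2 i w"
    using m by (simp add: algebra_simps)
  have U: "U i w = U0 w + g i w" by (simp add: g_def)
  have "Q w * (m * (V i w - U1 a b w)) = - V i w * V i w * H i w - F2 i w -
     (V i w * (- (a + b + 2) * (U i w + U0 w) + (a + 1) * (2 + th) + (b + 1) * (4 - th)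
        + w * (a + b) * (U i w + U0 w - 4)) + 3 * (1 - w) * (V i w * D1 i w + (U0 w - 2) * DV i w))"
    using eq first unfolding F1_def DV V U by algebra
  then show ?thesis using ne(4)[OF w] unfolding m_def by (simp add: field_simps)
qed

lemma V_minus_U1_bounded:
  "locally_bounded_family I cut_plane (\<lambda>i w. of_nat (n i) * (V i w - U1 a b w))"
proof -
  have DV: "locally_bounded_family I cut_plane DV"
    unfolding DV_def
    by (intro locally_bounded_family_mult bounded_id locally_bounded_family_deriv open_cut_plane
        holomorphic_family V_bounded)
  have "locally_bounded_family I cut_plane (\<lambda>i w. 1 / Q w)"
    using ne by (intro locally_bounded_family_continuous holomorphic_on_imp_continuous_on holomorphic_intros)
  then have "locally_bounded_family I cut_plane (\<lambda>i w. 1 / Q w * (- V i w * V i w * H i w - F2 i w -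
     (V i w * (- (a + b + 2) * (U i w + U0 w) + (a + 1) * (2 + th) + (b + 1) * (4 - th)
        + w * (a + b) * (U i w + U0 w - 4)) + 3 * (1 - w) * (V i w * D1 i w + (U0 w - 2) * DV i w))))"
    by (intro locally_bounded_family_arith V_bounded bounded_family U_bounded bounded_U0 bounded_id DV)
  then show ?thesis by (rule locally_bounded_family_cong) (simp only: V_minus_U1)
qed

text \<open>The comparison function is the first-order WKB solution of the differential equation.\<close>

lemma quotient_asymptotics:
  fixes T :: "'i \<Rightarrow> complex \<Rightarrow> complex" and L1 L2 E :: "complex \<Rightarrow> complex"
  assumes L1: "L1 holomorphic_on cut_plane" "L1 0 = 0" "\<And>w. w \<in> cut_plane \<Longrightarrow> (4 - th) * exp (L1 w) = A w"
    and L2: "L2 holomorphic_on cut_plane" "L2 0 = 0" "\<And>w. w \<in> cut_plane \<Longrightarrow> (2 + th) * exp (L2 w) = B w"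
    and E: "E holomorphic_on cut_plane" "E 0 = 1"
      "\<And>w. w \<in> cut_plane \<Longrightarrow> (4 - th) * (2 + th) * (E w)\<^sup>2 = (1 - \<psi> w) * Q w"
    and T: "\<And>i. i \<in> I \<Longrightarrow> T i holomorphic_on cut_plane" "\<And>i. i \<in> I \<Longrightarrow> T i 0 = 1"
      "\<And>i w. i \<in> I \<Longrightarrow> w \<in> cut_plane \<Longrightarrow> T i w \<noteq> 0"
      "\<And>i w. i \<in> I \<Longrightarrow> w \<in> cut_plane \<Longrightarrow> w * deriv (T i) w = of_nat (n i) * U i w * T i w"
  shows "locally_bounded_family I cut_plane (\<lambda>i w. of_nat (n i) *
    (T i w * E w / exp ((of_nat (n i) * (4 - th) + a + 1) * L1 w + (of_nat (n i) * (2 + th) + b + 1) * L2 w) - 1))"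
proof (rule locally_bounded_family_logderiv)
  let ?f = "\<lambda>i w. T i w * E w / exp ((of_nat (n i) * (4 - th) + a + 1) * L1 w + (of_nat (n i) * (2 + th) + b + 1) * L2 w)"
  have E_ne: "E w \<noteq> 0" if "w \<in> cut_plane" for w
    using E(3)[OF that] ne[OF that] by auto
  have hol: "?f i holomorphic_on cut_plane" if "i \<in> I" for i
    by (intro holomorphic_intros T(1) L1(1) L2(1) E(1) that) simp
  show f_ne: "?f i w \<noteq> 0" if "i \<in> I" "w \<in> cut_plane" for i w
    using T(3)[OF that] E_ne[OF that(2)] by simp
  \<comment> \<open>The terms of the exponent proportional to \<open>n\<close> contribute
    \<open>- n * U0\<close>; the others together with \<open>E\<close> contribute
    \<open>- U1\<close>.\<close>
  have logderiv: "w * (deriv (?f i) w / ?f i w) = V i w - U1 a b w" if i: "i \<in> I" and w: "w \<in> cut_plane" for i w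
  proof -
    define m where "m = complex_of_nat (n i)"
    define c1 c2 where "c1 = m * (4 - th) + a + 1" and "c2 = m * (2 + th) + b + 1"
    have D: "(T i has_field_derivative deriv (T i) w) (at w)" "(E has_field_derivative deriv E w) (at w)"
      "(L1 has_field_derivative deriv L1 w) (at w)" "(L2 has_field_derivative deriv L2 w) (at w)"
      using T(1)[OF i] L1(1) L2(1) E(1) open_cut_plane w by (auto intro: holomorphic_derivI)
    note dp = \<psi>_DERIV[OF w]
    have "((\<lambda>w. (4 - th) * exp (L1 w)) has_field_derivative (4 - th) * (exp (L1 w) * deriv L1 w)) (at w)"
      by (auto intro!: derivative_eq_intros D)
    then have "(A has_field_derivative (4 - th) * (exp (L1 w) * deriv L1 w)) (at w)"
      by (rule has_field_derivative_transform_within_open[OF _ open_cut_plane w]) (simp add: L1(3))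
    moreover have "(A has_field_derivative - (2 - th) * deriv \<psi> w) (at w)"
      unfolding A_def by (auto intro!: derivative_eq_intros dp simp: algebra_simps)
    ultimately have "(4 - th) * (exp (L1 w) * deriv L1 w) = - (2 - th) * deriv \<psi> w" by (rule DERIV_unique)
    then have "A w * (w * deriv L1 w) = - (2 - th) * d\<psi> w"
      unfolding d\<psi>_def L1(3)[OF w, symmetric] by algebra
    then have dL1: "w * deriv L1 w = - (2 - th) * d\<psi> w / A w"
      using ne(2)[OF w] by (metis nonzero_mult_div_cancel_left)
    have "((\<lambda>w. (2 + th) * exp (L2 w)) has_field_derivative (2 + th) * (exp (L2 w) * deriv L2 w)) (at w)"
      by (auto intro!: derivative_eq_intros D)
    then have "(B has_field_derivative (2 + th) * (exp (L2 w) * deriv L2 w)) (at w)"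
      by (rule has_field_derivative_transform_within_open[OF _ open_cut_plane w]) (simp add: L2(3))
    moreover have "(B has_field_derivative - th * deriv \<psi> w) (at w)"
      unfolding B_def by (auto intro!: derivative_eq_intros dp simp: algebra_simps)
    ultimately have "(2 + th) * (exp (L2 w) * deriv L2 w) = - th * deriv \<psi> w" by (rule DERIV_unique)
    then have "B w * (w * deriv L2 w) = - th * d\<psi> w"
      unfolding d\<psi>_def L2(3)[OF w, symmetric] by algebra
    then have dL2: "w * deriv L2 w = - th * d\<psi> w / B w"
      using ne(3)[OF w] by (metis nonzero_mult_div_cancel_left)
    have "((\<lambda>w. (4 - th) * (2 + th) * (E w)\<^sup>2) has_field_derivative (4 - th) * (2 + th) * (2 * E w * deriv E w)) (at w)"
      by (auto intro!: derivative_eq_intros D)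
    then have "((\<lambda>w. (1 - \<psi> w) * Q w) has_field_derivative (4 - th) * (2 + th) * (2 * E w * deriv E w)) (at w)"
      by (rule has_field_derivative_transform_within_open[OF _ open_cut_plane w]) (simp add: E(3))
    moreover have "((\<lambda>w. (1 - \<psi> w) * Q w) has_field_derivative
        - deriv \<psi> w * Q w - (1 - \<psi> w) * (3 * th * (2 - th) * deriv \<psi> w)) (at w)"
      unfolding Q_def by (auto intro!: derivative_eq_intros dp simp: algebra_simps)
    ultimately have "(4 - th) * (2 + th) * (2 * E w * deriv E w)
        = - deriv \<psi> w * Q w - (1 - \<psi> w) * (3 * th * (2 - th) * deriv \<psi> w)" by (rule DERIV_unique)
    moreover have "(4 - th) * (2 + th) * (2 * E w * deriv E w)
        = 2 * ((4 - th) * (2 + th) * (E w)\<^sup>2) * (deriv E w / E w)"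
      using E_ne[OF w] by (simp add: power2_eq_square)
    ultimately have "2 * ((1 - \<psi> w) * Q w) * (w * (deriv E w / E w))
        = - d\<psi> w * Q w - (1 - \<psi> w) * (3 * th * (2 - th) * d\<psi> w)"
      unfolding E(3)[OF w] d\<psi>_def by algebra
    moreover have "x = - d * (1 / e + k / q) / 2"
      if "2 * (e * q) * x = - d * q - e * (k * d)" "e \<noteq> 0" "q \<noteq> 0" for x d e k q :: complex
      using that by (simp add: field_simps)
    ultimately have dE: "w * (deriv E w / E w) = - d\<psi> w * (1 / (1 - \<psi> w) + 3 * th * (2 - th) / Q w) / 2"
      using ne[OF w] by blast
    have "(?f i has_field_derivative ?f i w * (deriv (T i) w / T i w + deriv E w / E w - (c1 * deriv L1 w + c2 * deriv L2 w))) (at w)"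
      unfolding m_def[symmetric] c1_def[symmetric] c2_def[symmetric]
      using T(3)[OF i w] E_ne[OF w]
      by (auto intro!: derivative_eq_intros D simp: field_simps)
    then have ld: "deriv (?f i) w / ?f i w = deriv (T i) w / T i w + deriv E w / E w - (c1 * deriv L1 w + c2 * deriv L2 w)"
      using f_ne[OF i w] by (simp add: DERIV_imp_deriv)
    have "w * (deriv (?f i) w / ?f i w) = w * deriv (T i) w / T i w + w * (deriv E w / E w)
        - (c1 * (w * deriv L1 w) + c2 * (w * deriv L2 w))"
      unfolding ld by (simp add: algebra_simps)
    also have "w * deriv (T i) w / T i w = m * U i w"
      using T(3,4)[OF i w] by (simp add: m_def)
    also note dE also note dL1 also note dL2
    also have "m * U i w + - d\<psi> w * (1 / (1 - \<psi> w) + 3 * th * (2 - th) / Q w) / 2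
        - (c1 * (- (2 - th) * d\<psi> w / A w) + c2 * (- th * d\<psi> w / B w))
      = m * U i w + m * (d\<psi> w * ((4 - th) * (2 - th) / A w + (2 + th) * th / B w)) - U1 a b w"
      unfolding c1_def c2_def U1_def divide_inverse by algebra
    \<comment> \<open>In other words, the logarithm of \<open>A^(4 - th) * B^(2 + th)\<close> has
      the Euler derivative \<open>U0\<close>: the numerators combine to \<open>2 * Q\<close>, which
      cancels against the denominator of \<open>d\<psi>\<close>.\<close>
    also have "d\<psi> w * ((4 - th) * (2 - th) / A w + (2 + th) * th / B w) = - U0 w"
    proof -
      have "p * x * y * (k / x + l / y) = p * (k * y + l * x)"
        if "x \<noteq> 0" "y \<noteq> 0" for p x y k l :: complex
        using that by (simp add: field_simps)
      then have "p * x * y / c * (k / x + l / y) = p * (k * y + l * x) / c"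
        if "x \<noteq> 0" "y \<noteq> 0" for p x y c k l :: complex
        using that by (metis times_divide_eq_left)
      then have "d\<psi> w * ((4 - th) * (2 - th) / A w + (2 + th) * th / B w)
          = \<psi> w * ((4 - th) * (2 - th) * B w + (2 + th) * th * A w) / ((1 - \<psi> w) * Q w)"
        unfolding d\<psi>_eq[OF w] using ne[OF w] by blast
      also have "(4 - th) * (2 - th) * B w + (2 + th) * th * A w = 2 * Q w"
        unfolding A_def B_def Q_def by algebra
      finally show ?thesis using ne[OF w] by (simp add: U0_def)
    qed
    finally show ?thesis by (simp add: V_def g_def m_def algebra_simps)
  qed
  have "locally_bounded_family I cut_plane (\<lambda>i w. w * (of_nat (n i) * (deriv (?f i) w / ?f i w)))"
    using V_minus_U1_bounded
  proof (rule locally_bounded_family_cong)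
    fix i w assume "i \<in> I" "w \<in> cut_plane"
    note ld = logderiv[OF this]
    have "x * (y * z) = y * v" if "x * z = v" for x y z v :: complex
      unfolding that[symmetric] by (rule mult.left_commute)
    from this[OF ld] show "of_nat (n i) * (V i w - U1 a b w) = w * (of_nat (n i) * (deriv (?f i) w / ?f i w))"
      by (rule sym)
  qed
  \<comment> \<open>The differential equation controls only \<open>w\<close> times the logarithmic
    derivative; the factor \<open>w\<close> is removed by holomorphy at 0.\<close>
  then show "locally_bounded_family I cut_plane (\<lambda>i w. of_nat (n i) * (deriv (?f i) w / ?f i w))"
  proof (rule locally_bounded_family_cancel_id[OF open_cut_plane zero_in_cut_plane, rotated])
    fix i assume i: "i \<in> I"
    show "(\<lambda>w. of_nat (n i) * (deriv (?f i) w / ?f i w)) holomorphic_on cut_plane"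
      by (rule holomorphic_on_mult[OF holomorphic_on_const
            holomorphic_on_divide[OF holomorphic_deriv[OF hol open_cut_plane] hol f_ne]]) (use i in auto)
  qed
  show "?f i holomorphic_on cut_plane" "?f i 0 = 1" if "i \<in> I" for i
    using hol T(2) L1(2) L2(2) E(2) that by auto
qed (auto intro: n_pos zero_in_cut_plane open_cut_plane closed_segment_cut_plane[THEN subsetD])

end

section \<open>The inverse branch\<close>

lemma theta_simps:
  assumes "0 < \<theta>" "\<theta> < 1"
  shows "(4 - \<theta>) * \<theta>1 \<theta> = 2 - \<theta>" "(2 + \<theta>) * \<theta>2 \<theta> = \<theta>" "(4 - \<theta>) * (2 + \<theta>) * c0 \<theta> = 4"
    "0 < \<theta>1 \<theta>" "0 < \<theta>2 \<theta>" "0 < c0 \<theta>" "3 * \<theta>1 \<theta> * \<theta>2 \<theta> < \<theta>1 \<theta>" "c0 \<theta> = (1 - \<theta>1 \<theta>) * (1 - \<theta>2 \<theta>)"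
proof -
  show "(4 - \<theta>) * \<theta>1 \<theta> = 2 - \<theta>" "(2 + \<theta>) * \<theta>2 \<theta> = \<theta>" "(4 - \<theta>) * (2 + \<theta>) * c0 \<theta> = 4"
    using assms by (auto simp: \<theta>1_def \<theta>2_def c0_def divide_simps)
  show pos: "0 < \<theta>1 \<theta>" "0 < \<theta>2 \<theta>" "0 < c0 \<theta>" using assms by (auto simp: \<theta>1_def \<theta>2_def c0_def)
  have "3 * \<theta>2 \<theta> < 1" using assms by (simp add: \<theta>2_def field_simps)
  then show "3 * \<theta>1 \<theta> * \<theta>2 \<theta> < \<theta>1 \<theta>" using pos(1) by (simp add: mult.assoc mult.left_commute[of 3])
  show "c0 \<theta> = (1 - \<theta>1 \<theta>) * (1 - \<theta>2 \<theta>)"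
    using assms by (simp add: \<theta>1_def \<theta>2_def c0_def field_simps)
qed

text \<open>The four alternatives say that \<open>x\<close> and \<open>y\<close> lie on the same side of the branch cut of the
  principal logarithm, where the negative axis counts as a side of its own.\<close>

definition same_side :: "complex \<Rightarrow> complex \<Rightarrow> bool" where
  "same_side x y \<longleftrightarrow> (Im x > 0 \<and> Im y > 0) \<or> (Im x < 0 \<and> Im y < 0) \<or>
     (Im x = 0 \<and> Im y = 0 \<and> Re x < 0 \<and> Re y < 0) \<or> (Im x = 0 \<and> Im y = 0 \<and> Re x > 0 \<and> Re y > 0)"

text \<open>The arguments of \<open>x\<close> and \<open>y\<close> both lie in
  \<open>(0, pi)\<close>, or both in \<open>(-pi, 0)\<close>, or they are equal. They differ by less
  than \<open>pi\<close>, so the difference of the principal logarithms is again principal.\<close>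

lemma same_side_Ln_divide:
  assumes "same_side x y"
  shows "Ln (x / y) = Ln x - Ln y" "x / y \<notin> \<real>\<^sub>\<le>\<^sub>0"
proof -
  have nz: "x \<noteq> 0" "y \<noteq> 0" using assms by (auto simp: same_side_def)
  have neg: "Im (Ln v) < 0" if "Im v < 0" for v
    using that Im_Ln_pos_le[of v] Im_Ln_le_pi[of v] by (cases "v = 0") auto
  have "\<bar>Im (Ln x) - Im (Ln y)\<bar> < pi"
    using assms unfolding same_side_def
  proof (elim disjE conjE)
    assume "0 < Im x" "0 < Im y"
    then show ?thesis using Im_Ln_pos_lt_imp[of x] Im_Ln_pos_lt_imp[of y] by linarith
  next
    assume "Im x < 0" "Im y < 0"
    then show ?thesis using neg mpi_less_Im_Ln[of x] mpi_less_Im_Ln[of y] nz by (smt (verit))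
  next
    assume "Im x = 0" "Im y = 0" "Re x < 0" "Re y < 0"
    then have "Im (Ln x) = pi" "Im (Ln y) = pi" using nz by (simp_all add: Im_Ln_eq_pi)
    then show ?thesis by simp
  next
    assume "Im x = 0" "Im y = 0" "Re x > 0" "Re y > 0"
    then have "Im (Ln x) = 0" "Im (Ln y) = 0" using nz by (simp_all add: Im_Ln_eq_0)
    then show ?thesis by simp
  qed
  then have d: "- pi < Im (Ln x - Ln y)" "Im (Ln x - Ln y) < pi" by auto
  show eq: "Ln (x / y) = Ln x - Ln y"
    by (rule Ln_unique) (use d nz in \<open>auto simp: exp_diff\<close>)
  show "x / y \<notin> \<real>\<^sub>\<le>\<^sub>0"
  proof
    assume "x / y \<in> \<real>\<^sub>\<le>\<^sub>0"
    moreover have "x / y \<noteq> 0" using nz by simp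
    ultimately have "Im (Ln (x / y)) = pi"
      by (subst Im_Ln_eq_pi) (auto simp: complex_nonpos_Reals_iff complex_eq_iff)
    then show False using d eq by simp
  qed
qed

lemma connected_sign:
  fixes f :: "'a::topological_space \<Rightarrow> real"
  assumes "connected X" "continuous_on X f" "\<And>x. x \<in> X \<Longrightarrow> f x \<noteq> 0" "a \<in> X" "f a > 0" "x \<in> X"
  shows "f x > 0"
proof (rule ccontr)
  assume "\<not> f x > 0"
  then have "0 \<in> f ` X"
    using connectedD_interval[of "f ` X" "f x" "f a" 0] assms connected_continuous_image[OF assms(2,1)] by auto
  then show False using assms(3) by auto
qed

lemma slit_plane_iff: "z \<in> slit_plane \<longleftrightarrow> Im z \<noteq> 0 \<or> Re z < 0 \<or> Re z > 1"
  by (auto simp: slit_plane_def complex_eq_iff image_iff)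

lemma open_slit_plane: "open slit_plane"
  unfolding slit_plane_def
  by (intro open_Compl compact_imp_closed compact_continuous_image) (auto intro!: continuous_intros)

lemma inverse_in_slit_plane:
  assumes "w \<in> cut_plane" "w \<noteq> 0"
  shows "1 / w \<in> slit_plane"
proof (rule ccontr)
  assume "1 / w \<notin> slit_plane"
  then obtain x where x: "x \<in> {0..1}" "1 / w = of_real x" by (auto simp: slit_plane_def)
  then have "x \<noteq> 0" using assms(2) by auto
  then have "w = of_real (1 / x)" "1 / x \<in> {1..}" using x assms(2) by (auto simp: field_simps)
  then show False using assms(1) unfolding cut_plane_def by blast
qed

lemma inverse_in_cut_plane:
  assumes "z \<in> slit_plane"
  shows "1 / z \<in> cut_plane"
proof (rule ccontr)
  assume "1 / z \<notin> cut_plane"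
  then obtain x where x: "x \<in> {1..}" "1 / z = of_real x" by (auto simp: cut_plane_def)
  then have "z = of_real (1 / x)" by (metis div_by_1 divide_divide_eq_right mult_1 of_real_1 of_real_divide)
  moreover have "1 / x \<in> {0..1}" using x by auto
  ultimately show False using assms unfolding slit_plane_def by blast
qed

section \<open>Mapping properties of \<phi>0 on the slit plane\<close>

locale phi0_branch =
  fixes \<theta> :: real and \<phi> S :: "complex \<Rightarrow> complex"
  assumes \<theta>: "0 < \<theta>" "\<theta> < 1" and is_phi0: "is_phi0 \<theta> \<phi>" and is_sqrt_D: "is_sqrt_D \<theta> \<phi> S"
begin

lemma \<phi>_holomorphic: "\<phi> holomorphic_on slit_plane"
  using is_phi0 by (simp add: is_phi0_def)

lemma \<phi>_R: "z \<in> slit_plane \<Longrightarrow> R_map \<theta> (\<phi> z) = z"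
  using is_phi0 by (simp add: is_phi0_def)

text \<open>\<open>R_map\<close> is 0 at 0 and, by \<open>x / 0 = 0\<close>, at both poles, and it
  is 1 at 1; neither 0 nor 1 belongs to the slit plane.\<close>

lemma \<phi>_ne:
  assumes z: "z \<in> slit_plane"
  shows "\<phi> z \<noteq> 0" "\<phi> z \<noteq> of_real (\<theta>1 \<theta>)" "\<phi> z \<noteq> of_real (\<theta>2 \<theta>)" "\<phi> z \<noteq> 1"
proof -
  have R: "R_map \<theta> (\<phi> z) = z" using z by (rule \<phi>_R)
  have "z \<noteq> 0" "z \<noteq> 1" using z by (auto simp: slit_plane_iff)
  then show "\<phi> z \<noteq> 0" "\<phi> z \<noteq> of_real (\<theta>1 \<theta>)" "\<phi> z \<noteq> of_real (\<theta>2 \<theta>)"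
    using R by (auto simp: R_map_def)
  have "R_map \<theta> 1 = of_real (c0 \<theta> / ((1 - \<theta>1 \<theta>) * (1 - \<theta>2 \<theta>)))" by (simp add: R_map_def)
  also have "\<dots> = 1" using theta_simps(6,8)[OF \<theta>] by (metis div_self less_irrefl of_real_1)
  finally show "\<phi> z \<noteq> 1" using R \<open>z \<noteq> 1\<close> by auto
qed

lemma \<phi>_eq:
  assumes z: "z \<in> slit_plane"
  shows "of_real (c0 \<theta>) * \<phi> z ^ 3 = z * ((\<phi> z - of_real (\<theta>1 \<theta>)) * (\<phi> z - of_real (\<theta>2 \<theta>)))"
proof -
  have "(\<phi> z - of_real (\<theta>1 \<theta>)) * (\<phi> z - of_real (\<theta>2 \<theta>)) \<noteq> 0" using \<phi>_ne[OF z] by simp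
  then show ?thesis using \<phi>_R[OF z] unfolding R_map_def by (metis nonzero_divide_eq_eq)
qed

lemma \<phi>_asymptotics:
  obtains C where "C > 0" "\<And>z. C \<le> cmod z \<Longrightarrow> cmod (\<phi> z - z / of_real (c0 \<theta>)) \<le> C"
proof -
  obtain c where "eventually (\<lambda>z. norm (\<phi> z - z / of_real (c0 \<theta>)) \<le> c * norm (1::complex)) at_infinity"
    using is_phi0 unfolding is_phi0_def by (blast elim: landau_o.bigE)
  then obtain b where b: "\<And>z. b \<le> cmod z \<Longrightarrow> cmod (\<phi> z - z / of_real (c0 \<theta>)) \<le> c"
    by (auto simp: eventually_at_infinity)
  show ?thesis
    by (rule that[of "max 1 (max b c)"]) (auto intro!: order.trans[OF b])
qed

lemma \<phi>_real_imp_real: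
  assumes "z \<in> slit_plane" "Im (\<phi> z) = 0"
  shows "Im z = 0"
proof -
  obtain x where x: "\<phi> z = of_real x" using assms(2) by (metis complex_is_Real_iff Reals_cases)
  have "z = of_real (c0 \<theta> * x ^ 3 / ((x - \<theta>1 \<theta>) * (x - \<theta>2 \<theta>)))"
    using \<phi>_R[OF assms(1)] by (simp add: R_map_def x)
  then show ?thesis by (metis Im_complex_of_real)
qed

lemma \<phi>_continuous: "X \<subseteq> slit_plane \<Longrightarrow> continuous_on X \<phi>"
  using \<phi>_holomorphic holomorphic_on_imp_continuous_on continuous_on_subset by blast

text \<open>Since \<open>R_map\<close> has real coefficients, \<open>\<phi>\<close> is nonreal at
  nonreal points. Hence the imaginary part has constant sign on the half-plane, and the behaviour at
  infinity determines it.\<close>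

lemma Im_\<phi>_pos:
  assumes "Im z > 0"
  shows "Im (\<phi> z) > 0"
proof -
  obtain C where C: "C > 0" "\<And>z. C \<le> cmod z \<Longrightarrow> cmod (\<phi> z - z / of_real (c0 \<theta>)) \<le> C"
    by (rule \<phi>_asymptotics) blast
  note c0 = theta_simps(6)[OF \<theta>]
  \<comment> \<open>At height \<open>y\<close> the main term \<open>y / c0 \<theta>\<close> of the
    imaginary part exceeds the error bound \<open>C\<close>.\<close>
  define y where "y = max C ((C + 1) * c0 \<theta>)"
  have y: "y \<ge> C" "y / c0 \<theta> \<ge> C + 1" using c0 by (auto simp: y_def field_simps)
  have sub: "{z. Im z > 0} \<subseteq> slit_plane" by (auto simp: slit_plane_iff)
  show ?thesis
  proof (rule connected_sign[of "{z. Im z > 0}" "\<lambda>z. Im (\<phi> z)" "Complex 0 y"])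
    show "connected {z. Im z > 0}" by (intro convex_connected convex_halfspace_Im_gt)
    show "continuous_on {z. Im z > 0} (\<lambda>z. Im (\<phi> z))" by (intro continuous_intros \<phi>_continuous sub)
    show "Im (\<phi> z) \<noteq> 0" if "z \<in> {z. Im z > 0}" for z using \<phi>_real_imp_real[of z] sub that by auto
    show "Complex 0 y \<in> {z. Im z > 0}" using y C by simp
    have "cmod (Complex 0 y) = y" using y C by (simp add: cmod_def)
    then have "\<bar>Im (\<phi> (Complex 0 y) - Complex 0 y / of_real (c0 \<theta>))\<bar> \<le> C"
      using C(2)[of "Complex 0 y"] y(1) abs_Im_le_cmod order.trans by metis
    then show "Im (\<phi> (Complex 0 y)) > 0" using y by (simp add: Im_divide_of_real)
  qed (use assms in auto)
qed

lemma Im_\<phi>_neg: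
  assumes "Im z < 0"
  shows "Im (\<phi> z) < 0"
proof -
  obtain C where C: "C > 0" "\<And>z. C \<le> cmod z \<Longrightarrow> cmod (\<phi> z - z / of_real (c0 \<theta>)) \<le> C"
    by (rule \<phi>_asymptotics) blast
  note c0 = theta_simps(6)[OF \<theta>]
  define y where "y = max C ((C + 1) * c0 \<theta>)"
  have y: "y \<ge> C" "y / c0 \<theta> \<ge> C + 1" using c0 by (auto simp: y_def field_simps)
  have sub: "{z. Im z < 0} \<subseteq> slit_plane" by (auto simp: slit_plane_iff)
  have "- Im (\<phi> z) > 0"
  proof (rule connected_sign[of "{z. Im z < 0}" "\<lambda>z. - Im (\<phi> z)" "Complex 0 (- y)"])
    show "connected {z. Im z < 0}" by (intro convex_connected convex_halfspace_Im_lt)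
    show "continuous_on {z. Im z < 0} (\<lambda>z. - Im (\<phi> z))" by (intro continuous_intros \<phi>_continuous sub)
    show "- Im (\<phi> z) \<noteq> 0" if "z \<in> {z. Im z < 0}" for z using \<phi>_real_imp_real[of z] sub that by auto
    show "Complex 0 (- y) \<in> {z. Im z < 0}" using y C by simp
    have "cmod (Complex 0 (- y)) = y" using y C by (simp add: cmod_def)
    then have "\<bar>Im (\<phi> (Complex 0 (- y)) - Complex 0 (- y) / of_real (c0 \<theta>))\<bar> \<le> C"
      using C(2)[of "Complex 0 (- y)"] y(1) abs_Im_le_cmod order.trans by metis
    then show "- Im (\<phi> (Complex 0 (- y))) > 0" using y by (simp add: Im_divide_of_real)
  qed (use assms in auto)
  then show ?thesis by simp
qed

text \<open>On the real part of the slit plane \<open>Im (\<phi> x)\<close> is a limit of positive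
  values from above and of negative values from below.\<close>

lemma \<phi>_real:
  assumes "of_real x \<in> slit_plane"
  shows "Im (\<phi> (of_real x)) = 0"
proof -
  have cont: "isCont \<phi> (of_real x)"
    using \<phi>_continuous[of slit_plane] open_slit_plane assms continuous_on_eq_continuous_at by blast
  have lim: "((\<lambda>t. Im (\<phi> (of_real x + of_real t * c))) \<longlongrightarrow> Im (\<phi> (of_real x))) (at_right (0::real))" for c
  proof (rule tendsto_Im, rule isCont_tendsto_compose[OF cont])
    have "((\<lambda>t. of_real x + of_real t * c) \<longlongrightarrow> of_real x + of_real 0 * c) (at_right (0::real))"
      by (intro tendsto_intros)
    then show "((\<lambda>t. of_real x + of_real t * c) \<longlongrightarrow> of_real x) (at_right (0::real))" by simp
  qed
  have ev: "eventually (\<lambda>t::real. t > 0) (at_right 0)" by (simp add: eventually_at_right_less)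
  have "Im (\<phi> (of_real x)) \<ge> 0"
    by (rule tendsto_lowerbound[OF lim[of \<i>]])
       (use ev in \<open>auto elim!: eventually_mono intro!: less_imp_le Im_\<phi>_pos\<close>)
  moreover have "Im (\<phi> (of_real x)) \<le> 0"
    by (rule tendsto_upperbound[OF lim[of "- \<i>"]])
       (use ev in \<open>auto elim!: eventually_mono intro!: less_imp_le Im_\<phi>_neg\<close>)
  ultimately show ?thesis by simp
qed

text \<open>On the half-line \<open>\<phi>\<close> is real, continuous and without zeros, so its
  sign is the one near minus infinity.\<close>

lemma \<phi>_negative:
  assumes "x < (0::real)"
  shows "Re (\<phi> (of_real x)) < 0"
proof -
  obtain C where C: "C > 0" "\<And>z. C \<le> cmod z \<Longrightarrow> cmod (\<phi> z - z / of_real (c0 \<theta>)) \<le> C"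
    by (rule \<phi>_asymptotics) blast
  note c0 = theta_simps(6)[OF \<theta>]
  define y where "y = max C ((C + 1) * c0 \<theta>)"
  have y: "y \<ge> C" "y / c0 \<theta> \<ge> C + 1" using c0 by (auto simp: y_def field_simps)
  have slit: "of_real x \<in> slit_plane" if "x < 0" for x :: real using that by (simp add: slit_plane_iff)
  have "- Re (\<phi> (of_real x)) > 0"
  proof (rule connected_sign[of "{..<0}" "\<lambda>x. - Re (\<phi> (of_real x))" "- y"])
    show "continuous_on {..<0} (\<lambda>x. - Re (\<phi> (of_real x)))"
      by (intro continuous_intros continuous_on_compose2[OF \<phi>_continuous[of slit_plane]]) (auto simp: slit)
    show "- Re (\<phi> (of_real x)) \<noteq> 0" if "x \<in> {..<0}" for x
      using \<phi>_ne(1)[OF slit] \<phi>_real[OF slit] that by (auto simp: complex_eq_iff)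
    have "\<bar>Re (\<phi> (of_real (- y)) - of_real (- y) / of_real (c0 \<theta>))\<bar> \<le> C"
      using C(2)[of "of_real (- y)"] y(1) C(1) abs_Re_le_cmod order.trans
      by (metis abs_minus_cancel abs_of_pos norm_of_real order_less_le_trans)
    then show "- Re (\<phi> (of_real (- y))) > 0" using y by (simp add: Re_divide_of_real)
  qed (use assms y C in auto)
  then show ?thesis by simp
qed

lemma \<phi>_greater:
  assumes "x > (1::real)" and c: "c \<in> {0, \<theta>1 \<theta>, \<theta>2 \<theta>}"
  shows "Re (\<phi> (of_real x)) > c"
proof -
  obtain C where C: "C > 0" "\<And>z. C \<le> cmod z \<Longrightarrow> cmod (\<phi> z - z / of_real (c0 \<theta>)) \<le> C"
    by (rule \<phi>_asymptotics) blast
  note c0 = theta_simps(6)[OF \<theta>]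
  define y where "y = max (max C 2) ((C + 1 + c) * c0 \<theta>)"
  have y: "y \<ge> C" "y > 1" "y / c0 \<theta> \<ge> C + 1 + c" using c0 by (auto simp: y_def field_simps)
  have slit: "of_real x \<in> slit_plane" if "x > 1" for x :: real using that by (simp add: slit_plane_iff)
  have "Re (\<phi> (of_real x)) - c > 0"
  proof (rule connected_sign[of "{1<..}" "\<lambda>x. Re (\<phi> (of_real x)) - c" y])
    show "continuous_on {1<..} (\<lambda>x. Re (\<phi> (of_real x)) - c)"
      by (intro continuous_intros continuous_on_compose2[OF \<phi>_continuous[of slit_plane]]) (auto simp: slit)
    show "Re (\<phi> (of_real x)) - c \<noteq> 0" if "x \<in> {1<..}" for x
      using \<phi>_ne(1-3)[OF slit] \<phi>_real[OF slit] that c by (auto simp: complex_eq_iff)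
    have "\<bar>Re (\<phi> (of_real y) - of_real y / of_real (c0 \<theta>))\<bar> \<le> C"
      using C(2)[of "of_real y"] y(1) C(1) abs_Re_le_cmod order.trans
      by (metis abs_of_pos norm_of_real order_less_le_trans)
    then show "Re (\<phi> (of_real y)) - c > 0" using y by (simp add: Re_divide_of_real)
  qed (use assms y in auto)
  then show ?thesis by simp
qed

text \<open>This allows principal logarithms of \<open>\<phi> z - c\<close>, \<open>\<phi> z\<close>
  and \<open>z\<close> to be subtracted without a multiple of \<open>2 * pi * \<i>\<close>, on the
  negative axis as well.\<close>

lemma same_side_\<phi>:
  assumes z: "z \<in> slit_plane" and c: "c \<in> {0, \<theta>1 \<theta>, \<theta>2 \<theta>}"
  shows "same_side (\<phi> z - of_real c) (\<phi> z)" "same_side (\<phi> z) z"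
proof -
  have c0: "c \<ge> 0" using c theta_simps(4,5)[OF \<theta>] by auto
  consider "Im z > 0" | "Im z < 0" | "z = of_real (Re z)" "Re z < 0" | "z = of_real (Re z)" "Re z > 1"
    using z by (cases "Im z" "0::real" rule: linorder_cases) (auto simp: slit_plane_iff complex_eq_iff)
  then have "same_side (\<phi> z - of_real c) (\<phi> z) \<and> same_side (\<phi> z) z"
  proof cases
    case 3
    then have "Im (\<phi> z) = 0" "Re (\<phi> z) < 0" "Im z = 0"
      using \<phi>_negative[of "Re z"] \<phi>_real[of "Re z"] z by (metis, metis, metis Im_complex_of_real)
    then show ?thesis using c0 3 by (simp add: same_side_def)
  next
    case 4
    then have "Im (\<phi> z) = 0" "Re (\<phi> z) > c" "Im z = 0"
      using \<phi>_greater[of "Re z", OF _ c] \<phi>_real[of "Re z"] z by (metis, metis, metis Im_complex_of_real)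
    then show ?thesis using c0 4 by (simp add: same_side_def)
  qed (auto simp: same_side_def Im_\<phi>_pos Im_\<phi>_neg)
  then show "same_side (\<phi> z - of_real c) (\<phi> z)" "same_side (\<phi> z) z" by auto
qed

text \<open>\<open>3 * \<theta>1 * \<theta>2\<close> lies strictly between 0 and
  \<open>\<theta>1\<close>; at this value \<open>\<phi> - \<theta>1\<close> would be negative and
  \<open>\<phi>\<close> positive.\<close>

lemma \<phi>_ne_kappa:
  assumes z: "z \<in> slit_plane"
  shows "\<phi> z \<noteq> of_real (3 * \<theta>1 \<theta> * \<theta>2 \<theta>)"
proof
  assume eq: "\<phi> z = of_real (3 * \<theta>1 \<theta> * \<theta>2 \<theta>)"
  have ss: "same_side (\<phi> z - of_real (\<theta>1 \<theta>)) (\<phi> z)" using z by (intro same_side_\<phi>) auto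
  have "\<phi> z - of_real (\<theta>1 \<theta>) = of_real (3 * \<theta>1 \<theta> * \<theta>2 \<theta> - \<theta>1 \<theta>)" by (simp add: eq)
  moreover have "3 * \<theta>1 \<theta> * \<theta>2 \<theta> > 0" using theta_simps(4,5)[OF \<theta>] by simp
  ultimately show False using ss theta_simps(7)[OF \<theta>]
    unfolding same_side_def eq by (simp only: Re_complex_of_real Im_complex_of_real) linarith
qed

section \<open>The branch in the variable \<open>w = 1 / z\<close>\<close>

definition \<psi> :: "complex \<Rightarrow> complex" where
  "\<psi> w = (if w = 0 then 0 else 1 / \<phi> (1 / w))"

lemma \<psi>_tendsto_0: "(\<psi> \<longlongrightarrow> 0) (at 0 within X)"
proof -
  obtain C where C: "C > 0" "\<And>z. C \<le> cmod z \<Longrightarrow> cmod (\<phi> z - z / of_real (c0 \<theta>)) \<le> C"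
    by (rule \<phi>_asymptotics) blast
  note c0 = theta_simps(6)[OF \<theta>]
  \<comment> \<open>The first bound gives \<open>C \<le> 1 / cmod w\<close>, so the asymptotics
    apply; the second makes the error \<open>C\<close> at most half of the main term
    \<open>1 / (c0 * cmod w)\<close>.\<close>
  define d where "d = min (1 / C) (1 / (2 * c0 \<theta> * C))"
  have d: "d > 0" using C c0 by (simp add: d_def)
  have bound: "cmod (\<psi> w) \<le> 2 * c0 \<theta> * cmod w" if w: "cmod w < d" for w
  proof (cases "w = 0")
    case False
    then have "cmod w > 0" by simp
    have "cmod w \<le> 1 / C" "cmod w \<le> 1 / (2 * c0 \<theta> * C)" using w by (auto simp: d_def)
    then have le: "C \<le> 1 / cmod w" "C \<le> 1 / (2 * c0 \<theta> * cmod w)"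
      using C c0 \<open>cmod w > 0\<close> by (simp_all add: field_simps)
    then have "cmod (\<phi> (1 / w) - 1 / w / of_real (c0 \<theta>)) \<le> C" by (intro C(2)) (simp add: norm_divide)
    moreover have "cmod (1 / w / of_real (c0 \<theta>)) = 2 * (1 / (2 * c0 \<theta> * cmod w))"
      using c0 by (simp add: norm_divide norm_mult)
    ultimately have "1 / (2 * c0 \<theta> * cmod w) \<le> cmod (\<phi> (1 / w))"
      using le(2) norm_triangle_ineq2[of "1 / w / of_real (c0 \<theta>)" "\<phi> (1 / w)"]
      by (simp add: norm_minus_commute)
    moreover from this have "cmod (\<phi> (1 / w)) > 0"
      using c0 \<open>cmod w > 0\<close> by (elim order.strict_trans2[rotated]) simp
    ultimately show ?thesis
      using False c0 \<open>cmod w > 0\<close> by (simp add: \<psi>_def norm_divide field_simps)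
  qed (simp add: \<psi>_def)
  show ?thesis
  proof (rule Lim_null_comparison[where g = "\<lambda>w. 2 * c0 \<theta> * cmod w"])
    show "eventually (\<lambda>w. norm (\<psi> w) \<le> 2 * c0 \<theta> * cmod w) (at 0 within X)"
      using bound d by (auto simp: eventually_at dist_norm)
    have "((\<lambda>w::complex. 2 * c0 \<theta> * cmod w) \<longlongrightarrow> 2 * c0 \<theta> * cmod 0) (at 0 within X)"
      by (intro tendsto_intros)
    then show "((\<lambda>w::complex. 2 * c0 \<theta> * cmod w) \<longlongrightarrow> 0) (at 0 within X)" by simp
  qed
qed

lemma \<psi>_holomorphic: "\<psi> holomorphic_on cut_plane"
proof (rule no_isolated_singularity'[of "{0}"])
  show "(\<psi> \<longlongrightarrow> \<psi> z) (at z within cut_plane)" if "z \<in> {0}" for z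
    using that \<psi>_tendsto_0 by (simp add: \<psi>_def)
  have "(\<phi> \<circ> (\<lambda>w. 1 / w)) holomorphic_on cut_plane - {0}"
    by (rule holomorphic_on_compose_gen[OF _ \<phi>_holomorphic])
       (auto intro!: holomorphic_intros inverse_in_slit_plane)
  then have "(\<lambda>w. 1 / \<phi> (1 / w)) holomorphic_on cut_plane - {0}"
    using \<phi>_ne(1)[OF inverse_in_slit_plane] by (auto intro!: holomorphic_intros simp: o_def)
  then show "\<psi> holomorphic_on cut_plane - {0}"
    by (rule holomorphic_transform) (simp add: \<psi>_def)
qed (auto simp: open_cut_plane)

abbreviation "th \<equiv> complex_of_real \<theta>"
abbreviation "t1 \<equiv> complex_of_real (\<theta>1 \<theta>)"
abbreviation "t2 \<equiv> complex_of_real (\<theta>2 \<theta>)"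

lemma complex_theta_simps:
  "(4 - th) * t1 = 2 - th" "(2 + th) * t2 = th" "(4 - th) * (2 + th) * of_real (c0 \<theta>) = 4"
  "4 - th \<noteq> 0" "2 + th \<noteq> 0"
proof -
  show "(4 - th) * t1 = 2 - th" "(2 + th) * t2 = th" "(4 - th) * (2 + th) * of_real (c0 \<theta>) = 4"
    using theta_simps(1-3)[OF \<theta>, THEN arg_cong[where f = complex_of_real]] by simp_all
  show "4 - th \<noteq> 0" "2 + th \<noteq> 0"
    using \<theta> by (auto simp: complex_eq_iff)
qed

lemma \<psi>_factor:
  "(4 - th) - (2 - th) * \<psi> w = (4 - th) * (1 - t1 * \<psi> w)"
  "(2 + th) - th * \<psi> w = (2 + th) * (1 - t2 * \<psi> w)"
  "(4 - th) * (2 + th) - 3 * th * (2 - th) * \<psi> w = (4 - th) * (2 + th) * (1 - 3 * t1 * t2 * \<psi> w)"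
  using complex_theta_simps(1,2) by algebra+

lemma \<psi>_reciprocal:
  assumes "z \<in> slit_plane"
  shows "\<psi> (1 / z) = 1 / \<phi> z"
  using assms by (auto simp: \<psi>_def slit_plane_iff)

lemma \<psi>_cubic:
  assumes w: "w \<in> cut_plane"
  shows "of_real (c0 \<theta>) * w = \<psi> w * ((1 - t1 * \<psi> w) * (1 - t2 * \<psi> w))"
proof (cases "w = 0")
  case False
  have z: "1 / w \<in> slit_plane" using w False by (rule inverse_in_slit_plane)
  define s where "s = \<phi> (1 / w)"
  have s: "s \<noteq> 0" "\<psi> w = 1 / s" using \<phi>_ne(1)[OF z] False by (simp_all add: s_def \<psi>_def)
  have "of_real (c0 \<theta>) * s ^ 3 * w = (s - t1) * (s - t2)"
    using \<phi>_eq[OF z] False by (simp add: s_def)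
  then have "of_real (c0 \<theta>) * w = (s - t1) * (s - t2) / s ^ 3"
    using s(1) by (simp add: nonzero_eq_divide_eq mult_ac)
  also have "\<dots> = \<psi> w * ((1 - t1 * \<psi> w) * (1 - t2 * \<psi> w))"
    using s(1) by (simp add: s(2) field_simps power3_eq_cube)
  finally show ?thesis .
qed (simp add: \<psi>_def)

text \<open>\<open>1 - c * \<psi>\<close> is the quotient \<open>(\<phi> - c) / \<phi>\<close> of
  two numbers on the same side of the cut. It makes the principal logarithms of
  \<open>A / (4 - th)\<close> and \<open>B / (2 + th)\<close> holomorphic on the whole cut
  plane.\<close>

lemma \<psi>_not_nonpos:
  assumes w: "w \<in> cut_plane"
  shows "1 - t1 * \<psi> w \<notin> \<real>\<^sub>\<le>\<^sub>0" "1 - t2 * \<psi> w \<notin> \<real>\<^sub>\<le>\<^sub>0"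
proof -
  have "1 - of_real c * \<psi> w \<notin> \<real>\<^sub>\<le>\<^sub>0" if c: "c \<in> {0, \<theta>1 \<theta>, \<theta>2 \<theta>}" for c
  proof (cases "w = 0")
    case False
    have z: "1 / w \<in> slit_plane" using w False by (rule inverse_in_slit_plane)
    then have "1 - of_real c * \<psi> w = (\<phi> (1 / w) - of_real c) / \<phi> (1 / w)"
      using \<phi>_ne(1)[OF z] False by (simp add: \<psi>_def field_simps)
    then show ?thesis using same_side_Ln_divide(2)[OF same_side_\<phi>(1)[OF z c]] by simp
  qed (simp add: \<psi>_def)
  then show "1 - t1 * \<psi> w \<notin> \<real>\<^sub>\<le>\<^sub>0" "1 - t2 * \<psi> w \<notin> \<real>\<^sub>\<le>\<^sub>0" by auto
qed

sublocale inverse_branch th \<psi>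
proof
  show "\<psi> holomorphic_on cut_plane" by (rule \<psi>_holomorphic)
  show "\<psi> 0 = 0" by (simp add: \<psi>_def)
  fix w assume w: "w \<in> cut_plane"
  show "4 * w = \<psi> w * ((4 - th) - (2 - th) * \<psi> w) * ((2 + th) - th * \<psi> w)"
    unfolding \<psi>_factor using \<psi>_cubic[OF w] complex_theta_simps(3) by algebra
  show "\<psi> w \<noteq> 1"
    using \<phi>_ne(4)[OF inverse_in_slit_plane[OF w]] by (auto simp: \<psi>_def)
  have "1 - t1 * \<psi> w \<noteq> 0" "1 - t2 * \<psi> w \<noteq> 0" using \<psi>_not_nonpos[OF w] by (metis nonpos_Reals_zero_I)+
  then show "(4 - th) - (2 - th) * \<psi> w \<noteq> 0" "(2 + th) - th * \<psi> w \<noteq> 0"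
    unfolding \<psi>_factor using complex_theta_simps(4,5) by auto
  have "1 - 3 * t1 * t2 * \<psi> w \<noteq> 0"
  proof (cases "w = 0")
    case False
    then show ?thesis
      using \<phi>_ne_kappa[OF inverse_in_slit_plane[OF w]] \<phi>_ne(1)[OF inverse_in_slit_plane[OF w]]
      by (auto simp: \<psi>_def field_simps)
  qed (simp add: \<psi>_def)
  then show "(4 - th) * (2 + th) - 3 * th * (2 - th) * \<psi> w \<noteq> 0"
    unfolding \<psi>_factor using complex_theta_simps(4,5) by auto
qed

section \<open>Logarithms and the square root on the cut plane\<close>

definition "L1 w = Ln (1 - t1 * \<psi> w)"
definition "L2 w = Ln (1 - t2 * \<psi> w)"

lemma L_holomorphic: "L1 holomorphic_on cut_plane" "L2 holomorphic_on cut_plane"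
  unfolding L1_def L2_def using \<psi>_not_nonpos by (auto intro!: holomorphic_intros \<psi>_holomorphic)

lemma L_0: "L1 0 = 0" "L2 0 = 0"
  by (simp_all add: L1_def L2_def \<psi>_def)

lemma exp_L:
  assumes w: "w \<in> cut_plane"
  shows "exp (L1 w) = 1 - t1 * \<psi> w" "exp (L2 w) = 1 - t2 * \<psi> w"
proof -
  have "1 - t1 * \<psi> w \<noteq> 0" "1 - t2 * \<psi> w \<noteq> 0" using \<psi>_not_nonpos[OF w] by (metis nonpos_Reals_zero_I)+
  then show "exp (L1 w) = 1 - t1 * \<psi> w" "exp (L2 w) = 1 - t2 * \<psi> w"
    by (simp_all add: L1_def L2_def)
qed

lemma Ln_\<phi>_diff:
  assumes z: "z \<in> slit_plane"
  shows "Ln (\<phi> z - t1) = Ln (\<phi> z) + L1 (1 / z)" "Ln (\<phi> z - t2) = Ln (\<phi> z) + L2 (1 / z)"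
proof -
  have "1 - of_real c * \<psi> (1 / z) = (\<phi> z - of_real c) / \<phi> z" for c
    using \<phi>_ne(1)[OF z] by (simp add: \<psi>_reciprocal[OF z] field_simps)
  then show "Ln (\<phi> z - t1) = Ln (\<phi> z) + L1 (1 / z)" "Ln (\<phi> z - t2) = Ln (\<phi> z) + L2 (1 / z)"
    using same_side_Ln_divide(1)[OF same_side_\<phi>(1)[OF z, of "\<theta>1 \<theta>"]]
      same_side_Ln_divide(1)[OF same_side_\<phi>(1)[OF z, of "\<theta>2 \<theta>"]]
    by (simp_all add: L1_def L2_def)
qed

text \<open>Both sides are logarithms of the same function on the connected cut plane, and they agree
  at \<open>0\<close>, that is, at \<open>z = \<infinity>\<close>.\<close>

lemma Ln_z:
  assumes z: "z \<in> slit_plane"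
  shows "Ln z = Ln (\<phi> z) - L1 (1 / z) - L2 (1 / z) + of_real (ln (c0 \<theta>))"
proof -
  note c0 = theta_simps(6)[OF \<theta>]
  define q where "q = (\<lambda>w. (1 - t1 * \<psi> w) * (1 - t2 * \<psi> w))"
  have q_z: "q (1 / z) = of_real (c0 \<theta>) * (\<phi> z / z)" if "z \<in> slit_plane" for z
  proof -
    have "z \<noteq> 0" using that by (auto simp: slit_plane_iff)
    then show ?thesis
      using \<psi>_cubic[OF inverse_in_cut_plane[OF that]] \<phi>_ne(1)[OF that]
      unfolding \<psi>_reciprocal[OF that] q_def by (simp add: field_simps)
  qed
  have q_nonpos: "q w \<notin> \<real>\<^sub>\<le>\<^sub>0" if w: "w \<in> cut_plane" for w
  proof (cases "w = 0")
    case False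
    have z: "1 / w \<in> slit_plane" using w False by (rule inverse_in_slit_plane)
    have "q w = of_real (c0 \<theta>) * (\<phi> (1 / w) / (1 / w))" using q_z[OF z] False by simp
    moreover have "\<phi> (1 / w) / (1 / w) \<notin> \<real>\<^sub>\<le>\<^sub>0"
      by (rule same_side_Ln_divide(2)[OF same_side_\<phi>(2)[OF z, of 0]]) simp
    ultimately show ?thesis using c0
      by (auto simp: complex_nonpos_Reals_iff mult_le_0_iff)
  qed (simp add: q_def \<psi>_def)
  define h where "h = (\<lambda>w. Ln (q w) - L1 w - L2 w)"
  have h_hol: "h holomorphic_on cut_plane"
    unfolding h_def using q_nonpos L_holomorphic \<psi>_holomorphic
    by (intro holomorphic_intros) (auto simp: q_def intro!: holomorphic_intros)
  have exp_h: "exp (h w) = 1" if w: "w \<in> cut_plane" for w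
  proof -
    have "q w \<noteq> 0" using q_nonpos[OF w] by (metis nonpos_Reals_zero_I)
    then have "exp (h w) = q w / exp (L1 w) / exp (L2 w)" by (simp add: h_def exp_diff)
    also have "\<dots> = 1" using \<open>q w \<noteq> 0\<close> by (auto simp: exp_L[OF w] q_def)
    finally show ?thesis .
  qed
  have "(h has_field_derivative 0) (at w)" if w: "w \<in> cut_plane" for w
  proof -
    have dh: "(h has_field_derivative deriv h w) (at w)"
      using h_hol open_cut_plane w by (rule holomorphic_derivI)
    then have "((\<lambda>w. exp (h w)) has_field_derivative exp (h w) * deriv h w) (at w)"
      by (auto intro!: derivative_eq_intros)
    then have "((\<lambda>w. 1) has_field_derivative exp (h w) * deriv h w) (at w)"
      by (rule has_field_derivative_transform_within_open[OF _ open_cut_plane w]) (simp add: exp_h)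
    then have "exp (h w) * deriv h w = 0" using DERIV_unique DERIV_const by blast
    then show ?thesis using dh by simp
  qed
  then obtain c where c: "\<And>w. w \<in> cut_plane \<Longrightarrow> h w = c"
    using DERIV_zero_connected_constant[OF connected_cut_plane open_cut_plane finite.emptyI
        holomorphic_on_imp_continuous_on[OF h_hol]] by blast
  have "h 0 = 0" by (simp add: h_def q_def L_0 \<psi>_def)
  then have "h (1 / z) = 0" using c[OF inverse_in_cut_plane[OF z]] c[OF zero_in_cut_plane] by simp
  then have "L1 (1 / z) + L2 (1 / z) = Ln (of_real (c0 \<theta>) * (\<phi> z / z))"
    using q_z[OF z] by (simp add: h_def algebra_simps)
  also have "\<dots> = of_real (ln (c0 \<theta>)) + Ln (\<phi> z / z)"
    using c0 \<phi>_ne(1)[OF z] z by (subst Ln_times_of_real) (auto simp: slit_plane_iff Ln_of_real)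
  also have "Ln (\<phi> z / z) = Ln (\<phi> z) - Ln z"
    by (rule same_side_Ln_divide(1)[OF same_side_\<phi>(2)[OF z, of 0]]) simp
  finally show ?thesis by (simp add: algebra_simps)
qed

text \<open>\<open>D_poly \<theta> s = s^4 * (1 - 1 / s) * (1 - 3 * \<theta>1 * \<theta>2 /
  s)\<close>, and in the variable \<open>w\<close> the last two factors have no zeros on the simply
  connected cut plane. Their root \<open>E\<close> with \<open>E 0 = 1\<close> agrees with
  \<open>S / \<phi>\<^sup>2\<close> up to a sign, which is constant because the cut plane without 0
  is connected.\<close>

lemma sqrt_D_factor:
  obtains E where "E holomorphic_on cut_plane" "E 0 = 1"
    "\<And>w. w \<in> cut_plane \<Longrightarrow> (4 - th) * (2 + th) * (E w)\<^sup>2 = (1 - \<psi> w) * Q w"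
    "\<And>z. z \<in> slit_plane \<Longrightarrow> S z = (\<phi> z)\<^sup>2 * E (1 / z)"
proof -
  define F where "F = (\<lambda>w. (1 - \<psi> w) * (1 - 3 * t1 * t2 * \<psi> w))"
  have Q: "Q w = (4 - th) * (2 + th) * (1 - 3 * t1 * t2 * \<psi> w)" for w
    unfolding Q_def \<psi>_factor ..
  have F_ne: "F w \<noteq> 0" if "w \<in> cut_plane" for w
    using ne(1,4)[OF that] complex_theta_simps(4,5) by (auto simp: F_def Q)
  have F_hol: "F holomorphic_on cut_plane" unfolding F_def by (intro holomorphic_intros \<psi>_holomorphic)
  have F_0: "F 0 = 1" by (simp add: F_def \<psi>_def)
  have "simply_connected cut_plane"
    unfolding cut_plane_def by (rule simply_connected_slotted_complex_plane_right)
  then obtain E0 where E0: "E0 holomorphic_on cut_plane" "\<And>w. w \<in> cut_plane \<Longrightarrow> F w = (E0 w)\<^sup>2"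
    using F_hol F_ne simply_connected_eq_holomorphic_sqrt[OF open_cut_plane] by metis
  define E where "E = (\<lambda>w. E0 w / E0 0)"
  have E00: "(E0 0)\<^sup>2 = 1" using E0(2)[OF zero_in_cut_plane] F_0 by simp
  have E: "E holomorphic_on cut_plane" "E 0 = 1" "\<And>w. w \<in> cut_plane \<Longrightarrow> (E w)\<^sup>2 = F w"
    using E0 E00 by (auto simp: E_def power_divide intro!: holomorphic_intros)
  have S: "S holomorphic_on slit_plane" "\<And>z. z \<in> slit_plane \<Longrightarrow> (S z)\<^sup>2 = D_poly \<theta> (\<phi> z)"
    "eventually (\<lambda>x::real. S (of_real x) \<in> \<real> \<and> 0 < Re (S (of_real x))) at_top"
    using is_sqrt_D by (auto simp: is_sqrt_D_def)
  define \<rho> where "\<rho> = (\<lambda>w. S (1 / w) * (\<psi> w)\<^sup>2 / E w)"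
  have E_ne: "E w \<noteq> 0" if "w \<in> cut_plane" for w using E(3)[OF that] F_ne[OF that] by auto
  have \<rho>_sq: "(\<rho> w)\<^sup>2 = 1" if w: "w \<in> cut_plane - {0}" for w
  proof -
    have z: "1 / w \<in> slit_plane" using w by (auto intro: inverse_in_slit_plane)
    define s where "s = \<phi> (1 / w)"
    have s: "s \<noteq> 0" "\<psi> w = 1 / s" using \<phi>_ne(1)[OF z] w by (auto simp: s_def \<psi>_def)
    have "F w = D_poly \<theta> s * (1 / s) ^ 4"
      using s(1) by (simp add: F_def D_poly_def s(2) field_simps power2_eq_square power4_eq_xxxx)
    then have "(S (1 / w) * (\<psi> w)\<^sup>2)\<^sup>2 = F w"
      using S(2)[OF z] by (simp add: s_def[symmetric] s(2) power_mult_distrib power_divide)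
    then show ?thesis using F_ne[of w] w E(3)[of w] by (simp add: \<rho>_def power_divide)
  qed
  have "\<rho> constant_on (cut_plane - {0})"
  proof (rule continuous_finite_range_constant)
    show "connected (cut_plane - {0})"
      by (intro connected_open_delete open_cut_plane connected_cut_plane) simp
    have "continuous_on (cut_plane - {0}) (\<lambda>w. S (1 / w))"
      by (rule continuous_on_compose2[OF holomorphic_on_imp_continuous_on[OF S(1)]])
         (auto intro!: continuous_intros inverse_in_slit_plane)
    moreover have "continuous_on (cut_plane - {0}) \<psi>" "continuous_on (cut_plane - {0}) E"
      using \<psi>_holomorphic E(1) by (auto intro: holomorphic_on_imp_continuous_on holomorphic_on_subset)
    ultimately show "continuous_on (cut_plane - {0}) \<rho>"
      unfolding \<rho>_def using E_ne by (intro continuous_intros) auto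
    have "\<rho> ` (cut_plane - {0}) \<subseteq> {1, -1}" using \<rho>_sq by (auto simp: power2_eq_1_iff)
    then show "finite (\<rho> ` (cut_plane - {0}))" by (rule finite_subset) simp
  qed
  then obtain c where c: "\<And>w. w \<in> cut_plane - {0} \<Longrightarrow> \<rho> w = c" by (auto simp: constant_on_def)
  have "isCont E 0"
    using E(1) open_cut_plane zero_in_cut_plane holomorphic_on_imp_continuous_on
      continuous_on_eq_continuous_at by blast
  then have "((\<lambda>x::real. E (of_real (inverse x))) \<longlongrightarrow> E 0) at_top"
  proof (rule isCont_tendsto_compose)
    have "((\<lambda>x::real. complex_of_real (inverse x)) \<longlongrightarrow> of_real 0) at_top"
      by (intro tendsto_of_real tendsto_inverse_0_at_top filterlim_ident)
    then show "((\<lambda>x::real. complex_of_real (inverse x)) \<longlongrightarrow> 0) at_top" by simp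
  qed
  then have "((\<lambda>x::real. Re (E (of_real (inverse x)))) \<longlongrightarrow> 1) at_top"
    using E(2) tendsto_Re by fastforce
  then have "eventually (\<lambda>x::real. 0 < Re (E (of_real (inverse x)))) at_top"
    by (rule order_tendstoD) simp
  then have "eventually (\<lambda>x::real. 0 < Re (E (of_real (inverse x))) \<and> S (of_real x) \<in> \<real> \<and> 0 < Re (S (of_real x)) \<and> x > 1) at_top"
    using S(3) eventually_gt_at_top[of "1::real"] by eventually_elim auto
  then obtain x :: real where x: "0 < Re (E (1 / of_real x))" "S (of_real x) \<in> \<real>" "0 < Re (S (of_real x))" "x > 1"
    by (auto simp: eventually_at_top_linorder inverse_eq_divide)
  have xs: "of_real x \<in> slit_plane" using x(4) by (simp add: slit_plane_iff)
  have xw: "1 / of_real x \<in> cut_plane - {0}" using inverse_in_cut_plane[OF xs] x(4) by auto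
  \<comment> \<open>At a large real \<open>x\<close> both \<open>S x\<close> and the real part of
    \<open>E\<close> are positive and \<open>\<phi> x\<close> is real, which excludes the sign
    -1.\<close>
  have "c = 1"
  proof (rule ccontr)
    assume "c \<noteq> 1"
    then have "c = -1" using \<rho>_sq[OF xw] c[OF xw] by (auto simp: power2_eq_1_iff)
    then have "S (of_real x) * (1 / \<phi> (of_real x))\<^sup>2 = - E (1 / of_real x)"
      using c[OF xw] E_ne[of "1 / of_real x"] xw
      by (simp add: \<rho>_def \<psi>_reciprocal[OF xs] nonzero_divide_eq_eq)
    moreover obtain r t where "S (of_real x) = of_real r" "\<phi> (of_real x) = of_real t"
      using x(2) \<phi>_real[OF xs] by (metis Reals_cases complex_is_Real_iff)
    ultimately have "r * (1 / t)\<^sup>2 = - Re (E (1 / of_real x))" "r > 0"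
      using x(3) by (metis Re_complex_of_real of_real_1 of_real_divide of_real_mult of_real_power uminus_complex.sel(1), simp)
    then have "r * (1 / t)\<^sup>2 < 0" using x(1) by simp
    then show False using \<open>r > 0\<close> by (simp add: mult_less_0_iff)
  qed
  have "S z = (\<phi> z)\<^sup>2 * E (1 / z)" if z: "z \<in> slit_plane" for z
  proof -
    have w: "1 / z \<in> cut_plane - {0}" using inverse_in_cut_plane[OF z] z by (auto simp: slit_plane_iff)
    have "S z * (1 / \<phi> z)\<^sup>2 / E (1 / z) = 1"
      using c[OF w] \<open>c = 1\<close> by (simp add: \<rho>_def \<psi>_reciprocal[OF z])
    then show ?thesis using E_ne[of "1 / z"] w \<phi>_ne(1)[OF z] by (simp add: field_simps)
  qed
  moreover have "(4 - th) * (2 + th) * (E w)\<^sup>2 = (1 - \<psi> w) * Q w" if "w \<in> cut_plane" for w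
    using E(3)[OF that] by (simp add: F_def Q)
  ultimately show ?thesis using that E(1,2) by blast
qed

text \<open>All branches are written through \<open>Ln (\<phi> z)\<close>, \<open>L1\<close>,
  \<open>L2\<close> and \<open>ln (c0 \<theta>)\<close>. In the prefactor the multiples of
  \<open>Ln (\<phi> z)\<close> cancel by \<open>1 + (\<alpha>2 - \<alpha>1 + 1) + (2 * \<alpha>1 -
  \<alpha>2) - \<alpha>1 - 2 = 0\<close>, and so do those of \<open>ln (c0 \<theta>)\<close>. In
  \<open>H0_tilde\<close> they are absorbed in \<open>2 * Ln z\<close>, whose multiple by
  \<open>n\<close> exponentiates to an integer power of \<open>z\<close>.\<close>

lemma main_term_eq:
  assumes z: "z \<in> slit_plane" and S: "S z = (\<phi> z)\<^sup>2 * E"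
  shows "prefactor \<alpha>1 \<alpha>2 \<theta> \<phi> S z * exp (of_nat n * H0_tilde \<theta> \<phi> z) =
    z ^ (2 * n) * (exp ((of_nat n * (4 - th) + of_real \<alpha>1 + 1) * L1 (1 / z)
      + (of_nat n * (2 + th) + of_real \<alpha>2 + 1) * L2 (1 / z)) / E)"
proof -
  note c0 = theta_simps(6)[OF \<theta>]
  define l0 l1 l2 lc where "l0 = Ln (\<phi> z)" and "l1 = L1 (1 / z)" and "l2 = L2 (1 / z)"
    and "lc = complex_of_real (ln (c0 \<theta>))"
  have z0: "z \<noteq> 0" using z by (auto simp: slit_plane_iff)
  have lz: "Ln z = l0 - l1 - l2 + lc" using Ln_z[OF z] by (simp add: l0_def l1_def l2_def lc_def)
  have d1: "Ln (\<phi> z - t1) = l0 + l1" and d2: "Ln (\<phi> z - t2) = l0 + l2"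
    using Ln_\<phi>_diff[OF z] by (simp_all add: l0_def l1_def l2_def)
  have e0: "\<phi> z = exp l0" and e1: "\<phi> z - t1 = exp (l0 + l1)"
    using \<phi>_ne[OF z] d1 by (simp add: l0_def, metis exp_Ln eq_iff_diff_eq_0)
  have "4 powr \<alpha>1 / ((2 + \<theta>) * (4 - \<theta>)) powr \<alpha>1 = c0 \<theta> powr \<alpha>1"
    using \<theta> by (simp add: c0_def powr_divide)
  also have "\<dots> = exp (\<alpha>1 * ln (c0 \<theta>))" using c0 by (simp add: powr_def)
  finally have "of_real (4 powr \<alpha>1) / of_real (((2 + \<theta>) * (4 - \<theta>)) powr \<alpha>1) = exp (of_real \<alpha>1 * lc)"
    by (metis exp_of_real lc_def of_real_divide of_real_mult)
  then have p1: "of_real (4 powr \<alpha>1) * (\<phi> z - t1) / of_real (((2 + \<theta>) * (4 - \<theta>)) powr \<alpha>1)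
      = exp (of_real \<alpha>1 * lc) * exp (l0 + l1)"
    by (metis e1 times_divide_eq_left)
  have p2: "(\<phi> z - t2) powr of_real (\<alpha>2 - \<alpha>1 + 1) = exp (of_real (\<alpha>2 - \<alpha>1 + 1) * (l0 + l2))"
    "\<phi> z powr of_real (2 * \<alpha>1 - \<alpha>2) = exp (of_real (2 * \<alpha>1 - \<alpha>2) * l0)"
    "z powr of_real \<alpha>1 = exp (of_real \<alpha>1 * (l0 - l1 - l2 + lc))"
    using \<phi>_ne[OF z] z0 by (simp_all add: powr_def d2 lz l0_def[symmetric])
  have "prefactor \<alpha>1 \<alpha>2 \<theta> \<phi> S z = exp (of_real \<alpha>1 * lc) * exp (l0 + l1) *
      (exp (of_real (\<alpha>2 - \<alpha>1 + 1) * (l0 + l2)) * exp (of_real (2 * \<alpha>1 - \<alpha>2) * l0)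
        / (exp (of_real \<alpha>1 * (l0 - l1 - l2 + lc)) * (exp l0 ^ 2 * E)))"
    unfolding prefactor_def p1 p2 S unfolding e0 ..
  also have "\<dots> = exp (of_real \<alpha>1 * lc + (l0 + l1) + of_real (\<alpha>2 - \<alpha>1 + 1) * (l0 + l2)
      + of_real (2 * \<alpha>1 - \<alpha>2) * l0 - of_real \<alpha>1 * (l0 - l1 - l2 + lc) - 2 * l0) / E"
    unfolding exp_diff exp_add exp_double by (simp add: divide_inverse mult_ac)
  also have "of_real \<alpha>1 * lc + (l0 + l1) + of_real (\<alpha>2 - \<alpha>1 + 1) * (l0 + l2)
      + of_real (2 * \<alpha>1 - \<alpha>2) * l0 - of_real \<alpha>1 * (l0 - l1 - l2 + lc) - 2 * l0
      = (of_real \<alpha>1 + 1) * l1 + (of_real \<alpha>2 + 1) * l2"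
    by (simp add: algebra_simps)
  finally have pre: "prefactor \<alpha>1 \<alpha>2 \<theta> \<phi> S z = exp ((of_real \<alpha>1 + 1) * l1 + (of_real \<alpha>2 + 1) * l2) / E" .
  have "C_const \<theta> - C0_const \<theta> = 2 * ln (c0 \<theta>)"
    using c0 by (simp add: C0_const_def ln_div)
  then have C: "of_real (C_const \<theta>) - of_real (C0_const \<theta>) = 2 * lc"
    unfolding lc_def by (metis of_real_diff of_real_mult of_real_numeral)
  have "H0_tilde \<theta> \<phi> z = (2 - th) * (l0 + l1) + th * (l0 + l2) + (of_real (C_const \<theta>) - of_real (C0_const \<theta>))"
    by (simp add: H0_tilde_def H0_def d1 d2)
  also have "\<dots> = 2 * Ln z + (4 - th) * l1 + (2 + th) * l2"
    unfolding C lz by (simp add: algebra_simps)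
  finally have H: "H0_tilde \<theta> \<phi> z = 2 * Ln z + (4 - th) * l1 + (2 + th) * l2" .
  have "exp (of_nat n * H0_tilde \<theta> \<phi> z)
      = exp (of_nat (2 * n) * Ln z + (of_nat n * (4 - th) * l1 + of_nat n * (2 + th) * l2))"
    unfolding H by (simp add: algebra_simps)
  also have "\<dots> = z ^ (2 * n) * exp (of_nat n * (4 - th) * l1 + of_nat n * (2 + th) * l2)"
    unfolding exp_add exp_of_nat_mult using z0 by simp
  finally have "exp (of_nat n * H0_tilde \<theta> \<phi> z)
      = z ^ (2 * n) * exp (of_nat n * (4 - th) * l1 + of_nat n * (2 + th) * l2)" .
  then have "prefactor \<alpha>1 \<alpha>2 \<theta> \<phi> S z * exp (of_nat n * H0_tilde \<theta> \<phi> z)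
      = z ^ (2 * n) * (exp (of_nat n * (4 - th) * l1 + of_nat n * (2 + th) * l2
          + ((of_real \<alpha>1 + 1) * l1 + (of_real \<alpha>2 + 1) * l2)) / E)"
    unfolding pre exp_add by simp
  then show ?thesis by (simp add: l1_def l2_def algebra_simps)
qed

end

section \<open>The asymptotic formula\<close>

lemma MOP_reflect_factorization:
  assumes "\<alpha>1 > -1" "\<alpha>2 > -1" "\<alpha>1 - \<alpha>2 \<notin> \<int>" "is_monic_MOP \<alpha>1 \<alpha>2 n1 n2 P"
  obtains rs :: "real list" where "set rs \<subseteq> {0..1}" "length rs = n1 + n2"
    "reflect_poly P = (\<Prod>r\<leftarrow>rs. [:1, - of_real r:])"
proof -
  obtain rs :: "real list" where rs: "set rs \<subseteq> {0..1}" "length rs = n1 + n2"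
    "P = (\<Prod>r\<leftarrow>rs. [:- of_real r, 1:])"
    using MOP_factorization[OF assms] by blast
  have "reflect_poly [:- complex_of_real r, 1:] = [:1, - of_real r:]" for r
    by (rule poly_eqI) (auto simp: coeff_reflect_poly coeff_pCons split: nat.splits)
  then have "reflect_poly P = (\<Prod>r\<leftarrow>rs. [:1, - of_real r:])"
    unfolding rs(3) reflect_poly_prod_list by (simp add: o_def)
  then show ?thesis using rs(1,2) that by blast
qed

text \<open>Coefficients are compared at \<open>w^(l + 1)\<close>. With \<open>k = N - l - 1\<close>
  the reversed coefficients are those for \<open>k\<close> and \<open>Suc k\<close>, and
  \<open>MOP_recurrence\<close> applies; two negated factors on the left and three on the right
  account for its sign. At \<open>l = N\<close> the right side vanishes by the factor
  \<open>l - N\<close>, and at \<open>j = 0\<close> the left side by the shift 0.\<close>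

lemma MOP_differential_equation:
  assumes \<alpha>: "\<alpha>1 > -1" "\<alpha>2 > -1" "\<alpha>1 - \<alpha>2 \<notin> \<int>" and P: "is_monic_MOP \<alpha>1 \<alpha>2 n1 n2 P"
  defines "N \<equiv> n1 + n2" and "T \<equiv> reflect_poly P"
  shows "shifted_euler 0 (shifted_euler (- (of_nat (N + n1) + of_real \<alpha>1 + 1))
      (shifted_euler (- (of_nat (N + n2) + of_real \<alpha>2 + 1)) T)) =
    pCons 0 (shifted_euler (- of_nat N) (shifted_euler (- (of_nat N + of_real \<alpha>1))
      (shifted_euler (- (of_nat N + of_real \<alpha>2)) T)))"
proof (rule poly_eqI)
  fix j
  have deg: "degree P = N" using P by (simp add: is_monic_MOP_def N_def)
  have T: "coeff T j = (if j \<le> N then coeff P (N - j) else 0)" for j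
    by (simp add: T_def coeff_reflect_poly deg)
  show "coeff (shifted_euler 0 (shifted_euler (- (of_nat (N + n1) + of_real \<alpha>1 + 1))
      (shifted_euler (- (of_nat (N + n2) + of_real \<alpha>2 + 1)) T))) j =
    coeff (pCons 0 (shifted_euler (- of_nat N) (shifted_euler (- (of_nat N + of_real \<alpha>1))
      (shifted_euler (- (of_nat N + of_real \<alpha>2)) T)))) j"
  proof (cases j)
    case (Suc l)
    consider "l < N" | "l = N" | "l > N" by linarith
    then show ?thesis
    proof cases
      case 1
      define k where "k = N - Suc l"
      have k: "k < n1 + n2" "N = k + Suc l" using 1 by (auto simp: k_def N_def)
      have coeffs: "coeff T (Suc l) = coeff P k" "coeff T l = coeff P (Suc k)"
        using k by (simp_all add: T Suc_diff_le)
      have l: "n1 + n2 - k = Suc l" using k by (simp add: N_def)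
      have factors:
        "of_nat (Suc l) + - (of_nat (N + n1) + complex_of_real \<alpha>1 + 1) = - (of_nat (k + n1) + of_real \<alpha>1 + 1)"
        "of_nat (Suc l) + - (of_nat (N + n2) + complex_of_real \<alpha>2 + 1) = - (of_nat (k + n2) + of_real \<alpha>2 + 1)"
        "of_nat l + - of_nat N = - (of_nat (Suc k) :: complex)"
        "of_nat l + - (of_nat N + complex_of_real \<alpha>1) = - (of_nat (Suc k) + of_real \<alpha>1)"
        "of_nat l + - (of_nat N + complex_of_real \<alpha>2) = - (of_nat (Suc k) + of_real \<alpha>2)"
        by (simp_all add: k(2))
      have signs: "(x + 0) * (- a * (- b * p)) = - y * (- c * (- d * q))"
        if "q * y * c * d = - p * x * a * b" for a b c d p q x y :: complex
        using that by algebra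
      show ?thesis
        unfolding Suc coeff_pCons_Suc coeff_shifted_euler coeffs factors
        by (rule signs) (rule MOP_recurrence[OF \<alpha> P k(1), unfolded l])
    qed (simp_all add: Suc coeff_shifted_euler T)
  qed (simp add: coeff_shifted_euler)
qed

theorem theorem7p1:
  fixes \<alpha>1 \<alpha>2 \<theta> :: real and \<phi>0 S :: "complex \<Rightarrow> complex"
  assumes "\<alpha>1 > -1" and "\<alpha>2 > -1" and "\<alpha>1 - \<alpha>2 \<notin> \<int>"
    and "0 < \<theta>" and "\<theta> < 1"
    and "is_phi0 \<theta> \<phi>0"
    and "is_sqrt_D \<theta> \<phi>0 S"
  shows "\<forall>K. compact K \<and> K \<subseteq> slit_plane \<longrightarrow>
    (\<exists>(M::real) (N::nat). \<forall>n\<ge>N. \<forall>n1 n2 P.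
       n1 + n2 = 2 * n \<and> real n2 / real (n1 + n2) = \<theta> / 2 \<and> is_monic_MOP \<alpha>1 \<alpha>2 n1 n2 P \<longrightarrow>
       (\<forall>z\<in>K. \<exists>\<epsilon>. cmod \<epsilon> \<le> M / real n \<and>
          poly P z = prefactor \<alpha>1 \<alpha>2 \<theta> \<phi>0 S z * exp (of_nat n * H0_tilde \<theta> \<phi>0 z) * (1 + \<epsilon>)))"
proof (intro allI impI)
  fix K assume K: "compact K \<and> K \<subseteq> slit_plane"
  note \<alpha> = assms(1-3)
  interpret phi0_branch \<theta> \<phi>0 S by unfold_locales (use assms in auto)
  \<comment> \<open>The index carries the degrees and the polynomial, so the bounds below are
    uniform over all admissible choices. The condition on the ratio is written without
    division.\<close>
  define I where "I = {(n, n1, n2, P). n > 0 \<and> n1 + n2 = 2 * n \<and> real n2 = \<theta> * real n \<and>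
    is_monic_MOP \<alpha>1 \<alpha>2 n1 n2 P}"
  define T where "T = (\<lambda>(n :: nat, n1 :: nat, n2 :: nat, P :: complex poly). reflect_poly P)"
  define U where "U = (\<lambda>i w. w * poly (pderiv (T i)) w / (of_nat (fst i) * poly (T i) w))"
  have T: "\<exists>rs :: real list. set rs \<subseteq> {0..1} \<and> length rs = 2 * fst i \<and> T i = (\<Prod>r\<leftarrow>rs. [:1, - of_real r:])"
    if "i \<in> I" for i
    using that MOP_reflect_factorization[OF \<alpha>] unfolding I_def T_def by (auto; metis)
  have T_ne: "poly (T i) w \<noteq> 0" if "i \<in> I" "w \<in> cut_plane" for i w
    using T[OF that(1)] poly_prod_one_minus_ne_zero[OF _ that(2)] by auto
  have T_0: "poly (T i) 0 = 1" if "i \<in> I" for i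
    using that by (auto simp: I_def T_def is_monic_MOP_def)
  have n_pos: "fst i > 0" if "i \<in> I" for i using that by (auto simp: I_def)
  have U_hol: "U i holomorphic_on cut_plane" if "i \<in> I" for i
    unfolding U_def using T_ne[OF that] n_pos[OF that] by (intro holomorphic_intros) auto
  have U_T: "w * poly (pderiv (T i)) w = of_nat (fst i) * U i w * poly (T i) w" if "i \<in> I" "w \<in> cut_plane" for i w
    using T_ne[OF that] n_pos[OF that(1)] by (simp add: U_def)
  interpret riccati_family th \<psi> I fst U "of_real \<alpha>1" "of_real \<alpha>2"
  proof
    fix i assume i: "i \<in> I"
    show "fst i > 0" "U i holomorphic_on cut_plane" "U i 0 = 0"
      using i n_pos U_hol by (auto simp: U_def)
    obtain n n1 n2 P where i_eq: "i = (n, n1, n2, P)" by (cases i) auto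
    have iP: "n > 0" "n1 + n2 = 2 * n" "real n2 = \<theta> * real n" "is_monic_MOP \<alpha>1 \<alpha>2 n1 n2 P"
      using i by (auto simp: I_def i_eq)
    fix w m D1 D2 :: complex
    assume w: "w \<in> cut_plane" and m: "m = of_nat (fst i)" and D: "D1 = w * deriv (U i) w"
      "D2 = w * deriv (\<lambda>z. z * deriv (U i) z) w"
    have "of_nat n2 = th * m" "of_nat (n1 + n2) = 2 * m"
      using iP(2) iP(3)[THEN arg_cong[where f = complex_of_real]] by (simp_all add: m i_eq)
    moreover from this have "of_nat n1 = (2 - th) * m" by (simp add: algebra_simps)
    ultimately have N: "of_nat (n1 + n2) = 2 * m" "of_nat (n1 + n2 + n1) = (4 - th) * m"
      "of_nat (n1 + n2 + n2) = (2 + th) * m"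
      by (simp_all add: algebra_simps)
    have p3: "poly (shifted_euler c3 (shifted_euler c2 (shifted_euler c1 (T i)))) w =
      (m * D2 + m * D1 * (2 * m * U i w + c1 + c2) + (m * U i w + c3) * (m * D1 + (m * U i w + c1) * (m * U i w + c2)))
        * poly (T i) w" for c1 c2 c3
      unfolding m D by (rule poly_shifted_euler_3[OF open_cut_plane w U_hol[OF i]]) (rule U_T[OF i])
    have "poly (shifted_euler 0 (shifted_euler (- (of_nat (n1 + n2 + n1) + of_real \<alpha>1 + 1))
      (shifted_euler (- (of_nat (n1 + n2 + n2) + of_real \<alpha>2 + 1)) (T i)))) w =
      w * poly (shifted_euler (- of_nat (n1 + n2)) (shifted_euler (- (of_nat (n1 + n2) + of_real \<alpha>1))
      (shifted_euler (- (of_nat (n1 + n2) + of_real \<alpha>2)) (T i)))) w"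
      using MOP_differential_equation[OF \<alpha> iP(4)] by (simp add: T_def i_eq)
    then have "(m * D2 + m * D1 * (2 * m * U i w - ((2 + th) * m + of_real \<alpha>2 + 1) - ((4 - th) * m + of_real \<alpha>1 + 1))
         + m * U i w * (m * D1 + (m * U i w - ((2 + th) * m + of_real \<alpha>2 + 1)) * (m * U i w - ((4 - th) * m + of_real \<alpha>1 + 1))))
         * poly (T i) w
       = w * (m * D2 + m * D1 * (2 * m * U i w - (2 * m + of_real \<alpha>2) - (2 * m + of_real \<alpha>1))
         + (m * U i w - 2 * m) * (m * D1 + (m * U i w - (2 * m + of_real \<alpha>2)) * (m * U i w - (2 * m + of_real \<alpha>1))))
         * poly (T i) w"
      unfolding p3 N by algebra
    then show "m * D2 + m * D1 * (2 * m * U i w - ((2 + th) * m + of_real \<alpha>2 + 1) - ((4 - th) * m + of_real \<alpha>1 + 1))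
         + m * U i w * (m * D1 + (m * U i w - ((2 + th) * m + of_real \<alpha>2 + 1)) * (m * U i w - ((4 - th) * m + of_real \<alpha>1 + 1)))
       = w * (m * D2 + m * D1 * (2 * m * U i w - (2 * m + of_real \<alpha>2) - (2 * m + of_real \<alpha>1))
         + (m * U i w - 2 * m) * (m * D1 + (m * U i w - (2 * m + of_real \<alpha>2)) * (m * U i w - (2 * m + of_real \<alpha>1))))"
      using T_ne[OF i w] by (metis mult_right_cancel)
  next
    show "locally_bounded_family I cut_plane U"
    proof (rule locally_bounded_familyI)
      fix K assume K: "compact K" "K \<subseteq> cut_plane"
      obtain C :: real where C: "\<And>rs w. set rs \<subseteq> {0..1} \<Longrightarrow> w \<in> K \<Longrightarrow>
        cmod (w * poly (pderiv (\<Prod>r\<leftarrow>rs. [:1, - of_real r:])) w / poly (\<Prod>r\<leftarrow>rs. [:1, - of_real r:]) w)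
          \<le> C * length rs"
        using logderiv_prod_one_minus_bound[OF K] by blast
      have "cmod (U i w) \<le> 2 * C" if i: "i \<in> I" and w: "w \<in> K" for i w
      proof -
        obtain rs :: "real list" where rs: "set rs \<subseteq> {0..1}" "length rs = 2 * fst i"
          "T i = (\<Prod>r\<leftarrow>rs. [:1, - of_real r:])"
          using T[OF i] by blast
        have "cmod (U i w) = cmod (w * poly (pderiv (T i)) w / poly (T i) w) / fst i"
          by (simp add: U_def norm_divide norm_mult mult.commute)
        also have "\<dots> \<le> C * (2 * fst i) / fst i"
          using C[OF rs(1) w] rs(2) by (intro divide_right_mono) (simp_all add: rs(3))
        also have "\<dots> = 2 * C" using n_pos[OF i] by simp
        finally show ?thesis .
      qed
      then show "\<exists>C. \<forall>i\<in>I. \<forall>w\<in>K. cmod (U i w) \<le> C" by blast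
    qed
  qed
  obtain E where E: "E holomorphic_on cut_plane" "E 0 = 1"
    "\<And>w. w \<in> cut_plane \<Longrightarrow> (4 - th) * (2 + th) * (E w)\<^sup>2 = (1 - \<psi> w) * Q w"
    "\<And>z. z \<in> slit_plane \<Longrightarrow> S z = (\<phi>0 z)\<^sup>2 * E (1 / z)"
    by (rule sqrt_D_factor) blast
  define X where "X = (\<lambda>n w. exp ((of_nat n * (4 - th) + of_real \<alpha>1 + 1) * L1 w
    + (of_nat n * (2 + th) + of_real \<alpha>2 + 1) * L2 w))"
  have bounded: "locally_bounded_family I cut_plane (\<lambda>i w. of_nat (fst i) * (poly (T i) w * E w / X (fst i) w - 1))"
    unfolding X_def
  proof (rule quotient_asymptotics[where T = "\<lambda>i. poly (T i)", OF L_holomorphic(1) L_0(1) _ L_holomorphic(2) L_0(2) _ E(1-3)])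
    show "(4 - th) * exp (L1 w) = A w" "(2 + th) * exp (L2 w) = B w" if "w \<in> cut_plane" for w
      using exp_L[OF that] by (simp_all add: A_def B_def \<psi>_factor)
    show "w * deriv (poly (T i)) w = of_nat (fst i) * U i w * poly (T i) w" if "i \<in> I" "w \<in> cut_plane" for i w
      using U_T[OF that] by (simp add: DERIV_imp_deriv[OF poly_DERIV])
  qed (auto simp: T_0 T_ne intro!: holomorphic_intros)
  have "compact ((\<lambda>z. 1 / z) ` K)" "(\<lambda>z. 1 / z) ` K \<subseteq> cut_plane"
    using K inverse_in_cut_plane
    by (auto intro!: compact_continuous_image continuous_intros simp: slit_plane_iff subset_iff; fail)+
  from locally_bounded_familyE[OF bounded this] obtain C where
    C: "\<And>i z. i \<in> I \<Longrightarrow> z \<in> K \<Longrightarrow> cmod (of_nat (fst i) * (poly (T i) (1 / z) * E (1 / z) / X (fst i) (1 / z) - 1)) \<le> C"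
    by (metis image_eqI)
  show "\<exists>(M::real) (N::nat). \<forall>n\<ge>N. \<forall>n1 n2 P.
       n1 + n2 = 2 * n \<and> real n2 / real (n1 + n2) = \<theta> / 2 \<and> is_monic_MOP \<alpha>1 \<alpha>2 n1 n2 P \<longrightarrow>
       (\<forall>z\<in>K. \<exists>\<epsilon>. cmod \<epsilon> \<le> M / real n \<and>
          poly P z = prefactor \<alpha>1 \<alpha>2 \<theta> \<phi>0 S z * exp (of_nat n * H0_tilde \<theta> \<phi>0 z) * (1 + \<epsilon>))"
  proof (intro exI[of _ C] exI[of _ "1 :: nat"] allI impI ballI)
    fix n n1 n2 P z
    assume n: "1 \<le> n" and "n1 + n2 = 2 * n \<and> real n2 / real (n1 + n2) = \<theta> / 2 \<and> is_monic_MOP \<alpha>1 \<alpha>2 n1 n2 P"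
      and zK: "z \<in> K"
    then have n12: "n1 + n2 = 2 * n" and ratio: "real n2 / real (n1 + n2) = \<theta> / 2"
      and MOP: "is_monic_MOP \<alpha>1 \<alpha>2 n1 n2 P"
      by blast+
    have "real n2 / real (2 * n) = \<theta> / 2" using ratio by (simp only: n12)
    then have "real n2 = \<theta> * real n" using n by (simp add: field_simps)
    note P = n12 this MOP
    have z: "z \<in> slit_plane" using zK K by auto
    then have z0: "z \<noteq> 0" by (auto simp: slit_plane_iff)
    have i: "(n, n1, n2, P) \<in> I" using n P by (auto simp: I_def)
    define \<epsilon> where "\<epsilon> = poly (T (n, n1, n2, P)) (1 / z) * E (1 / z) / X n (1 / z) - 1"
    have "real n * cmod \<epsilon> \<le> C"
      using C[OF i zK] by (simp only: \<epsilon>_def norm_mult norm_of_nat fst_conv)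
    then have "cmod \<epsilon> \<le> C / real n" using n by (simp add: field_simps)
    moreover have "degree P = 2 * n" using P(1,3) by (simp add: is_monic_MOP_def)
    then have "z ^ (2 * n) * poly (T (n, n1, n2, P)) (1 / z) = poly P z"
      using z0 by (simp add: T_def poly_reflect_poly_nz power_mult_distrib[symmetric] flip: mult.assoc)
    \<comment> \<open>\<open>E\<close> has no zeros, because \<open>(1 - \<psi>) * Q\<close> has
      none, so the factor \<open>E / X\<close> in the definition of \<open>\<epsilon>\<close>
      cancels against the main term.\<close>
    then have "poly P z = prefactor \<alpha>1 \<alpha>2 \<theta> \<phi>0 S z * exp (of_nat n * H0_tilde \<theta> \<phi>0 z) * (1 + \<epsilon>)"
      unfolding main_term_eq[OF z E(4)[OF z]] X_def[symmetric]
      using E(3)[OF inverse_in_cut_plane[OF z]] ne[OF inverse_in_cut_plane[OF z]]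
      by (auto simp: \<epsilon>_def X_def)
    ultimately show "\<exists>\<epsilon>. cmod \<epsilon> \<le> C / real n \<and>
          poly P z = prefactor \<alpha>1 \<alpha>2 \<theta> \<phi>0 S z * exp (of_nat n * H0_tilde \<theta> \<phi>0 z) * (1 + \<epsilon>)"
      by blast
  qed
qed

end
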